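(* Let $\phi$ be an LTL formula over $P=I\uplus O$ with weight function $w_P:\mathrm{Lit}(P)\to\mathbb{Z}$, let $\nu\in\mathbb{Q}$, and let $w_\nu:\mathrm{Lit}(P)\to\mathbb{Q}$ be a weight function whose extension to letters satisfies $w_\nu(\sigma)=w_P(\sigma)-\nu$ for every $\sigma\in\Sigma_P$. Let $\mathcal{A}$ be a deterministic complete parity automaton with $L(\mathcal A)=[\![\phi]\!]$, and let $G_\phi$ be the game graph built from $\mathcal A$ (as described in the context), with $|S|$ states and $d$ priorities. Then: (1) $\phi$ is MP-realizable under finite memory for threshold $\nu$ (with weights $w_P$) if and only if $\phi$ is E-realizable with weights $w_\nu$; (2) if $\phi$ is MP-realizable under finite memory for threshold $\nu$, Player $O$ has a winning strategy whose memory size is at most $4\cdot|S|^2\cdot d\cdot W$, where $W$ is the largest absolute value of an edge weight of $G_\phi$ when $G_\phi$ is equipped with the edge weights induced by $w_\nu$.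
   Context: $P$ is a finite set of atomic propositions partitioned into inputs $I$ (Player $I$) and outputs $O$ (Player $O$); $\Sigma_P=2^P$, $\Sigma_I=2^I$, $\Sigma_O=2^O$. Game: Player $O$ chooses $o_0\in\Sigma_O$, Player $I$ responds $i_0\in\Sigma_I$, then $o_1$, $i_1$, ...; outcome $(o_0\cup i_0)(o_1\cup i_1)\cdots$. Strategies $\lambda_O:(\Sigma_O\Sigma_I)^*\to\Sigma_O$, $\lambda_I:(\Sigma_O\Sigma_I)^*\Sigma_O\to\Sigma_I$; $\lambda_O$ is finite-memory with memory size $k$ if there is a right-congruence with $k$ classes on $(\Sigma_O\Sigma_I)^*$ on whose classes $\lambda_O$ is constant. A weight function $w$ on $\mathrm{Lit}(P)=P\cup\{\neg p\}$ extends to $\Sigma_I$ by $w(i)=\sum_{p\in i}w(p)+\sum_{p\in I\setminus i}w(\neg p)$, similarly to $\Sigma_O$, and $w(o\cup i)=w(o)+w(i)$. For $u=\sigma_0\sigma_1\cdots$: $\mathsf{EL}(u(n))=\sum_{k<n}w(\sigma_k)$, $\mathsf{MP}(u)=\liminf_n\frac1n\mathsf{EL}(u(n))$, $\mathsf{Val}(u)=\mathsf{MP}(u)$ if $u\models\phi$, else $-\infty$. MP-realizable under finite memory for $\nu$: some finite-memory $\lambda_O$ has $\mathsf{Val}(\mathsf{Outcome}(\lambda_O,\lambda_I))\ge\nu$ for all $\lambda_I$. E-realizable: there exist $\lambda_O$ and $c_0\in\mathbb{N}$ such that for all $\lambda_I$, $u=\mathsf{Outcome}(\lambda_O,\lambda_I)\models\phi$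 and $c_0+\mathsf{EL}(u(n))\ge0$ for all $n$. A deterministic complete parity automaton $\mathcal A=(\Sigma_P,Q,q_0,\delta,p)$ has $\delta:Q\times\Sigma_P\to Q$ and priorities $p:Q\to\mathbb{N}$; it accepts $u$ iff the minimal priority of states visited infinitely often by its run on $u$ is even. The game graph $G_\phi$: Player-1 states $S_1=Q\times\Sigma_I$, Player-2 states $S_2=Q\times\Sigma_O$ (restricted to those reachable from the initial state), initial state $(q_0,j_0)$ for a fixed $j_0\in\Sigma_I$; for each $q\in Q$, $o\in\Sigma_O$, $i\in\Sigma_I$ with $q'=\delta(q,o\cup i)$, there are edges $((q,j),(q,o))$ for all $j\in\Sigma_I$ and $((q,o),(q',i))$; the priority of $(q,x)$ is $p(q)$; given a weight function $w$ on literals, an edge ending in $(q,o)$ has weight $w(o)$ and an edge ending in $(q,i)$ has weight $w(i)$.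
   Formalization: In (2) the bound 4|S|²dW fails for rational or zero weights (φ=true, all w_ν=1/1000 gives a bound below 1), so W is replaced by max(1, bW) for any b≥1 making every b·(edge weight) an integer; for integer edge weights with W≠0 this is the stated bound. *)

theory Defs
  imports Complex_Main "HOL-Library.Extended_Real" "HOL-Library.Liminf_Limsup"
    "HOL-Library.FuncSet" "HOL-Library.Infinite_Set"
begin

subsection \<open>LTL over infinite words\<close>

datatype (atoms: 'p) ltl =
    LTrue
  | LAtom 'p
  | LNot "'p ltl"
  | LOr "'p ltl" "'p ltl"
  | LNext "'p ltl"
  | LUntil "'p ltl" "'p ltl"

primrec sat :: "(nat \<Rightarrow> 'p set) \<Rightarrow> 'p ltl \<Rightarrow> bool"  (infix "\<Turnstile>" 55) where
  "u \<Turnstile> LTrue \<longleftrightarrow> True"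
| "u \<Turnstile> LAtom p \<longleftrightarrow> p \<in> u 0"
| "u \<Turnstile> LNot f \<longleftrightarrow> \<not> (u \<Turnstile> f)"
| "u \<Turnstile> LOr f g \<longleftrightarrow> u \<Turnstile> f \<or> u \<Turnstile> g"
| "u \<Turnstile> LNext f \<longleftrightarrow> (\<lambda>n. u (Suc n)) \<Turnstile> f"
| "u \<Turnstile> LUntil f g \<longleftrightarrow>
     (\<exists>k. (\<lambda>n. u (k + n)) \<Turnstile> g \<and> (\<forall>j<k. (\<lambda>n. u (j + n)) \<Turnstile> f))"

definition words :: "'p set \<Rightarrow> (nat \<Rightarrow> 'p set) set" where
  "words P = {u. \<forall>n. u n \<in> Pow P}"

definition ltl_language :: "'p set \<Rightarrow> 'p ltl \<Rightarrow> (nat \<Rightarrow> 'p set) set" where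
  "ltl_language P \<phi> = {u \<in> words P. u \<Turnstile> \<phi>}"


subsection \<open>Weights\<close>

datatype 'p lit = Pos 'p | Neg 'p

text \<open>\<open>set_weight w A x\<close> is the weight of \<open>x \<in> Pow A\<close>, for \<open>A\<close> the inputs or the outputs.\<close>

definition set_weight :: "('p lit \<Rightarrow> rat) \<Rightarrow> 'p set \<Rightarrow> 'p set \<Rightarrow> rat" where
  "set_weight w A x = (\<Sum>p\<in>x. w (Pos p)) + (\<Sum>p\<in>A - x. w (Neg p))"

definition letter_weight :: "'p set \<Rightarrow> 'p set \<Rightarrow> ('p lit \<Rightarrow> rat) \<Rightarrow> 'p set \<Rightarrow> rat" where
  "letter_weight Inp Out w \<sigma> =
     set_weight w Out (\<sigma> \<inter> Out) + set_weight w Inp (\<sigma> \<inter> Inp)"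

definition EL :: "'p set \<Rightarrow> 'p set \<Rightarrow> ('p lit \<Rightarrow> rat) \<Rightarrow> (nat \<Rightarrow> 'p set) \<Rightarrow> nat \<Rightarrow> rat" where
  "EL Inp Out w u n = (\<Sum>k<n. letter_weight Inp Out w (u k))"

definition MP :: "'p set \<Rightarrow> 'p set \<Rightarrow> ('p lit \<Rightarrow> rat) \<Rightarrow> (nat \<Rightarrow> 'p set) \<Rightarrow> ereal" where
  "MP Inp Out w u = liminf (\<lambda>n. ereal (real_of_rat (EL Inp Out w u n) / real n))"

definition Val ::
  "'p set \<Rightarrow> 'p set \<Rightarrow> 'p ltl \<Rightarrow> ('p lit \<Rightarrow> rat) \<Rightarrow> (nat \<Rightarrow> 'p set) \<Rightarrow> ereal" where
  "Val Inp Out \<phi> w u = (if u \<Turnstile> \<phi> then MP Inp Out w u else - \<infinity>)"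


subsection \<open>Strategies and outcomes\<close>

text \<open>A finite play is a list of rounds \<open>(o, i)\<close>; Player O moves first in each round.\<close>

type_synonym 'p round = "'p set \<times> 'p set"

definition histories :: "'p set \<Rightarrow> 'p set \<Rightarrow> 'p round list set" where
  "histories Inp Out = lists (Pow Out \<times> Pow Inp)"

definition strategies_O :: "'p set \<Rightarrow> 'p set \<Rightarrow> ('p round list \<Rightarrow> 'p set) set" where
  "strategies_O Inp Out = histories Inp Out \<rightarrow> Pow Out"

definition strategies_I :: "'p set \<Rightarrow> 'p set \<Rightarrow> ('p round list \<Rightarrow> 'p set \<Rightarrow> 'p set) set" where
  "strategies_I Inp Out = histories Inp Out \<rightarrow> (Pow Out \<rightarrow> Pow Inp)"

primrec play_prefix ::
  "('p round list \<Rightarrow> 'p set) \<Rightarrow> ('p round list \<Rightarrow> 'p set \<Rightarrow> 'p set) \<Rightarrow> nat \<Rightarrow> 'p round list" where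
  "play_prefix sO sI 0 = []"
| "play_prefix sO sI (Suc n) =
     (let h = play_prefix sO sI n in h @ [(sO h, sI h (sO h))])"

definition outcome ::
  "('p round list \<Rightarrow> 'p set) \<Rightarrow> ('p round list \<Rightarrow> 'p set \<Rightarrow> 'p set) \<Rightarrow> nat \<Rightarrow> 'p set" where
  "outcome sO sI n = (let h = play_prefix sO sI n in sO h \<union> sI h (sO h))"

definition right_congruence :: "'p set \<Rightarrow> 'p set \<Rightarrow> ('p round list \<times> 'p round list) set \<Rightarrow> bool" where
  "right_congruence Inp Out R \<longleftrightarrow>
     equiv (histories Inp Out) R \<and>
     (\<forall>(h, h') \<in> R. \<forall>r \<in> Pow Out \<times> Pow Inp. (h @ [r], h' @ [r]) \<in> R)"

definition memory_size :: "'p set \<Rightarrow> 'p set \<Rightarrow> ('p round list \<Rightarrow> 'p set) \<Rightarrow> nat \<Rightarrow> bool" where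
  "memory_size Inp Out sO k \<longleftrightarrow>
     (\<exists>R. right_congruence Inp Out R \<and>
          finite (histories Inp Out // R) \<and> card (histories Inp Out // R) = k \<and>
          (\<forall>(h, h') \<in> R. sO h = sO h'))"


subsection \<open>Realizability\<close>

definition MP_winning ::
  "'p set \<Rightarrow> 'p set \<Rightarrow> 'p ltl \<Rightarrow> ('p lit \<Rightarrow> rat) \<Rightarrow> rat \<Rightarrow> ('p round list \<Rightarrow> 'p set) \<Rightarrow> bool" where
  "MP_winning Inp Out \<phi> w \<nu> sO \<longleftrightarrow>
     sO \<in> strategies_O Inp Out \<and>
     (\<forall>sI \<in> strategies_I Inp Out.
        Val Inp Out \<phi> w (outcome sO sI) \<ge> ereal (real_of_rat \<nu>))"

definition MP_realizable_fm ::
  "'p set \<Rightarrow> 'p set \<Rightarrow> 'p ltl \<Rightarrow> ('p lit \<Rightarrow> rat) \<Rightarrow> rat \<Rightarrow> bool" where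
  "MP_realizable_fm Inp Out \<phi> w \<nu> \<longleftrightarrow>
     (\<exists>sO k. MP_winning Inp Out \<phi> w \<nu> sO \<and> memory_size Inp Out sO k)"

definition E_realizable :: "'p set \<Rightarrow> 'p set \<Rightarrow> 'p ltl \<Rightarrow> ('p lit \<Rightarrow> rat) \<Rightarrow> bool" where
  "E_realizable Inp Out \<phi> w \<longleftrightarrow>
     (\<exists>sO \<in> strategies_O Inp Out. \<exists>c\<^sub>0 :: nat. \<forall>sI \<in> strategies_I Inp Out.
        outcome sO sI \<Turnstile> \<phi> \<and>
        (\<forall>n. of_nat c\<^sub>0 + EL Inp Out w (outcome sO sI) n \<ge> 0))"


subsection \<open>Deterministic complete parity automata\<close>

record ('q, 'p) automaton =
  states :: "'q set"
  init :: 'q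
  delta :: "'q \<Rightarrow> 'p set \<Rightarrow> 'q"
  prio :: "'q \<Rightarrow> nat"

definition parity_automaton :: "'p set \<Rightarrow> ('q, 'p) automaton \<Rightarrow> bool" where
  "parity_automaton P A \<longleftrightarrow>
     finite (states A) \<and> init A \<in> states A \<and>
     (\<forall>q \<in> states A. \<forall>\<sigma> \<in> Pow P. delta A q \<sigma> \<in> states A)"

primrec run :: "('q, 'p) automaton \<Rightarrow> (nat \<Rightarrow> 'p set) \<Rightarrow> nat \<Rightarrow> 'q" where
  "run A u 0 = init A"
| "run A u (Suc n) = delta A (run A u n) (u n)"

definition accepts :: "('q, 'p) automaton \<Rightarrow> (nat \<Rightarrow> 'p set) \<Rightarrow> bool" where
  "accepts A u \<longleftrightarrow> even (Min (prio A ` {q. \<exists>\<^sub>\<infinity>n. run A u n = q}))"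

definition automaton_language :: "'p set \<Rightarrow> ('q, 'p) automaton \<Rightarrow> (nat \<Rightarrow> 'p set) set" where
  "automaton_language P A = {u \<in> words P. accepts A u}"


subsection \<open>The game graph\<close>

text \<open>
  The two constructors keep the Player-1 state \<open>(q, {})\<close> with \<open>{} \<in> Pow Inp\<close> apart from the
  Player-2 state \<open>(q, {})\<close> with \<open>{} \<in> Pow Out\<close>.
\<close>

datatype ('q, 'p) vertex = V1 'q "'p set" | V2 'q "'p set"

definition all_edges ::
  "'p set \<Rightarrow> 'p set \<Rightarrow> ('q, 'p) automaton \<Rightarrow> (('q, 'p) vertex \<times> ('q, 'p) vertex) set" where
  "all_edges Inp Out A =
     {(V1 q j, V2 q x) | q j x. q \<in> states A \<and> j \<in> Pow Inp \<and> x \<in> Pow Out} \<union>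
     {(V2 q x, V1 (delta A q (x \<union> i)) i) | q x i. q \<in> states A \<and> x \<in> Pow Out \<and> i \<in> Pow Inp}"

definition game_states ::
  "'p set \<Rightarrow> 'p set \<Rightarrow> ('q, 'p) automaton \<Rightarrow> 'p set \<Rightarrow> ('q, 'p) vertex set" where
  "game_states Inp Out A j\<^sub>0 = {v. (V1 (init A) j\<^sub>0, v) \<in> (all_edges Inp Out A)\<^sup>*}"

definition game_edges ::
  "'p set \<Rightarrow> 'p set \<Rightarrow> ('q, 'p) automaton \<Rightarrow> 'p set \<Rightarrow> (('q, 'p) vertex \<times> ('q, 'p) vertex) set" where
  "game_edges Inp Out A j\<^sub>0 =
     all_edges Inp Out A \<inter> (game_states Inp Out A j\<^sub>0 \<times> game_states Inp Out A j\<^sub>0)"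

fun vertex_prio :: "('q, 'p) automaton \<Rightarrow> ('q, 'p) vertex \<Rightarrow> nat" where
  "vertex_prio A (V1 q x) = prio A q"
| "vertex_prio A (V2 q x) = prio A q"

fun edge_weight ::
  "'p set \<Rightarrow> 'p set \<Rightarrow> ('p lit \<Rightarrow> rat) \<Rightarrow> ('q, 'p) vertex \<times> ('q, 'p) vertex \<Rightarrow> rat" where
  "edge_weight Inp Out w (v, V1 q i) = set_weight w Inp i"
| "edge_weight Inp Out w (v, V2 q x) = set_weight w Out x"

definition num_priorities :: "'p set \<Rightarrow> 'p set \<Rightarrow> ('q, 'p) automaton \<Rightarrow> 'p set \<Rightarrow> nat" where
  "num_priorities Inp Out A j\<^sub>0 = card (vertex_prio A ` game_states Inp Out A j\<^sub>0)"

text \<open>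
  Memory bounds that are linear in the maximal weight presuppose integer edge weights. For rational
  weights the maximum below has to be multiplied by a common denominator of the edge weights.
\<close>

definition max_abs_weight ::
  "'p set \<Rightarrow> 'p set \<Rightarrow> ('q, 'p) automaton \<Rightarrow> 'p set \<Rightarrow> ('p lit \<Rightarrow> rat) \<Rightarrow> rat" where
  "max_abs_weight Inp Out A j\<^sub>0 w =
     Max ((\<lambda>e. \<bar>edge_weight Inp Out w e\<bar>) ` game_edges Inp Out A j\<^sub>0)"

end

theory Submission
  imports Defs "HOL-Library.Omega_Words_Fun"
begin

text \<open>
  Both notions of realizability are equivalent to the following property of the game graph:
  against every positional strategy of Player I there is a play that satisfies the parity
  condition and has energy bounded from below. It follows from MP-realizability under finite
  memory because a finite-memory strategy and a positional one produce an eventually periodic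
  word, along which a nonnegative mean payoff bounds the energy from below.

  Conversely, relax the objective to ``the energy tends to infinity, or it is bounded from below
  and the parity condition holds''. This objective and its dual for Player I do not depend on
  finite prefixes and are preserved when plays are interleaved, so the relaxed game is
  positionally determined. Hence Player O has a positional strategy under which every cycle has
  positive weight, or weight zero and even least priority. By induction on the number of states,
  as in Zielonka's algorithm for parity games, Player O then still wins when the energy is capped
  at \<open>3 \<sqdot> d \<sqdot> |S| \<sqdot> W\<close>. The capped game is a finite parity game, in which a positional strategy
  wins; a state together with a capped energy level is therefore enough memory.
\<close>

section \<open>Half-positional determinacy\<close>

subsection \<open>Arenas, plays and strategies\<close>

definition infpath :: "('v \<times> 'v) set \<Rightarrow> 'v word \<Rightarrow> bool" where
  "infpath E u \<longleftrightarrow> (\<forall>n. (u n, u (Suc n)) \<in> E)"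

definition arena :: "('v \<times> 'v) set \<Rightarrow> bool" where
  "arena E \<longleftrightarrow> finite E \<and> Range E \<subseteq> Domain E"

definition positional :: "('v \<times> 'v) set \<Rightarrow> 'v set \<Rightarrow> ('v \<Rightarrow> 'v) \<Rightarrow> bool" where
  "positional E P s \<longleftrightarrow> (\<forall>v \<in> P \<inter> Domain E. (v, s v) \<in> E)"

definition conform :: "('v \<times> 'v) set \<Rightarrow> 'v set \<Rightarrow> ('v \<Rightarrow> 'v) \<Rightarrow> ('v \<times> 'v) set" where
  "conform E P s = {(a, b) \<in> E. a \<in> P \<longrightarrow> b = s a}"

definition hist_strategy :: "('v \<times> 'v) set \<Rightarrow> 'v set \<Rightarrow> ('v list \<Rightarrow> 'v) \<Rightarrow> bool" where
  "hist_strategy E P t \<longleftrightarrow> (\<forall>h. h \<noteq> [] \<and> last h \<in> P \<inter> Domain E \<longrightarrow> (last h, t h) \<in> E)"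

definition consistent :: "'v set \<Rightarrow> ('v list \<Rightarrow> 'v) \<Rightarrow> 'v word \<Rightarrow> bool" where
  "consistent P t u \<longleftrightarrow> (\<forall>n. u n \<in> P \<longrightarrow> u (Suc n) = t (prefix (Suc n) u))"

definition hist_wins ::
  "('v \<times> 'v) set \<Rightarrow> 'v set \<Rightarrow> ('v word \<Rightarrow> bool) \<Rightarrow> ('v list \<Rightarrow> 'v) \<Rightarrow> 'v \<Rightarrow> bool" where
  "hist_wins E P L t v \<longleftrightarrow> hist_strategy E P t \<and>
     (\<forall>u. infpath E u \<and> u 0 = v \<and> consistent P t u \<longrightarrow> L u)"

definition forces :: "('v \<times> 'v) set \<Rightarrow> 'v set \<Rightarrow> ('v word \<Rightarrow> bool) \<Rightarrow> 'v \<Rightarrow> bool" where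
  "forces E P L v \<longleftrightarrow> (\<exists>t. hist_wins E P L t v)"

definition avoids :: "('v \<times> 'v) set \<Rightarrow> ('v word \<Rightarrow> bool) \<Rightarrow> 'v \<Rightarrow> bool" where
  "avoids F L v \<longleftrightarrow> (\<forall>u. infpath F u \<and> u 0 = v \<longrightarrow> \<not> L u)"

definition tail_closed :: "('v word \<Rightarrow> bool) \<Rightarrow> bool" where
  "tail_closed L \<longleftrightarrow> (\<forall>u k. L (suffix k u) \<longleftrightarrow> L u)"

definition shuffle_closed :: "('v word \<Rightarrow> bool) \<Rightarrow> bool" where
  "shuffle_closed L \<longleftrightarrow> (\<forall>u N. finite (range u) \<and> infinite N \<and> infinite (- N) \<and>
     L (u \<circ> enumerate N) \<and> L (u \<circ> enumerate (- N)) \<longrightarrow> L u)"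

lemma infpathD: "infpath E u \<Longrightarrow> (u n, u (Suc n)) \<in> E"
  by (simp add: infpath_def)

lemma infpath_in_Domain: "infpath E u \<Longrightarrow> u n \<in> Domain E"
  by (auto simp: infpath_def)

lemma infpath_mono: "infpath E u \<Longrightarrow> E \<subseteq> F \<Longrightarrow> infpath F u"
  by (auto simp: infpath_def)

lemma infpath_suffix: "infpath E u \<Longrightarrow> infpath E (suffix k u)"
  by (simp add: infpath_def)

lemma infpath_rtrancl:
  assumes "infpath E u"
  shows "(u 0, u n) \<in> E\<^sup>*"
proof (induction n)
  case (Suc n)
  then show ?case using infpathD[OF assms, of n] by (rule rtrancl_into_rtrancl)
qed simp

lemma infpath_build: "infpath E (v ## u) \<longleftrightarrow> (v, u 0) \<in> E \<and> infpath E u"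
  unfolding infpath_def by (metis build.simps old.nat.exhaust)

lemma arena_finite_Domain: "arena E \<Longrightarrow> finite (Domain E)"
  by (simp add: arena_def finite_Domain)

lemma arena_succ_in_Domain: "arena E \<Longrightarrow> (a, b) \<in> E \<Longrightarrow> b \<in> Domain E"
  by (auto simp: arena_def)

lemma finite_range_infpath: "arena E \<Longrightarrow> infpath E u \<Longrightarrow> finite (range u)"
  by (rule finite_subset[OF _ arena_finite_Domain]) (auto dest: infpath_in_Domain)

lemma conform_subset: "conform E P s \<subseteq> E"
  by (auto simp: conform_def)

lemma hist_strategyD:
  "hist_strategy E P t \<Longrightarrow> h \<noteq> [] \<Longrightarrow> last h \<in> P \<Longrightarrow> last h \<in> Domain E \<Longrightarrow> (last h, t h) \<in> E"
  by (simp add: hist_strategy_def)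

lemma tail_closed_suffix: "tail_closed L \<Longrightarrow> L (suffix k u) \<longleftrightarrow> L u"
  by (simp add: tail_closed_def)

lemma avoidsD: "avoids F L v \<Longrightarrow> infpath F u \<Longrightarrow> u 0 = v \<Longrightarrow> \<not> L u"
  by (simp add: avoids_def)

lemma avoids_iff_succ:
  assumes "tail_closed L"
  shows "avoids F L v \<longleftrightarrow> (\<forall>y. (v, y) \<in> F \<longrightarrow> avoids F L y)"
proof (intro iffI allI impI)
  fix y assume v: "avoids F L v" and "(v, y) \<in> F"
  show "avoids F L y"
    unfolding avoids_def
  proof (intro allI impI)
    fix u assume "infpath F u \<and> u 0 = y"
    then have "\<not> L (v ## u)" using avoidsD[OF v] \<open>(v, y) \<in> F\<close> by (simp add: infpath_build)
    moreover have "suffix 1 (v ## u) = u" by auto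
    ultimately show "\<not> L u" using tail_closed_suffix[OF assms, of 1 "v ## u"] by simp
  qed
next
  assume succ: "\<forall>y. (v, y) \<in> F \<longrightarrow> avoids F L y"
  show "avoids F L v"
    unfolding avoids_def
  proof (intro allI impI)
    fix u assume u: "infpath F u \<and> u 0 = v"
    then have "avoids F L (u 1)" using succ infpathD[of F u 0] by simp
    then have "\<not> L (suffix 1 u)" using avoidsD infpath_suffix u by fastforce
    then show "\<not> L u" using tail_closed_suffix[OF assms] by blast
  qed
qed

lemma avoids_rtrancl:
  assumes "tail_closed L" "avoids F L v" "(v, y) \<in> F\<^sup>*"
  shows "avoids F L y"
  using assms(3,2) avoids_iff_succ[OF assms(1)] by (induction rule: rtrancl_induct) blast+

text \<open>A play that enters the region where \<open>F1\<close> avoids \<open>L\<close> stays in \<open>F1\<close> from then on; any other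
  play stays in \<open>F2\<close>.\<close>

lemma avoids_combine:
  assumes L: "tail_closed L"
    and F1: "\<And>a b. (a, b) \<in> F \<Longrightarrow> avoids F1 L a \<Longrightarrow> (a, b) \<in> F1"
    and F2: "\<And>a b. (a, b) \<in> F \<Longrightarrow> \<not> avoids F1 L a \<Longrightarrow> \<not> avoids F1 L b \<Longrightarrow> (a, b) \<in> F2"
    and v: "avoids F1 L v \<or> avoids F2 L v"
  shows "avoids F L v"
  unfolding avoids_def
proof (intro allI impI)
  fix u assume u: "infpath F u \<and> u 0 = v"
  show "\<not> L u"
  proof (cases "\<exists>k. avoids F1 L (u k)")
    case True
    then obtain k where k: "avoids F1 L (u k)" by blast
    have stays: "avoids F1 L (u (k + n))" for n
    proof (induction n)
      case (Suc n)
      then have "(u (k + n), u (Suc (k + n))) \<in> F1" using F1 infpathD[of F u] u by blast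
      then have "avoids F1 L (u (Suc (k + n)))" using Suc avoids_iff_succ[OF L] by blast
      then show ?case by simp
    qed (simp add: k)
    have "infpath F1 (suffix k u)"
      unfolding infpath_def using F1 stays infpathD[of F u] u by simp
    then show ?thesis using avoidsD[OF k] tail_closed_suffix[OF L, of k u] by fastforce
  next
    case False
    then have "infpath F2 u" unfolding infpath_def using F2 infpathD[of F u] u by blast
    then show ?thesis using v False u avoidsD by metis
  qed
qed

lemma ex_word_of_history_function:
  fixes f :: "'v list \<Rightarrow> 'v"
  obtains u where "u 0 = v" "\<And>n. u (Suc n) = f (prefix (Suc n) u)"
proof -
  define h where "h = rec_nat [v] (\<lambda>_ g. g @ [f g])"
  define u where "u n = last (h n)" for n
  have h_Suc: "h (Suc n) = h n @ [f (h n)]" for n by (simp add: h_def)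
  have "prefix (Suc n) u = h n" for n
  proof (induction n)
    case (Suc n)
    have "u (Suc n) = f (h n)" by (simp add: u_def h_Suc)
    then show ?case using Suc by (simp add: h_Suc)
  qed (simp add: u_def h_def)
  then show ?thesis using that[of u] by (simp add: u_def h_Suc) (simp add: h_def)
qed

lemma forces_disjoint:
  assumes E: "arena E" and v: "v \<in> Domain E"
    and forces: "forces E P L v" "forces E (- P) L' v"
  obtains u where "L u" "L' u"
proof -
  obtain t t' where t: "hist_wins E P L t v" and t': "hist_wins E (- P) L' t' v"
    using forces unfolding forces_def by blast
  obtain u where u: "u 0 = v"
    "\<And>n. u (Suc n) = (if u n \<in> P then t (prefix (Suc n) u) else t' (prefix (Suc n) u))"
    using ex_word_of_history_function[of v "\<lambda>h. if last h \<in> P then t h else t' h"] by auto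
  have step: "(u n, u (Suc n)) \<in> E" if "u n \<in> Domain E" for n
  proof -
    have strat: "hist_strategy E P t" "hist_strategy E (- P) t'"
      using t t' by (simp_all add: hist_wins_def)
    show ?thesis
      using hist_strategyD[OF strat(1), of "prefix (Suc n) u"]
        hist_strategyD[OF strat(2), of "prefix (Suc n) u"] that u(2)[of n] by auto
  qed
  have "u n \<in> Domain E" for n
    by (induction n) (use u(1) v step arena_succ_in_Domain[OF E] in \<open>blast+\<close>)
  then have "infpath E u" using step by (simp add: infpath_def)
  moreover have "consistent P t u" "consistent (- P) t' u"
    using u(2) by (simp_all add: consistent_def)
  ultimately show ?thesis using that t t' u(1) unfolding hist_wins_def by blast
qed

lemma forces_residual:
  assumes L: "tail_closed L" and t: "hist_wins E P L t v" and u0: "u 0 = v"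
    and path: "\<And>n. n < k \<Longrightarrow> (u n, u (Suc n)) \<in> E"
    and cons: "\<And>n. n < k \<Longrightarrow> u n \<in> P \<Longrightarrow> u (Suc n) = t (prefix (Suc n) u)"
  shows "forces E P L (u k)"
proof -
  define t' where "t' g = t (prefix k u @ g)" for g
  have "L z" if z: "infpath E z" "z 0 = u k" "consistent P t' z" for z
  proof -
    define y where "y = prefix k u \<frown> z"
    have y_before: "y n = u n" if "n \<le> k" for n
      using that z(2) by (cases "n < k") (simp_all add: y_def)
    have y_after: "y (k + n) = z n" for n by (simp add: y_def)
    have step: "(y n, y (Suc n)) \<in> E \<and> (y n \<in> P \<longrightarrow> y (Suc n) = t (prefix (Suc n) y))" for n
    proof (cases "n < k")
      case True
      then have "prefix (Suc n) y = prefix (Suc n) u"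
        using y_before by (simp add: subsequence_def del: upt_Suc)
      then show ?thesis using True path cons y_before[of n] y_before[of "Suc n"] by simp
    next
      case False
      then obtain m where m: "n = k + m" using le_Suc_ex[of k n] by auto
      have "prefix (Suc n) y = prefix k u @ prefix (Suc m) z" by (simp add: y_def m)
      then show ?thesis
        using z infpathD[OF z(1), of m] y_after[of m] y_after[of "Suc m"]
        by (auto simp: m consistent_def t'_def)
    qed
    have "L y"
      using t step y_before[of 0] u0 by (auto simp: hist_wins_def infpath_def consistent_def)
    moreover have "suffix k y = z" by (auto simp: y_def)
    ultimately show "L z" using tail_closed_suffix[OF L, of k y] by simp
  qed
  moreover have "hist_strategy E P t'"
    unfolding hist_strategy_def
  proof (intro allI impI)
    fix g assume "g \<noteq> [] \<and> last g \<in> P \<inter> Domain E"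
    then show "(last g, t' g) \<in> E"
      using hist_strategyD[of E P t "prefix k u @ g"] t by (simp add: hist_wins_def t'_def)
  qed
  ultimately show ?thesis unfolding forces_def hist_wins_def by blast
qed

lemma dropWhile_prefix_first_visit:
  assumes "u k = x" "\<And>i. i < k \<Longrightarrow> u i \<noteq> x"
  shows "dropWhile (\<lambda>a. a \<noteq> x) (prefix (Suc (k + n)) u) = prefix (Suc n) (suffix k u)"
proof -
  let ?g = "prefix (Suc n) (suffix k u)"
  have "prefix (Suc (k + n)) u = prefix k u @ ?g"
    using subsequence_append[of u k "Suc n"] by simp
  moreover have "dropWhile (\<lambda>a. a \<noteq> x) ?g = ?g"
    by (simp add: subsequence_def upt_conv_Cons assms(1) del: upt_Suc subsequence_shift)
  moreover have "\<forall>a \<in> set (prefix k u). a \<noteq> x" using assms(2) by auto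
  then have "dropWhile (\<lambda>a. a \<noteq> x) (prefix k u @ ?g) = dropWhile (\<lambda>a. a \<noteq> x) ?g"
    by (intro dropWhile_append2) (rule bspec)
  ultimately show ?thesis by (simp only:)
qed

lemma forces_by_switching:
  assumes L: "tail_closed L" and t: "hist_strategy E P t" and x: "forces E P L x"
    and wins: "\<And>u. infpath E u \<Longrightarrow> u 0 = v \<Longrightarrow> consistent P t u \<Longrightarrow> x \<notin> range u \<Longrightarrow> L u"
  shows "forces E P L v"
proof -
  obtain tx where tx: "hist_wins E P L tx x" using x unfolding forces_def by blast
  define t' where "t' h = (if x \<in> set h then tx (dropWhile (\<lambda>a. a \<noteq> x) h) else t h)" for h
  have "(last h, t' h) \<in> E" if h: "h \<noteq> []" "last h \<in> P \<inter> Domain E" for h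
  proof (cases "x \<in> set h")
    case True
    then have ne: "dropWhile (\<lambda>a. a \<noteq> x) h \<noteq> []" by (simp add: dropWhile_eq_Nil_conv)
    then have "last (dropWhile (\<lambda>a. a \<noteq> x) h) = last h"
      by (metis last_appendR takeWhile_dropWhile_id)
    moreover have "hist_strategy E P tx" using tx by (simp add: hist_wins_def)
    ultimately show ?thesis using hist_strategyD[OF _ ne, of E P tx] h(2) True by (simp add: t'_def)
  qed (use t h in \<open>simp add: hist_strategy_def t'_def\<close>)
  moreover have "L u" if u: "infpath E u" "u 0 = v" "consistent P t' u" for u
  proof (cases "x \<in> range u")
    case False
    then have "x \<notin> set (prefix n u)" for n by auto
    then have "consistent P t u" using u(3) by (simp add: consistent_def t'_def del: subseq_to_Suc)
    with u False show ?thesis by (intro wins)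
  next
    case True
    then obtain k where k: "u k = x" "\<And>i. i < k \<Longrightarrow> u i \<noteq> x"
      using exists_least_iff[of "\<lambda>k. u k = x"] by auto
    have visited: "x \<in> set (prefix (Suc (k + n)) u)" for n
      unfolding set_subsequence k(1)[symmetric] by (rule imageI) simp
    have "consistent P tx (suffix k u)"
      using u(3) dropWhile_prefix_first_visit[of u k x, OF k] visited
      by (simp add: consistent_def t'_def del: subseq_to_Suc)
    then have "L (suffix k u)"
      using tx infpath_suffix[OF u(1), of k] k(1) by (simp add: hist_wins_def)
    then show ?thesis by (simp only: tail_closed_suffix[OF L])
  qed
  ultimately have "hist_wins E P L t' v" by (simp add: hist_wins_def hist_strategy_def)
  then show ?thesis unfolding forces_def by blast
qed

subsection \<open>Interleaving\<close>

lemma enumerate_cofinite: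
  fixes N :: "nat set"
  assumes "finite (- N)"
  obtains k m where "\<And>j. enumerate N (k + j) = m + j"
proof -
  have inf: "infinite N" using assms finite_UnI[of N "- N"] by auto
  obtain m where "\<forall>n\<in>- N. n < m" using assms finite_nat_set_iff_bounded by blast
  then have m: "m + j \<in> N" for j by fastforce
  obtain k where k: "enumerate N k = m" using enumerate_Ex[OF inf] m[of 0] by auto
  have "enumerate N (k + j) = m + j" for j
  proof (induction j)
    case (Suc j)
    have "enumerate N (k + Suc j) = (LEAST s. s \<in> N \<and> m + j < s)"
      using enumerate_Suc''[OF inf, of "k + j"] Suc by simp
    also have "\<dots> = m + Suc j" using m[of "Suc j"] by (intro Least_equality) auto
    finally show ?case .
  qed (simp add: k)
  then show ?thesis by (rule that)
qed

lemma shuffle_closedD: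
  assumes L: "tail_closed L" "shuffle_closed L" and u: "finite (range u)"
    and N: "infinite N \<Longrightarrow> L (u \<circ> enumerate N)"
    and compl_N: "infinite (- N) \<Longrightarrow> L (u \<circ> enumerate (- N))"
  shows "L u"
proof -
  have cofinite: "L u" if "finite (- M)" "L (u \<circ> enumerate M)" for M
  proof -
    obtain k m where "\<And>j. enumerate M (k + j) = m + j"
      using enumerate_cofinite[OF \<open>finite (- M)\<close>] by blast
    then have "suffix k (u \<circ> enumerate M) = suffix m u" by auto
    then show ?thesis using that(2) tail_closed_suffix[OF L(1)] by metis
  qed
  have "infinite N \<or> infinite (- N)" using finite_UnI[of N "- N"] by auto
  then show ?thesis
    using cofinite[of N] cofinite[of "- N"] N compl_N L(2) u unfolding shuffle_closed_def
    by (metis double_complement)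
qed

lemma enumerate_gap:
  fixes N :: "nat set"
  assumes "infinite N" "enumerate N j < k" "k < enumerate N (Suc j)"
  shows "k \<notin> N"
  using assms not_less_Least[of k "\<lambda>s. s \<in> N \<and> enumerate N j < s"] by (auto simp: enumerate_Suc'')

lemma less_enumerate_0:
  fixes N :: "nat set"
  shows "k < enumerate N 0 \<Longrightarrow> k \<notin> N"
  unfolding enumerate_0 by (rule not_less_Least)

lemma filter_upt_enumerate:
  fixes N :: "nat set"
  assumes "infinite N"
  shows "filter (\<lambda>k. k \<in> N) [0..<enumerate N j] = map (enumerate N) [0..<j]"
proof (induction j)
  case 0
  show ?case by (auto simp: filter_empty_conv dest: less_enumerate_0)
next
  case (Suc j)
  let ?e = "enumerate N"
  have "?e j < ?e (Suc j)" using assms by (rule enumerate_step)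
  then have "[0..<?e (Suc j)] = [0..<?e j] @ ?e j # [Suc (?e j)..<?e (Suc j)]"
    using upt_add_eq_append[of 0 "?e j" "?e (Suc j) - ?e j"] by (simp add: upt_conv_Cons)
  moreover have "filter (\<lambda>k. k \<in> N) [Suc (?e j)..<?e (Suc j)] = []"
    using enumerate_gap[OF assms, of j] by (simp add: filter_empty_conv)
  ultimately show ?case using Suc enumerate_in_set[OF assms, of j] by simp
qed

text \<open>If \<open>u\<close> can enter or leave the positions in \<open>N\<close> only when it visits \<open>x\<close>, then its subword at
  these positions moves like \<open>u\<close> itself.\<close>

lemma enumerate_glue:
  fixes u :: "'v word"
  assumes N: "infinite N" and u0: "u 0 = x"
    and switch: "\<And>n. (n \<in> N) \<noteq> (Suc n \<in> N) \<Longrightarrow> u (Suc n) = x"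
  shows "u (enumerate N 0) = x" "u (enumerate N (Suc j)) = u (Suc (enumerate N j))"
proof -
  let ?e = "enumerate N"
  have e: "?e i \<in> N" for i using N by (rule enumerate_in_set)
  show "u (?e 0) = x"
  proof (cases "?e 0")
    case (Suc k)
    then have "k \<notin> N" "Suc k \<in> N" using less_enumerate_0[of k N] e[of 0] by auto
    then show ?thesis using switch[of k] Suc by simp
  qed (simp add: u0)
  show "u (?e (Suc j)) = u (Suc (?e j))"
  proof (cases "?e (Suc j) = Suc (?e j)")
    case False
    have less: "?e j < ?e (Suc j)" using N by (rule enumerate_step)
    then obtain k where k: "?e (Suc j) = Suc k" using less_imp_Suc_add by blast
    have "Suc (?e j) \<notin> N" "k \<notin> N"
      using enumerate_gap[OF N, of j] less k False by auto
    then show ?thesis using switch[of "?e j"] switch[of k] e[of j] e[of "Suc j"] k by auto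
  qed simp
qed

subsection \<open>Splitting the exits of a vertex\<close>

definition restrict_exits :: "('v \<times> 'v) set \<Rightarrow> 'v \<Rightarrow> 'v set \<Rightarrow> bool \<Rightarrow> ('v \<times> 'v) set" where
  "restrict_exits E x Y b = {(c, d) \<in> E. c = x \<longrightarrow> (d \<in> Y \<longleftrightarrow> b)}"

lemma restrict_exits_subset: "restrict_exits E x Y b \<subseteq> E"
  by (auto simp: restrict_exits_def)

lemma restrict_exits_other: "(c, d) \<in> E \<Longrightarrow> c \<noteq> x \<Longrightarrow> (c, d) \<in> restrict_exits E x Y b"
  by (simp add: restrict_exits_def)

lemma infpath_restrict_exits:
  "infpath E u \<Longrightarrow> x \<notin> range u \<Longrightarrow> infpath (restrict_exits E x Y b) u"
  unfolding infpath_def by (metis rangeI restrict_exits_other)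

lemma Domain_restrict_exits:
  assumes "(x, y) \<in> E" "y \<in> Y" "(x, z) \<in> E" "z \<notin> Y"
  shows "Domain (restrict_exits E x Y b) = Domain E"
proof
  show "Domain E \<subseteq> Domain (restrict_exits E x Y b)"
  proof
    fix c assume "c \<in> Domain E"
    then obtain d where "(c, d) \<in> E" by blast
    then have "(c, if c = x then if b then y else z else d) \<in> restrict_exits E x Y b"
      using assms by (simp add: restrict_exits_def)
    then show "c \<in> Domain (restrict_exits E x Y b)" by blast
  qed
qed (rule Domain_mono[OF restrict_exits_subset])

lemma arena_restrict_exits:
  assumes "arena E" "(x, y) \<in> E" "y \<in> Y" "(x, z) \<in> E" "z \<notin> Y"
  shows "arena (restrict_exits E x Y b)" "card (restrict_exits E x Y b) < card E"
proof -
  have fin: "finite E" using assms(1) by (simp add: arena_def)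
  have "finite (restrict_exits E x Y b)"
    by (rule finite_subset[OF restrict_exits_subset fin])
  moreover have "Range (restrict_exits E x Y b) \<subseteq> Domain E"
    using assms(1) restrict_exits_subset[of E x Y b] unfolding arena_def by blast
  ultimately show "arena (restrict_exits E x Y b)"
    unfolding arena_def Domain_restrict_exits[OF assms(2-5)] by blast
  have "restrict_exits E x Y b \<subset> E"
    using assms(2-5) by (cases b) (auto simp: restrict_exits_def)
  then show "card (restrict_exits E x Y b) < card E" by (rule psubset_card_mono[OF fin])
qed

text \<open>\<open>exit_mode x Y u n\<close> tells whether the last exit from \<open>x\<close> up to position \<open>n\<close> went to \<open>Y\<close>; it
  looks ahead to \<open>u (Suc n)\<close> only if \<open>u n = x\<close>.\<close>

primrec exit_mode :: "'v \<Rightarrow> 'v set \<Rightarrow> 'v word \<Rightarrow> nat \<Rightarrow> bool" where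
  "exit_mode x Y u 0 \<longleftrightarrow> u 1 \<in> Y"
| "exit_mode x Y u (Suc n) \<longleftrightarrow>
     (if u (Suc n) = x then u (Suc (Suc n)) \<in> Y else exit_mode x Y u n)"

lemma exit_mode_cong:
  assumes "\<And>i. i \<le> n \<Longrightarrow> u i = z i" "u n = x \<Longrightarrow> u (Suc n) = z (Suc n)" "u 0 = x"
  shows "exit_mode x Y u n = exit_mode x Y z n"
  using assms
proof (induction n)
  case (Suc n)
  then have "u (Suc n) = z (Suc n)" by simp
  with Suc show ?case by auto
qed auto

lemma exit_mode_at: "u n = x \<Longrightarrow> exit_mode x Y u n \<longleftrightarrow> u (Suc n) \<in> Y"
  by (cases n) auto

text \<open>The strategy recalls the loops at \<open>x\<close> that were left in the same mode as the current one,
  and plays as if their concatenation were the history.\<close>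

definition interleave :: "'v \<Rightarrow> 'v set \<Rightarrow> (bool \<Rightarrow> 'v list \<Rightarrow> 'v) \<Rightarrow> 'v list \<Rightarrow> 'v" where
  "interleave x Y t h =
     (let m = exit_mode x Y (nth h); n = length h - 1
      in t (m n) (map (nth h) (filter (\<lambda>k. m k = m n) [0..<Suc n])))"

lemma hist_strategy_interleave:
  assumes x: "x \<notin> P" and t: "\<And>b. hist_strategy (restrict_exits E x Y b) P (t b)"
  shows "hist_strategy E P (interleave x Y t)"
  unfolding hist_strategy_def
proof (intro allI impI)
  fix h assume h: "h \<noteq> [] \<and> last h \<in> P \<inter> Domain E"
  define m where "m = exit_mode x Y (nth h)"
  define n where "n = length h - 1"
  define g where "g = map (nth h) (filter (\<lambda>k. m k = m n) [0..<Suc n])"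
  have "g = map (nth h) (filter (\<lambda>k. m k = m n) [0..<n]) @ [h ! n]" by (simp add: g_def)
  then have "g \<noteq> []" "last g = last h" using h by (simp_all add: n_def last_conv_nth)
  moreover have "last h \<in> Domain (restrict_exits E x Y (m n))"
    using h x restrict_exits_other[of "last h" _ E x] by (metis Domain.simps IntE)
  ultimately have "(last h, t (m n) g) \<in> restrict_exits E x Y (m n)"
    using hist_strategyD[OF t, of g] h by simp
  moreover have "interleave x Y t h = t (m n) g"
    by (simp add: interleave_def g_def m_def n_def Let_def)
  ultimately show "(last h, interleave x Y t h) \<in> E" using restrict_exits_subset by fastforce
qed

lemma interleave_prefix:
  assumes x: "u 0 = x" and n: "u n \<noteq> x"
    and N: "N = {k. exit_mode x Y u k = b}" "infinite N" "enumerate N j = n"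
  shows "interleave x Y t (prefix (Suc n) u) = t b (prefix (Suc j) (u \<circ> enumerate N))"
proof -
  let ?h = "prefix (Suc n) u"
  have h: "?h ! k = u k" if "k \<le> n" for k
    using that by (simp add: subsequence_def nth_append)
  have mode: "exit_mode x Y (nth ?h) k = exit_mode x Y u k" if "k \<le> n" for k
  proof (rule exit_mode_cong[symmetric])
    show "u (Suc k) = ?h ! Suc k" if "u k = x"
      using that n \<open>k \<le> n\<close> h[of "Suc k"] by (cases "k = n") auto
  qed (use that h x in simp_all)
  have "n \<in> N" using N(3) enumerate_in_set[OF N(2)] by blast
  then have "exit_mode x Y u n = b" by (simp add: N(1))
  then have "filter (\<lambda>k. exit_mode x Y (nth ?h) k = b) [0..<Suc n] = filter (\<lambda>k. k \<in> N) [0..<Suc n]"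
    using mode by (intro filter_cong) (auto simp: N(1))
  also have "\<dots> = map (enumerate N) [0..<Suc j]"
    using filter_upt_enumerate[OF N(2), of j] \<open>n \<in> N\<close> by (simp add: N(3))
  finally have "map (nth ?h) (filter (\<lambda>k. exit_mode x Y (nth ?h) k = b) [0..<Suc n]) =
      map (\<lambda>i. ?h ! enumerate N i) [0..<Suc j]"
    by (simp only: map_map o_def)
  also have "\<dots> = prefix (Suc j) (u \<circ> enumerate N)"
  proof -
    have "?h ! enumerate N i = u (enumerate N i)" if "i \<le> j" for i
      using that enumerate_mono_le_iff[OF N(2), of i j] by (intro h) (simp add: N(3))
    then show ?thesis by (simp add: subsequence_def[of "u \<circ> enumerate N"] del: upt_Suc)
  qed
  finally show ?thesis
    using mode[of n] \<open>exit_mode x Y u n = b\<close>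
    by (simp add: interleave_def Let_def del: upt_Suc subseq_to_Suc)
qed

lemma forces_interleave:
  assumes E: "arena E" and L: "tail_closed L" "shuffle_closed L" and x: "x \<notin> P"
    and forces: "\<And>b. forces (restrict_exits E x Y b) P L x"
  shows "forces E P L x"
proof -
  obtain t where t: "\<And>b. hist_wins (restrict_exits E x Y b) P L (t b) x"
    using forces unfolding forces_def by metis
  have "L u" if u: "infpath E u" "u 0 = x" "consistent P (interleave x Y t) u" for u
  proof -
    let ?N = "\<lambda>b. {n. exit_mode x Y u n = b}"
    have part: "L (u \<circ> enumerate (?N b))" if inf: "infinite (?N b)" for b
    proof -
      let ?e = "enumerate (?N b)"
      have e: "exit_mode x Y u (?e j) = b" for j using enumerate_in_set[OF inf, of j] by simp
      have glue: "u (?e 0) = x" "u (?e (Suc j)) = u (Suc (?e j))" for j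
        by (rule enumerate_glue[of _ u, OF inf u(2)]; auto split: if_splits)+
      have "infpath (restrict_exits E x Y b) (u \<circ> ?e)"
        unfolding infpath_def restrict_exits_def
        using infpathD[OF u(1)] glue(2) e exit_mode_at[of u _ x Y] by auto
      moreover have "consistent P (t b) (u \<circ> ?e)"
        unfolding consistent_def
      proof (intro allI impI)
        fix j assume "(u \<circ> ?e) j \<in> P"
        then have "u (?e j) \<noteq> x" "u (Suc (?e j)) = interleave x Y t (prefix (Suc (?e j)) u)"
          using x u(3) unfolding consistent_def by auto
        then show "(u \<circ> ?e) (Suc j) = t b (prefix (Suc j) (u \<circ> ?e))"
          using interleave_prefix[OF u(2) _ refl inf refl] glue(2) by simp
      qed
      ultimately show ?thesis using t[of b] glue(1) by (simp add: hist_wins_def)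
    qed
    have "- ?N True = ?N False" by auto
    then show "L u"
      using shuffle_closedD[OF L finite_range_infpath[OF E u(1)], of "?N True"]
        part[of True] part[of False] by simp
  qed
  moreover have "hist_strategy E P (interleave x Y t)"
    using t by (intro hist_strategy_interleave[OF x]) (simp add: hist_wins_def)
  ultimately show ?thesis unfolding forces_def hist_wins_def by blast
qed

lemma forces_if_forces_restrict_exits:
  assumes E: "arena E" and dom: "\<And>b. Domain (restrict_exits E x Y b) = Domain E"
    and L: "tail_closed L" "shuffle_closed L" and x: "x \<notin> P"
    and forces: "\<And>b. forces (restrict_exits E x Y b) P L v"
  shows "forces E P L v"
proof -
  let ?sub = "restrict_exits E x Y"
  obtain t where t: "\<And>b. hist_wins (?sub b) P L (t b) v"
    using forces unfolding forces_def by metis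
  have strat: "hist_strategy E P (t b)" for b
    using t[of b] restrict_exits_subset[of E x Y b]
    unfolding hist_wins_def hist_strategy_def dom by blast
  have miss_x: "L u"
    if "infpath E u" "u 0 = v" "consistent P (t b) u" "x \<notin> range u" for u b
    using t[of b] that infpath_restrict_exits[of E u x Y b] by (simp add: hist_wins_def)
  show ?thesis
  proof (cases "\<forall>b. forces (?sub b) P L x")
    case True
    then have "forces E P L x" by (intro forces_interleave[OF E L x]) blast
    then show ?thesis using forces_by_switching[OF L(1) strat] miss_x by blast
  next
    case False
    then obtain b where b: "\<not> forces (?sub b) P L x" by blast
    have "x \<notin> range u" if u: "infpath E u" "u 0 = v" "consistent P (t b) u" for u
    proof
      assume "x \<in> range u"
      then obtain k where k: "u k = x" "\<And>i. i < k \<Longrightarrow> u i \<noteq> x"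
        using exists_least_iff[of "\<lambda>k. u k = x"] by auto
      have "forces (?sub b) P L (u k)"
        using forces_residual[where u = u and k = k, OF L(1) t u(2)] infpathD[OF u(1)] k(2) u(3)
          restrict_exits_other[of _ _ E x Y b]
        by (simp add: consistent_def)
      with b k(1) show False by simp
    qed
    then have "hist_wins E P L (t b) v" using strat miss_x unfolding hist_wins_def by blast
    then show ?thesis unfolding forces_def by blast
  qed
qed

subsection \<open>Determinacy\<close>

lemma forces_if_no_choice:
  assumes E: "arena E" and unique: "\<And>a b c. a \<notin> P \<Longrightarrow> (a, b) \<in> E \<Longrightarrow> (a, c) \<in> E \<Longrightarrow> b = c"
    and u: "infpath E u" "L u"
  shows "forces E P L (u 0)"
proof -
  define t where
    "t h = (if (last h, u (length h)) \<in> E then u (length h) else SOME y. (last h, y) \<in> E)" for h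
  have "hist_strategy E P t"
    by (auto simp: hist_strategy_def t_def intro: someI)
  moreover have "z = u" if z: "infpath E z" "z 0 = u 0" "consistent P t z" for z
  proof
    show "z n = u n" for n
    proof (induction n)
      case (Suc n)
      show ?case
      proof (cases "z n \<in> P")
        case True
        then show ?thesis using z(3) Suc infpathD[OF u(1), of n] by (simp add: consistent_def t_def)
      next
        case False
        then show ?thesis using unique infpathD[OF z(1), of n] infpathD[OF u(1), of n] Suc by metis
      qed
    qed (rule z(2))
  qed
  ultimately show ?thesis using u(2) unfolding forces_def hist_wins_def by blast
qed

lemma ex_uniform_restrict_exits:
  assumes L: "tail_closed L" and dom: "\<And>b. Domain (restrict_exits E x Y b) = Domain E"
    and x: "x \<in> P" and s: "\<And>b. positional (restrict_exits E x Y b) P (s b)"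
  obtains r where "positional E P r"
    "\<And>b v. avoids (conform (restrict_exits E x Y b) P (s b)) L v \<Longrightarrow> avoids (conform E P r) L v"
proof -
  let ?F = "\<lambda>b. conform (restrict_exits E x Y b) P (s b)"
  have s_sub: "(a, s b a) \<in> restrict_exits E x Y b" if "a \<in> P" "a \<in> Domain E" for a b
    using s[of b] that dom[of b] by (simp add: positional_def)
  have F: "(c, d) \<in> ?F b" if "(c, d) \<in> E" "c \<in> P \<longrightarrow> d = s b c" for c d b
    using that s_sub[of c b] x by (auto simp: conform_def restrict_exits_def)
  define r where "r v = s (avoids (?F True) L v) v" for v
  have "positional E P r"
    using s_sub restrict_exits_subset unfolding positional_def r_def by fastforce
  moreover have "avoids (conform E P r) L v" if "avoids (?F b) L v" for v b
  proof (rule avoids_combine[OF L])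
    show "(c, d) \<in> ?F True" if "(c, d) \<in> conform E P r" "avoids (?F True) L c" for c d
      using that F[of c d True] by (simp add: conform_def r_def)
    show "(c, d) \<in> ?F False" if "(c, d) \<in> conform E P r" "\<not> avoids (?F True) L c" for c d
      using that F[of c d False] by (simp add: conform_def r_def)
    show "avoids (?F True) L v \<or> avoids (?F False) L v" using that by (cases b) auto
  qed
  ultimately show ?thesis by (rule that)
qed

theorem half_positional_determinacy:
  assumes "arena E" and L: "tail_closed L" "shuffle_closed L"
  shows "\<exists>s. positional E P s \<and>
    (\<forall>v \<in> Domain E. avoids (conform E P s) L v \<or> forces E (- P) L v)"
  using assms(1)
proof (induction "card E" arbitrary: E rule: less_induct)
  case less
  note E = \<open>arena E\<close>
  show ?case
  proof (cases "\<exists>x y z. x \<in> P \<and> (x, y) \<in> E \<and> (x, z) \<in> E \<and> y \<noteq> z")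
    case False
    then have "forces E (- P) L v" if "infpath E u" "u 0 = v" "L u" for u v
      using forces_if_no_choice[OF E, of "- P" u L] that by auto
    then have "avoids (conform E P s) L v \<or> forces E (- P) L v" for s v
      using infpath_mono[OF _ conform_subset] unfolding avoids_def by metis
    moreover have "positional E P (\<lambda>v. SOME y. (v, y) \<in> E)"
      by (auto simp: positional_def intro: someI)
    ultimately show ?thesis by blast
  next
    case True
    then obtain x y z where x: "x \<in> P" and y: "(x, y) \<in> E" "y \<in> {y}"
      and z: "(x, z) \<in> E" "z \<notin> {y}" by blast
    let ?sub = "restrict_exits E x {y}"
    have dom: "Domain (?sub b) = Domain E" for b by (rule Domain_restrict_exits[OF y z])
    obtain s where s: "\<And>b. positional (?sub b) P (s b)"
      and win: "\<And>b v. v \<in> Domain E \<Longrightarrow>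
        avoids (conform (?sub b) P (s b)) L v \<or> forces (?sub b) (- P) L v"
      using less.hyps[OF arena_restrict_exits(2,1)[OF E y z]] unfolding dom by metis
    obtain r where "positional E P r"
      "\<And>b v. avoids (conform (?sub b) P (s b)) L v \<Longrightarrow> avoids (conform E P r) L v"
      using ex_uniform_restrict_exits[OF L(1) dom x s] by blast
    moreover have "forces E (- P) L v" if "\<And>b. forces (?sub b) (- P) L v" for v
      using forces_if_forces_restrict_exits[OF E dom L _ that] x by simp
    ultimately show ?thesis using win by blast
  qed
qed

theorem positional_determinacy:
  assumes E: "arena E"
    and L: "tail_closed L" "shuffle_closed L" and L': "tail_closed L'" "shuffle_closed L'"
    and disj: "\<And>u. \<not> (L u \<and> L' u)"
  obtains s t where "positional E P s" "positional E (- P) t"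
    "\<And>v. v \<in> Domain E \<Longrightarrow> avoids (conform E P s) L v \<or> avoids (conform E (- P) t) L' v"
proof -
  obtain s where s: "positional E P s"
      "\<And>v. v \<in> Domain E \<Longrightarrow> avoids (conform E P s) L v \<or> forces E (- P) L v"
    using half_positional_determinacy[OF E L] by metis
  obtain t where t: "positional E (- P) t"
      "\<And>v. v \<in> Domain E \<Longrightarrow> avoids (conform E (- P) t) L' v \<or> forces E P L' v"
    using half_positional_determinacy[OF E L', of "- P"] by (metis double_complement)
  have "\<not> (forces E P L' v \<and> forces E (- P) L v)" if "v \<in> Domain E" for v
    using forces_disjoint[OF E that] disj by metis
  then show ?thesis using that s t by blast
qed

section \<open>Winning regions, traps and attractors\<close>

definition avoid_region :: "('v \<times> 'v) set \<Rightarrow> 'v set \<Rightarrow> ('v word \<Rightarrow> bool) \<Rightarrow> 'v set" where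
  "avoid_region E P L = {v \<in> Domain E. \<exists>s. positional E P s \<and> avoids (conform E P s) L v}"

definition trap :: "('v \<times> 'v) set \<Rightarrow> 'v set \<Rightarrow> 'v set \<Rightarrow> bool" where
  "trap E P X \<longleftrightarrow> X \<subseteq> Domain E \<and>
     (\<forall>v \<in> X. if v \<in> P then E `` {v} \<subseteq> X else E `` {v} \<inter> X \<noteq> {})"

lemma avoid_regionI:
  "v \<in> Domain E \<Longrightarrow> positional E P s \<Longrightarrow> avoids (conform E P s) L v \<Longrightarrow> v \<in> avoid_region E P L"
  by (auto simp: avoid_region_def)

lemma avoid_regionE:
  assumes "v \<in> avoid_region E P L"
  obtains s where "v \<in> Domain E" "positional E P s" "avoids (conform E P s) L v"
  using assms by (auto simp: avoid_region_def)

lemma avoid_region_uniform: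
  assumes E: "arena E" and L: "tail_closed L"
  obtains s where "positional E P s" "\<And>v. v \<in> avoid_region E P L \<Longrightarrow> avoids (conform E P s) L v"
proof -
  have finite_case: "\<exists>s. positional E P s \<and> (\<forall>v \<in> S. avoids (conform E P s) L v)"
    if "finite S" "S \<subseteq> avoid_region E P L" for S
    using that
  proof (induction S)
    case empty
    have "positional E P (\<lambda>v. SOME y. (v, y) \<in> E)"
      by (auto simp: positional_def intro: someI)
    then show ?case by blast
  next
    case (insert v S)
    then obtain s1 s2 where s1: "positional E P s1" "\<forall>x \<in> S. avoids (conform E P s1) L x"
      and s2: "positional E P s2" "avoids (conform E P s2) L v"
      unfolding avoid_region_def by blast
    define s where "s x = (if avoids (conform E P s1) L x then s1 x else s2 x)" for x
    have "positional E P s" using s1(1) s2(1) by (simp add: positional_def s_def)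
    moreover have "avoids (conform E P s) L x" if "x \<in> insert v S" for x
    proof (rule avoids_combine[OF L])
      show "avoids (conform E P s1) L x \<or> avoids (conform E P s2) L x" using that s1 s2 by blast
    qed (auto simp: s_def conform_def)
    ultimately show ?case by blast
  qed
  have "finite (avoid_region E P L)"
    using arena_finite_Domain[OF E] by (simp add: avoid_region_def)
  then show ?thesis using finite_case[of "avoid_region E P L"] that by blast
qed

lemma avoids_closed_subgraph:
  assumes closed: "\<And>a b. a \<in> X \<Longrightarrow> (a, b) \<in> F \<Longrightarrow> b \<in> X \<and> (a, b) \<in> F'"
    and v: "v \<in> X" "avoids F' L v"
  shows "avoids F L v"
  unfolding avoids_def
proof (intro allI impI)
  fix u assume u: "infpath F u \<and> u 0 = v"
  have "u n \<in> X" for n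
    by (induction n) (use u v(1) closed infpathD[of F u] in blast)+
  then have "infpath F' u" using closed u by (auto simp: infpath_def)
  then show "\<not> L u" using avoidsD[OF v(2)] u by blast
qed

subsection \<open>Traps\<close>

lemma trap_subset: "trap E P X \<Longrightarrow> X \<subseteq> Domain E"
  by (simp add: trap_def)

lemma trap_closed: "trap E P X \<Longrightarrow> v \<in> X \<Longrightarrow> v \<in> P \<Longrightarrow> (v, y) \<in> E \<Longrightarrow> y \<in> X"
  unfolding trap_def by (metis ImageI singletonI subsetD)

lemma trap_ex_succ:
  assumes "trap E P X" "v \<in> X"
  obtains y where "y \<in> X" "(v, y) \<in> E"
proof (cases "v \<in> P")
  case True
  then show ?thesis using assms trap_closed[OF assms] that by (auto simp: trap_def)
next
  case False
  then have "E `` {v} \<inter> X \<noteq> {}" using assms by (simp add: trap_def)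
  then show ?thesis using that by blast
qed

lemma Domain_Restr_trap: "trap E P X \<Longrightarrow> Domain (Restr E X) = X"
  by (auto elim: trap_ex_succ)

lemma arena_Restr_trap:
  assumes "arena E" "trap E P X"
  shows "arena (Restr E X)"
  using assms(1) Domain_Restr_trap[OF assms(2)] by (auto simp: arena_def)

lemma trap_trans:
  assumes "trap E P Y" "trap (Restr E Y) P X"
  shows "trap E P X" "Restr (Restr E Y) X = Restr E X"
proof -
  have "X \<subseteq> Y" using trap_subset[OF assms(2)] by blast
  then show "Restr (Restr E Y) X = Restr E X" by blast
  show "trap E P X"
    unfolding trap_def
  proof (intro conjI ballI)
    show "X \<subseteq> Domain E" using trap_subset[OF assms(2)] by blast
    fix v assume v: "v \<in> X"
    have "E `` {v} \<subseteq> X" if "v \<in> P"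
      using trap_closed[OF assms(1) _ that] trap_closed[OF assms(2) v that] v \<open>X \<subseteq> Y\<close> by blast
    moreover have "E `` {v} \<inter> X \<noteq> {}" using trap_ex_succ[OF assms(2) v] by blast
    ultimately show "if v \<in> P then E `` {v} \<subseteq> X else E `` {v} \<inter> X \<noteq> {}" by simp
  qed
qed

lemma avoid_region_Restr_trap:
  assumes X: "trap E P X"
  shows "avoid_region (Restr E X) (- P) L \<subseteq> avoid_region E (- P) L"
proof
  fix v assume "v \<in> avoid_region (Restr E X) (- P) L"
  then obtain s where s: "positional (Restr E X) (- P) s" "avoids (conform (Restr E X) (- P) s) L v"
    and v: "v \<in> X"
    by (blast elim: avoid_regionE)
  define r where "r x = (if x \<in> X then s x else SOME y. (x, y) \<in> E)" for x
  have s_X: "(x, s x) \<in> Restr E X" if "x \<in> X" "x \<notin> P" for x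
    using s(1) that Domain_Restr_trap[OF X] by (simp add: positional_def)
  have "positional E (- P) r"
    using s_X by (auto simp: positional_def r_def intro: someI)
  moreover have "avoids (conform E (- P) r) L v"
  proof (rule avoids_closed_subgraph[OF _ v s(2)])
    fix a b assume a: "a \<in> X" and ab: "(a, b) \<in> conform E (- P) r"
    have "b \<in> X"
      using ab a s_X[of a] trap_closed[OF X a, of b]
      by (cases "a \<in> P") (auto simp: conform_def r_def)
    then show "b \<in> X \<and> (a, b) \<in> conform (Restr E X) (- P) s"
      using a ab by (simp add: conform_def r_def)
  qed
  ultimately show "v \<in> avoid_region E (- P) L"
    using v trap_subset[OF X] by (intro avoid_regionI) auto
qed

lemma trap_compl_avoid_region:
  assumes E: "arena E" and L: "tail_closed L"
  shows "trap E P (Domain E - avoid_region E P L)"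
  unfolding trap_def
proof (intro conjI ballI)
  obtain s where s: "positional E P s" "\<And>v. v \<in> avoid_region E P L \<Longrightarrow> avoids (conform E P s) L v"
    using avoid_region_uniform[OF E L] by blast
  fix v assume v: "v \<in> Domain E - avoid_region E P L"
  have "v \<in> avoid_region E P L" if y: "v \<in> P" "(v, y) \<in> E" "avoids (conform E P s) L y" for y
  proof (rule avoid_regionI)
    show "positional E P (s(v := y))" using s(1) y by (auto simp: positional_def)
    show "avoids (conform E P (s(v := y))) L v"
    proof (rule avoids_combine[OF L])
      have "\<not> avoids (conform E P s) L v" using v avoid_regionI[OF _ s(1)] by blast
      then show "(a, b) \<in> conform E P s"
        if "(a, b) \<in> conform E P (s(v := y))" "avoids (conform E P s) L a" for a b
        using that by (auto simp: conform_def split: if_splits)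
      show "(a, b) \<in> {(a, b) \<in> E. a \<noteq> v}"
        if "(a, b) \<in> conform E P (s(v := y))" "\<not> avoids (conform E P s) L b" for a b
        using that y by (auto simp: conform_def)
      show "avoids (conform E P s) L v \<or> avoids {(a, b) \<in> E. a \<noteq> v} L v"
        using infpathD[of "{(a, b) \<in> E. a \<noteq> v}" _ 0] by (auto simp: avoids_def)
    qed
  qed (use v in blast)
  moreover have "v \<in> avoid_region E P L" if "E `` {v} \<subseteq> avoid_region E P L"
  proof (rule avoid_regionI[OF _ s(1)])
    show "avoids (conform E P s) L v"
      using that s(2) conform_subset[of E P s] avoids_iff_succ[OF L] by blast
  qed (use v in blast)
  moreover have "E `` {v} \<subseteq> Domain E" using arena_succ_in_Domain[OF E] by blast
  ultimately show "if v \<in> P then E `` {v} \<subseteq> Domain E - avoid_region E P L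
      else E `` {v} \<inter> (Domain E - avoid_region E P L) \<noteq> {}"
    using v s(2) by (cases "v \<in> P") (simp; blast)+
qed auto

lemma avoid_region_Restr_compl:
  assumes E: "arena E" and L: "tail_closed L"
  shows "avoid_region (Restr E (Domain E - avoid_region E P L)) P L = {}"
proof -
  let ?R = "avoid_region E P L" and ?X = "Domain E - avoid_region E P L"
  obtain s where s: "positional E P s" "\<And>v. v \<in> ?R \<Longrightarrow> avoids (conform E P s) L v"
    using avoid_region_uniform[OF E L] by blast
  note dom = Domain_Restr_trap[OF trap_compl_avoid_region[OF E L]]
  have R: "v \<in> ?R \<longleftrightarrow> avoids (conform E P s) L v" if "v \<in> Domain E" for v
    using avoid_regionI[OF that s(1)] s(2) by blast
  have "v \<in> ?R" if lost: "v \<in> avoid_region (Restr E ?X) P L" for v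
  proof -
    obtain r where r: "positional (Restr E ?X) P r" "avoids (conform (Restr E ?X) P r) L v"
      using avoid_regionE[OF lost] by blast
    have v: "v \<in> Domain E" using lost by (auto simp: avoid_region_def[of "Restr E ?X"])
    define q where "q x = (if x \<in> ?R then s x else r x)" for x
    have "positional E P q"
      using r(1) s(1) unfolding positional_def q_def dom by auto
    moreover have "avoids (conform E P q) L v"
    proof (rule avoids_combine[OF L])
      show "(a, b) \<in> conform E P s" if "(a, b) \<in> conform E P q" "avoids (conform E P s) L a" for a b
        using that R[of a] by (auto simp: conform_def q_def)
      show "(a, b) \<in> conform (Restr E ?X) P r"
        if "(a, b) \<in> conform E P q" "\<not> avoids (conform E P s) L a"
          "\<not> avoids (conform E P s) L b" for a b
        using that R[of a] R[of b] arena_succ_in_Domain[OF E, of a b]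
        by (auto simp: conform_def q_def)
    qed (use r(2) in blast)
    ultimately show "v \<in> ?R" by (intro avoid_regionI[OF v])
  qed
  moreover have "avoid_region (Restr E ?X) P L \<subseteq> ?X"
    by (auto simp: avoid_region_def)
  ultimately show ?thesis by blast
qed

subsection \<open>Attractors\<close>

definition controlled_pre :: "('v \<times> 'v) set \<Rightarrow> 'v set \<Rightarrow> 'v set \<Rightarrow> 'v set" where
  "controlled_pre E P A =
     {v \<in> Domain E. if v \<in> P then E `` {v} \<inter> A \<noteq> {} else E `` {v} \<subseteq> A}"

primrec attr_level :: "('v \<times> 'v) set \<Rightarrow> 'v set \<Rightarrow> 'v set \<Rightarrow> nat \<Rightarrow> 'v set" where
  "attr_level E P T 0 = T"
| "attr_level E P T (Suc k) = attr_level E P T k \<union> controlled_pre E P (attr_level E P T k)"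

definition attr :: "('v \<times> 'v) set \<Rightarrow> 'v set \<Rightarrow> 'v set \<Rightarrow> 'v set" where
  "attr E P T = (\<Union>k. attr_level E P T k)"

definition attr_rank :: "('v \<times> 'v) set \<Rightarrow> 'v set \<Rightarrow> 'v set \<Rightarrow> 'v \<Rightarrow> nat" where
  "attr_rank E P T v = (LEAST k. v \<in> attr_level E P T k)"

definition attr_move :: "('v \<times> 'v) set \<Rightarrow> 'v set \<Rightarrow> 'v set \<Rightarrow> 'v \<Rightarrow> 'v" where
  "attr_move E P T v =
     (SOME y. y \<in> attr E P T \<and> (v, y) \<in> E \<and> attr_rank E P T y < attr_rank E P T v)"

lemma attr_level_mono: "mono (attr_level E P T)"
  by (simp add: mono_iff_le_Suc)

lemma target_subset_attr: "T \<subseteq> attr E P T"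
  unfolding attr_def using attr_level.simps(1) by fast

lemma attr_subset_Domain:
  assumes "T \<subseteq> Domain E"
  shows "attr E P T \<subseteq> Domain E"
proof -
  have "attr_level E P T k \<subseteq> Domain E" for k
    by (induction k) (use assms in \<open>auto simp: controlled_pre_def\<close>)
  then show ?thesis by (auto simp: attr_def)
qed

lemma attr_rank_le_iff:
  assumes "v \<in> attr E P T"
  shows "attr_rank E P T v \<le> k \<longleftrightarrow> v \<in> attr_level E P T k"
proof
  have "v \<in> attr_level E P T (attr_rank E P T v)"
    using assms unfolding attr_def attr_rank_def by (auto intro: LeastI)
  then show "attr_rank E P T v \<le> k \<Longrightarrow> v \<in> attr_level E P T k"
    using monoD[OF attr_level_mono, of "attr_rank E P T v" k E P T] by blast
qed (simp add: attr_rank_def Least_le)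

lemma attr_rank_Suc:
  assumes "v \<in> attr E P T - T"
  obtains k where "attr_rank E P T v = Suc k" "v \<in> attr_level E P T (Suc k) - attr_level E P T k"
proof (cases "attr_rank E P T v")
  case 0
  then show ?thesis using assms attr_rank_le_iff[of v E P T 0] by simp
next
  case (Suc k)
  then show ?thesis
    using that assms attr_rank_le_iff[of v E P T k] attr_rank_le_iff[of v E P T "Suc k"] by simp
qed

lemma attr_move:
  assumes "v \<in> attr E P T - T" "v \<in> P"
  shows "attr_move E P T v \<in> attr E P T" "(v, attr_move E P T v) \<in> E"
    "attr_rank E P T (attr_move E P T v) < attr_rank E P T v"
proof -
  obtain k where k: "attr_rank E P T v = Suc k" "v \<in> attr_level E P T (Suc k) - attr_level E P T k"
    using attr_rank_Suc[OF assms(1)] .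
  then obtain y where y: "(v, y) \<in> E" "y \<in> attr_level E P T k"
    using assms(2) by (auto simp: controlled_pre_def)
  then have "y \<in> attr E P T" by (auto simp: attr_def)
  moreover from this have "attr_rank E P T y < attr_rank E P T v"
    using attr_rank_le_iff[of y E P T k] y(2) k(1) by simp
  ultimately have "\<exists>y. y \<in> attr E P T \<and> (v, y) \<in> E \<and> attr_rank E P T y < attr_rank E P T v"
    using y(1) by blast
  from someI_ex[OF this] show "attr_move E P T v \<in> attr E P T" "(v, attr_move E P T v) \<in> E"
    "attr_rank E P T (attr_move E P T v) < attr_rank E P T v"
    unfolding attr_move_def by blast+
qed

lemma attr_opponent_move:
  assumes "v \<in> attr E P T - T" "v \<notin> P" "(v, y) \<in> E"
  shows "y \<in> attr E P T" "attr_rank E P T y < attr_rank E P T v"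
proof -
  obtain k where k: "attr_rank E P T v = Suc k" "v \<in> attr_level E P T (Suc k) - attr_level E P T k"
    using attr_rank_Suc[OF assms(1)] .
  then have y: "y \<in> attr_level E P T k" using assms(2,3) by (auto simp: controlled_pre_def)
  then show y_attr: "y \<in> attr E P T" by (auto simp: attr_def)
  show "attr_rank E P T y < attr_rank E P T v"
    using attr_rank_le_iff[OF y_attr, of k] y k(1) by simp
qed

lemma attr_eq_level:
  assumes "finite (attr E P T)"
  shows "attr E P T = attr_level E P T (card (attr E P T - T))"
proof -
  define f where "f k = attr_level E P T k - T" for k
  have T: "T \<subseteq> attr_level E P T k" for k by (induction k) auto
  have level: "attr_level E P T k = f k \<union> T" for k using T[of k] by (auto simp: f_def)
  have bound: "f k \<subseteq> attr E P T - T" for k by (auto simp: f_def attr_def)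
  have "\<exists>N. (\<forall>n\<le>N. \<forall>m\<le>N. m < n \<longrightarrow> f m \<subset> f n) \<and> (\<forall>n\<ge>N. f N = f n)"
  proof (rule finite_mono_remains_stable_implies_strict_prefix)
    show "finite (range f)"
      using bound assms by (intro finite_subset[of "range f" "Pow (attr E P T - T)"]) auto
    have "f m \<subseteq> f n" if "m \<le> n" for m n
      using monoD[OF attr_level_mono that, of E P T] unfolding f_def by blast
    then show "mono f" by (rule monoI)
    show "\<forall>n. f n = f (Suc n) \<longrightarrow> f (Suc n) = f (Suc (Suc n))"
    proof (intro allI impI)
      fix n assume "f n = f (Suc n)"
      then have "attr_level E P T n = attr_level E P T (Suc n)"
        using level[of n] level[of "Suc n"] by simp
      then have "attr_level E P T (Suc n) = attr_level E P T (Suc (Suc n))"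
        unfolding attr_level.simps(2)[of E P T "Suc n"] by simp
      then show "f (Suc n) = f (Suc (Suc n))" by (simp only: f_def)
    qed
  qed
  then have "f (card (attr E P T - T)) = (\<Union>k. f k)"
    using bound assms by (intro finite_mono_strict_prefix_implies_finite_fixpoint) auto
  moreover have "attr E P T = (\<Union>k. f k) \<union> T" unfolding attr_def level by blast
  ultimately show ?thesis using level by simp
qed

lemma attr_rank_le_card:
  assumes "finite (attr E P T)" "v \<in> attr E P T"
  shows "attr_rank E P T v \<le> card (attr E P T - T)"
  using attr_rank_le_iff[OF assms(2)] attr_eq_level[OF assms(1)] assms(2) by blast

lemma trap_compl_attr:
  assumes E: "arena E" and T: "T \<subseteq> Domain E"
  shows "trap E P (Domain E - attr E P T)"
  unfolding trap_def
proof (intro conjI ballI)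
  define k where "k = card (attr E P T - T)"
  have "finite (attr E P T)"
    using attr_subset_Domain[OF T] arena_finite_Domain[OF E] by (rule finite_subset)
  then have k: "attr E P T = attr_level E P T k" unfolding k_def by (rule attr_eq_level)
  fix v assume v: "v \<in> Domain E - attr E P T"
  then have "v \<in> Domain E" "v \<notin> attr_level E P T (Suc k)" unfolding attr_def by blast+
  then have "if v \<in> P then E `` {v} \<inter> attr E P T = {} else \<not> E `` {v} \<subseteq> attr E P T"
    unfolding k by (simp add: controlled_pre_def split: if_splits)
  moreover have "E `` {v} \<subseteq> Domain E" using arena_succ_in_Domain[OF E] by blast
  ultimately show "if v \<in> P then E `` {v} \<subseteq> Domain E - attr E P T
      else E `` {v} \<inter> (Domain E - attr E P T) \<noteq> {}"
    by (cases "v \<in> P") (simp; blast)+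
qed blast

lemma attr_visits_target:
  assumes u: "infpath E u"
    and move: "\<And>n. u n \<in> attr E P T - T \<Longrightarrow> u n \<in> P \<Longrightarrow> u (Suc n) = attr_move E P T (u n)"
  shows "u n \<in> attr E P T \<Longrightarrow> \<exists>m \<ge> n. u m \<in> T"
proof (induction "attr_rank E P T (u n)" arbitrary: n rule: less_induct)
  case less
  show ?case
  proof (cases "u n \<in> T")
    case False
    then have n: "u n \<in> attr E P T - T" using less.prems by simp
    have "u (Suc n) \<in> attr E P T" "attr_rank E P T (u (Suc n)) < attr_rank E P T (u n)"
      using attr_move(1,3)[OF n] attr_opponent_move[OF n _ infpathD[OF u]] move[OF n] by metis+
    then obtain m where "Suc n \<le> m" "u m \<in> T" using less.hyps by blast
    then show ?thesis using Suc_leD by blast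
  qed blast
qed

section \<open>Energy and parity objectives\<close>

definition esum :: "('v \<Rightarrow> int) \<Rightarrow> 'v word \<Rightarrow> nat \<Rightarrow> int" where
  "esum w u n = (\<Sum>k<n. w (u k))"

definition parity :: "bool \<Rightarrow> ('v \<Rightarrow> nat) \<Rightarrow> 'v word \<Rightarrow> bool" where
  "parity b pr u \<longleftrightarrow> (even (Min (limit (pr \<circ> u))) \<longleftrightarrow> b)"

definition energy_parity :: "bool \<Rightarrow> ('v \<Rightarrow> int) \<Rightarrow> ('v \<Rightarrow> nat) \<Rightarrow> 'v word \<Rightarrow> bool" where
  "energy_parity b w pr u \<longleftrightarrow> bdd_below (range (esum w u)) \<and> parity b pr u"

definition lax_energy_parity :: "bool \<Rightarrow> ('v \<Rightarrow> int) \<Rightarrow> ('v \<Rightarrow> nat) \<Rightarrow> 'v word \<Rightarrow> bool" where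
  "lax_energy_parity b w pr u \<longleftrightarrow>
     filterlim (esum w u) at_top sequentially \<or> energy_parity b w pr u"

lemma esum_0 [simp]: "esum w u 0 = 0"
  by (simp add: esum_def)

lemma esum_Suc [simp]: "esum w u (Suc n) = esum w u n + w (u n)"
  by (simp add: esum_def)

lemma esum_add: "esum w u (k + n) = esum w u k + esum w (suffix k u) n"
  by (induction n) simp_all

lemma esum_uminus: "esum (\<lambda>v. - w v) u n = - esum w u n"
  by (simp add: esum_def sum_negf)

subsection \<open>Closure under tails\<close>

lemma bdd_below_range_shift:
  fixes f :: "nat \<Rightarrow> 'a :: lattice"
  shows "bdd_below (range (\<lambda>n. f (k + n))) \<longleftrightarrow> bdd_below (range f)"
proof -
  have "n \<in> {..<k} \<union> range ((+) k)" for n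
    by (cases "n < k") (auto simp: image_iff intro: le_Suc_ex)
  then have "range f = f ` ({..<k} \<union> range ((+) k))" by blast
  then have "range f = f ` {..<k} \<union> range (\<lambda>n. f (k + n))"
    by (simp add: image_Un image_image)
  then show ?thesis by simp
qed

lemma bdd_below_range_add_iff:
  fixes f :: "'b \<Rightarrow> int"
  shows "bdd_below (range (\<lambda>n. c + f n)) \<longleftrightarrow> bdd_below (range f)"
proof -
  have "(\<forall>n. m \<le> c + f n) \<longleftrightarrow> (\<forall>n. m - c \<le> f n)" for m by (simp add: algebra_simps)
  then show ?thesis by (simp add: bdd_below_def) (metis add_diff_cancel)
qed

lemma filterlim_at_top_add_iff:
  fixes f :: "'b \<Rightarrow> int"
  shows "filterlim (\<lambda>n. c + f n) at_top F \<longleftrightarrow> filterlim f at_top F"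
proof -
  have "(\<forall>\<^sub>F n in F. m \<le> c + f n) \<longleftrightarrow> (\<forall>\<^sub>F n in F. m - c \<le> f n)" for m
    by (simp add: algebra_simps)
  then show ?thesis by (simp add: filterlim_at_top) (metis add_diff_cancel)
qed

lemma tail_closed_parity: "tail_closed (parity b pr)"
  unfolding tail_closed_def
proof (intro allI)
  fix u k
  have "pr \<circ> suffix k u = suffix k (pr \<circ> u)" by auto
  then show "parity b pr (suffix k u) \<longleftrightarrow> parity b pr u" by (simp add: parity_def)
qed

lemma tail_closed_bdd_below_esum: "tail_closed (\<lambda>u. bdd_below (range (esum w u)))"
  unfolding tail_closed_def
proof (intro allI)
  fix u k
  show "bdd_below (range (esum w (suffix k u))) \<longleftrightarrow> bdd_below (range (esum w u))"
    using bdd_below_range_add_iff[of "esum w u k" "esum w (suffix k u)"]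
      bdd_below_range_shift[of "esum w u" k] by (simp add: esum_add)
qed

lemma tail_closed_diverges: "tail_closed (\<lambda>u. filterlim (esum w u) at_top sequentially)"
  unfolding tail_closed_def
proof (intro allI)
  fix u k
  show "filterlim (esum w (suffix k u)) at_top sequentially \<longleftrightarrow>
      filterlim (esum w u) at_top sequentially"
    using filterlim_at_top_add_iff[of "esum w u k" "esum w (suffix k u)" sequentially]
      eventually_sequentially_seg[of "\<lambda>n. _ \<le> esum w u n" k]
    by (simp add: filterlim_at_top esum_add add.commute[of _ k])
qed

lemma tail_closed_energy_parity: "tail_closed (energy_parity b w pr)"
  using tail_closed_bdd_below_esum[of w] tail_closed_parity[of b pr]
  by (simp add: tail_closed_def energy_parity_def)

lemma tail_closed_lax_energy_parity: "tail_closed (lax_energy_parity b w pr)"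
  using tail_closed_diverges[of w] tail_closed_energy_parity[of b w pr]
  by (simp add: tail_closed_def lax_energy_parity_def)

subsection \<open>Closure under shuffling\<close>

lemma card_below_enumerate:
  fixes N :: "nat set"
  assumes "infinite N"
  shows "card (N \<inter> {..<enumerate N i}) = i"
proof -
  have "N \<inter> {..<enumerate N i} = enumerate N ` {..<i}"
  proof
    show "N \<inter> {..<enumerate N i} \<subseteq> enumerate N ` {..<i}"
      using enumerate_Ex[OF assms] enumerate_mono_iff[OF assms] by fastforce
  qed (use assms enumerate_in_set in auto)
  moreover have "inj_on (enumerate N) {..<i}"
    using inj_enumerate[OF assms] by (rule inj_on_subset) simp
  ultimately show ?thesis by (simp add: card_image)
qed

lemma filterlim_card_below:
  fixes N :: "nat set"
  assumes "infinite N"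
  shows "filterlim (\<lambda>n. card (N \<inter> {..<n})) at_top sequentially"
  unfolding filterlim_at_top
proof (intro allI eventually_sequentiallyI)
  fix i n assume "enumerate N i \<le> n"
  then have "card (N \<inter> {..<enumerate N i}) \<le> card (N \<inter> {..<n})" by (intro card_mono) auto
  then show "i \<le> card (N \<inter> {..<n})" by (simp add: card_below_enumerate[OF assms])
qed

lemma sum_enumerate:
  fixes N :: "nat set"
  assumes "infinite N"
  shows "(\<Sum>k \<in> N \<inter> {..<n}. w (u k)) = esum w (u \<circ> enumerate N) (card (N \<inter> {..<n}))"
proof (induction n)
  case (Suc n)
  show ?case
  proof (cases "n \<in> N")
    case True
    then obtain i where "enumerate N i = n" using enumerate_Ex[OF assms] by blast
    then have "enumerate N (card (N \<inter> {..<n})) = n"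
      using card_below_enumerate[OF assms, of i] by simp
    moreover have "N \<inter> {..<Suc n} = insert n (N \<inter> {..<n})" using True by auto
    ultimately show ?thesis using Suc by simp
  next
    case False
    then have "N \<inter> {..<Suc n} = N \<inter> {..<n}" by (auto simp: less_Suc_eq)
    then show ?thesis using Suc by simp
  qed
qed simp

lemma esum_shuffle:
  fixes N :: "nat set"
  assumes "infinite N" "infinite (- N)"
  shows "esum w u n = esum w (u \<circ> enumerate N) (card (N \<inter> {..<n})) +
    esum w (u \<circ> enumerate (- N)) (card (- N \<inter> {..<n}))"
  using sum.Int_Diff[of "{..<n}" "\<lambda>k. w (u k)" N] sum_enumerate[OF assms(1), of w u n]
    sum_enumerate[OF assms(2), of w u n]
  by (simp add: esum_def Int_commute Diff_eq)

lemma bdd_below_if_at_top: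
  fixes f :: "nat \<Rightarrow> 'a :: {linorder, lattice}"
  assumes "filterlim f at_top sequentially"
  shows "bdd_below (range f)"
proof -
  obtain k where "\<And>n. k \<le> n \<Longrightarrow> f 0 \<le> f n"
    using assms unfolding filterlim_at_top eventually_sequentially by blast
  then have "f 0 \<le> f (k + n)" for n by simp
  then have "bdd_below (range (\<lambda>n. f (k + n)))" by (rule bdd_belowI2)
  then show ?thesis using bdd_below_range_shift[of f k] by simp
qed

lemma filterlim_at_top_add_bdd_below:
  fixes f g :: "nat \<Rightarrow> int"
  assumes f: "filterlim f at_top sequentially" "filterlim h at_top sequentially"
    and g: "bdd_below (range g)"
  shows "filterlim (\<lambda>n. f (h n) + g (k n)) at_top sequentially"
    "filterlim (\<lambda>n. g (k n) + f (h n)) at_top sequentially"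
proof -
  obtain c where c: "\<And>n. c \<le> g n" using g by (auto simp: bdd_below_def)
  have "filterlim (\<lambda>n. c + f (h n)) at_top sequentially"
    using filterlim_compose[OF f] by (simp add: filterlim_at_top_add_iff)
  then show "filterlim (\<lambda>n. f (h n) + g (k n)) at_top sequentially"
    "filterlim (\<lambda>n. g (k n) + f (h n)) at_top sequentially"
    by (rule filterlim_at_top_mono; use c in \<open>simp add: add.commute\<close>)+
qed

lemma limit_shuffle:
  assumes "infinite N" "infinite (- N)"
  shows "limit u = limit (u \<circ> enumerate N) \<union> limit (u \<circ> enumerate (- N))"
proof -
  have part: "infinite (M \<inter> u -` {a}) \<longleftrightarrow> a \<in> limit (u \<circ> enumerate M)" if "infinite M" for M a
  proof -
    have "enumerate M ` ((u \<circ> enumerate M) -` {a}) = M \<inter> u -` {a}"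
      using enumerate_in_set[OF that] enumerate_Ex[OF that] by fastforce
    moreover have "inj_on (enumerate M) ((u \<circ> enumerate M) -` {a})"
      using inj_enumerate[OF that] by (rule inj_on_subset) simp
    ultimately show ?thesis unfolding limit_vimage by (metis finite_image_iff)
  qed
  have "u -` {a} = (N \<inter> u -` {a}) \<union> (- N \<inter> u -` {a})" for a by blast
  then have "a \<in> limit u \<longleftrightarrow> infinite (N \<inter> u -` {a}) \<or> infinite (- N \<inter> u -` {a})" for a
    unfolding limit_vimage by (metis finite_Un)
  then show ?thesis using part assms by blast
qed

lemma shuffle_closed_parity: "shuffle_closed (parity b pr)"
  unfolding shuffle_closed_def
proof (intro allI impI)
  fix u :: "'a word" and N
  assume u: "finite (range u) \<and> infinite N \<and> infinite (- N) \<and>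
    parity b pr (u \<circ> enumerate N) \<and> parity b pr (u \<circ> enumerate (- N))"
  define l1 l2
    where "l1 = limit (pr \<circ> (u \<circ> enumerate N))" and "l2 = limit (pr \<circ> (u \<circ> enumerate (- N)))"
  have limit: "finite (limit (pr \<circ> (u \<circ> f)))" "limit (pr \<circ> (u \<circ> f)) \<noteq> {}" for f
  proof -
    have "range (pr \<circ> (u \<circ> f)) \<subseteq> pr ` range u" by auto
    then have fin: "finite (range (pr \<circ> (u \<circ> f)))" by (rule finite_subset) (use u in simp)
    show "finite (limit (pr \<circ> (u \<circ> f)))" by (rule finite_subset[OF limit_in_range fin])
    show "limit (pr \<circ> (u \<circ> f)) \<noteq> {}" using limit_nonempty[OF fin] by blast
  qed
  have "limit (pr \<circ> u) = l1 \<union> l2"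
    using limit_shuffle[of N "pr \<circ> u"] u by (simp add: l1_def l2_def o_assoc)
  then have "Min (limit (pr \<circ> u)) = min (Min l1) (Min l2)"
    using limit by (simp add: Min_Un l1_def l2_def)
  then show "parity b pr u" using u by (simp add: parity_def l1_def l2_def min_def)
qed

lemma shuffle_closed_lax_energy_parity: "shuffle_closed (lax_energy_parity b w pr)"
  unfolding shuffle_closed_def
proof (intro allI impI)
  fix u :: "'a word" and N
  assume u: "finite (range u) \<and> infinite N \<and> infinite (- N) \<and>
    lax_energy_parity b w pr (u \<circ> enumerate N) \<and> lax_energy_parity b w pr (u \<circ> enumerate (- N))"
  let ?e1 = "esum w (u \<circ> enumerate N)" and ?e2 = "esum w (u \<circ> enumerate (- N))"
  have inf: "infinite N" "infinite (- N)" using u by auto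
  have esum: "esum w u = (\<lambda>n. ?e1 (card (N \<inter> {..<n})) + ?e2 (card (- N \<inter> {..<n})))"
    using esum_shuffle[OF inf] by auto
  have bdd: "bdd_below (range ?e1)" "bdd_below (range ?e2)"
    using u bdd_below_if_at_top by (auto simp: lax_energy_parity_def energy_parity_def)
  consider (diverges) "filterlim ?e1 at_top sequentially"
    | (diverges_compl) "filterlim ?e2 at_top sequentially"
    | (parity) "parity b pr (u \<circ> enumerate N)" "parity b pr (u \<circ> enumerate (- N))"
    using u by (auto simp: lax_energy_parity_def energy_parity_def)
  then show "lax_energy_parity b w pr u"
  proof cases
    case diverges
    show ?thesis
      using filterlim_at_top_add_bdd_below(1)[OF diverges filterlim_card_below[OF inf(1)] bdd(2)]
      by (simp add: lax_energy_parity_def esum)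
  next
    case diverges_compl
    show ?thesis
      using filterlim_at_top_add_bdd_below(2)[OF diverges_compl filterlim_card_below[OF inf(2)]
          bdd(1)]
      by (simp add: lax_energy_parity_def esum)
  next
    case parity
    then have "parity b pr u" using shuffle_closed_parity u unfolding shuffle_closed_def by blast
    moreover obtain c d where "\<And>n. c \<le> ?e1 n" "\<And>n. d \<le> ?e2 n"
      using bdd by (auto simp: bdd_below_def)
    then have "bdd_below (range (esum w u))"
      unfolding esum by (intro bdd_belowI2[of _ "c + d"] add_mono)
    ultimately show ?thesis by (simp add: lax_energy_parity_def energy_parity_def)
  qed
qed

subsection \<open>Parity\<close>

lemma parity_False_iff: "parity False pr u \<longleftrightarrow> \<not> parity True pr u"
  by (auto simp: parity_def)

lemma parity_cong: "(\<And>n. pr (u n) = pr' (z n)) \<Longrightarrow> parity b pr u \<longleftrightarrow> parity b pr' z"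
  by (simp add: parity_def o_def)

lemma parity_of_frequent_minimum:
  assumes u: "finite (range u)" and least: "\<And>n. p \<le> pr (u n)"
    and often: "\<exists>\<^sub>\<infinity>n. pr (u n) = p"
  shows "parity (even p) pr u"
proof -
  have "Min (limit (pr \<circ> u)) = p"
  proof (rule Min_eqI)
    have "finite (range (pr \<circ> u))" using finite_imageI[OF u, of pr] by (simp add: image_comp)
    then show "finite (limit (pr \<circ> u))" using limit_in_range finite_subset by metis
    show "p \<le> q" if "q \<in> limit (pr \<circ> u)" for q
      using that limit_in_range[of "pr \<circ> u"] least by auto
    show "p \<in> limit (pr \<circ> u)" using often by (simp add: limit_iff_frequent)
  qed
  then show ?thesis by (simp add: parity_def)
qed

text \<open>If the least priority is odd, then a player for whom odd priorities are good wins everywhere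
  as soon as she wins everywhere outside her attractor to it: she either stays outside forever, or
  reaches it again and again.\<close>

lemma avoid_region_eq_Domain_if_odd_min:
  assumes E: "arena E" and L: "tail_closed L" "\<And>u. L u \<Longrightarrow> parity True pr u"
    and p: "odd p" "\<And>v. v \<in> Domain E \<Longrightarrow> p \<le> pr v" and T: "T = {v \<in> Domain E. pr v = p}"
    and Y: "Y = Domain E - attr E P T" "Y \<subseteq> avoid_region (Restr E Y) P L"
  shows "avoid_region E P L = Domain E"
proof -
  have trap: "trap E P Y" unfolding Y(1) by (rule trap_compl_attr[OF E]) (simp add: T)
  obtain r where r: "positional (Restr E Y) P r"
      "\<And>v. v \<in> avoid_region (Restr E Y) P L \<Longrightarrow> avoids (conform (Restr E Y) P r) L v"
    using avoid_region_uniform[OF arena_Restr_trap[OF E trap] L(1)] by blast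
  define s where "s v = (if v \<in> Y then r v
      else if v \<in> T then SOME y. (v, y) \<in> E else attr_move E P T v)" for v
  have "positional E P s"
    using r(1) attr_move(2)[of _ E P T] unfolding positional_def Domain_Restr_trap[OF trap]
    by (auto simp: s_def Y(1) intro: someI)
  moreover have "\<not> L u" if u: "infpath (conform E P s) u" for u
  proof (cases "\<exists>k. \<forall>n. u (k + n) \<in> Y")
    case True
    then obtain k where k: "\<And>n. u (k + n) \<in> Y" by blast
    then have "infpath (conform (Restr E Y) P r) (suffix k u)"
      using infpathD[OF u, of "k + _"] k[of "Suc _"] by (auto simp: infpath_def conform_def s_def)
    then have "\<not> L (suffix k u)" using avoidsD[OF r(2)] k[of 0] Y(2) by fastforce
    then show ?thesis by (simp add: tail_closed_suffix[OF L(1)])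
  next
    case False
    have path: "infpath E u" using infpath_mono[OF u conform_subset] .
    have "\<exists>m \<ge> n. u m \<in> T" for n
    proof -
      obtain k where k: "u (n + k) \<notin> Y" using False by blast
      then have "u (n + k) \<in> attr E P T" using infpath_in_Domain[OF path] Y(1) by blast
      moreover have "u (Suc m) = attr_move E P T (u m)"
        if "u m \<in> attr E P T - T" "u m \<in> P" for m
        using infpathD[OF u, of m] that by (simp add: conform_def s_def Y(1))
      ultimately obtain m where "n + k \<le> m" "u m \<in> T" using attr_visits_target[OF path] by blast
      then show ?thesis by (intro exI[of _ m]) simp
    qed
    then have "\<exists>\<^sub>\<infinity>n. u n \<in> T" by (simp add: INFM_nat_le)
    then have "\<exists>\<^sub>\<infinity>n. pr (u n) = p" by (rule INFM_mono) (simp add: T)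
    then have "parity (even p) pr u"
      using p(2) infpath_in_Domain[OF path] finite_range_infpath[OF E path]
      by (intro parity_of_frequent_minimum) auto
    then show ?thesis using L(2) p(1) by (auto simp: parity_False_iff)
  qed
  ultimately show ?thesis
    by (auto simp: avoids_def elim: avoid_regionE intro: avoid_regionI)
qed

lemma ex_trap_without_odd_min:
  assumes E: "arena E" and L: "tail_closed L" "\<And>u. L u \<Longrightarrow> parity True pr u"
    and win: "avoid_region E (- P) L = {}"
    and ne: "Domain E \<noteq> {}" and p: "p = Min (pr ` Domain E)" "odd p"
  obtains X where "trap E (- P) X" "X \<noteq> {}" "p \<notin> pr ` X" "avoid_region (Restr E X) (- P) L = {}"
proof -
  define T where "T = {v \<in> Domain E. pr v = p}"
  define Y where "Y = Domain E - attr E (- P) T"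
  define X where "X = Domain (Restr E Y) - avoid_region (Restr E Y) (- P) L"
  have Y: "trap E (- P) Y" unfolding Y_def by (rule trap_compl_attr[OF E]) (simp add: T_def)
  note E_Y = arena_Restr_trap[OF E Y]
  have X: "trap (Restr E Y) (- P) X" unfolding X_def by (rule trap_compl_avoid_region[OF E_Y L(1)])
  have "p \<le> pr v" if "v \<in> Domain E" for v
    unfolding p(1) using that arena_finite_Domain[OF E] by simp
  then have "\<not> Y \<subseteq> avoid_region (Restr E Y) (- P) L"
    using avoid_region_eq_Domain_if_odd_min[OF E L p(2) _ T_def Y_def] win ne by blast
  then have "X \<noteq> {}" unfolding X_def Domain_Restr_trap[OF Y] by blast
  moreover have "X \<subseteq> Y" unfolding X_def Domain_Restr_trap[OF Y] by blast
  then have "p \<notin> pr ` X" using target_subset_attr[of T E "- P"] by (auto simp: Y_def T_def)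
  moreover have "avoid_region (Restr E X) (- P) L = {}"
    using avoid_region_Restr_compl[OF E_Y L(1), of "- P"] trap_trans(2)[OF Y X] by (simp add: X_def)
  ultimately show ?thesis using that trap_trans(1)[OF Y X] by blast
qed

section \<open>Good-for-energy strategies\<close>

text \<open>The closed walks of a good-for-energy graph have positive weight, or weight zero and even
  least priority.\<close>

definition good_for_energy :: "('v \<times> 'v) set \<Rightarrow> ('v \<Rightarrow> int) \<Rightarrow> ('v \<Rightarrow> nat) \<Rightarrow> bool" where
  "good_for_energy F w pr \<longleftrightarrow>
     (\<forall>u. infpath F u \<longrightarrow> \<not> lax_energy_parity False (\<lambda>v. - w v) pr u)"

lemma lax_energy_parity_disjoint:
  "\<not> (lax_energy_parity False (\<lambda>v. - w v) pr u \<and> lax_energy_parity True w pr u)"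
proof
  assume lax: "lax_energy_parity False (\<lambda>v. - w v) pr u \<and> lax_energy_parity True w pr u"
  then have "bdd_below (range (esum w u))" "bdd_below (range (esum (\<lambda>v. - w v) u))"
    using bdd_below_if_at_top by (auto simp: lax_energy_parity_def energy_parity_def)
  then obtain c d where c: "\<And>n. c \<le> esum w u n" and d: "\<And>n. d \<le> - esum w u n"
    by (auto simp: bdd_below_def esum_uminus)
  have "\<not> filterlim f at_top sequentially" if "\<And>n. f n \<le> a" for f :: "nat \<Rightarrow> int" and a
  proof
    assume "filterlim f at_top sequentially"
    then obtain n where "a + 1 \<le> f n"
      unfolding filterlim_at_top eventually_sequentially by blast
    with that[of n] show False by simp
  qed
  from this[of "esum w u" "- d"] this[of "esum (\<lambda>v. - w v) u" "- c"]
  have "parity False pr u \<and> parity True pr u"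
    using lax c d by (simp add: lax_energy_parity_def energy_parity_def esum_uminus le_minus_iff)
  then show False by (simp add: parity_def)
qed

text \<open>Unlike the energy parity objective, its lax variant is of the same kind for both players, so
  both have positional strategies.\<close>

theorem ex_good_for_energy_strategy:
  assumes E: "arena E" and win: "avoid_region E (- P) (energy_parity True w pr) = {}"
  obtains s where "positional E P s" "good_for_energy (conform E P s) w pr"
proof -
  let ?L = "lax_energy_parity False (\<lambda>v. - w v) pr" and ?L' = "lax_energy_parity True w pr"
  obtain s t where s: "positional E P s" and t: "positional E (- P) t"
    and det: "\<And>v. v \<in> Domain E \<Longrightarrow> avoids (conform E P s) ?L v \<or> avoids (conform E (- P) t) ?L' v"
    using positional_determinacy[OF E tail_closed_lax_energy_parity shuffle_closed_lax_energy_parity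
        tail_closed_lax_energy_parity shuffle_closed_lax_energy_parity lax_energy_parity_disjoint,
        of P w pr] by blast
  have "\<not> avoids (conform E (- P) t) ?L' v" if "v \<in> Domain E" for v
  proof -
    have "\<not> avoids (conform E (- P) t) (energy_parity True w pr) v"
      using win avoid_regionI[OF that t] by blast
    then show ?thesis by (auto simp: avoids_def lax_energy_parity_def)
  qed
  then have "avoids (conform E P s) ?L v" if "v \<in> Domain E" for v using det that by blast
  then have "\<not> ?L u" if "infpath (conform E P s) u" for u
    using avoidsD[OF _ that refl] infpath_in_Domain[OF infpath_mono[OF that conform_subset]]
    by blast
  then show ?thesis using that s by (simp add: good_for_energy_def)
qed

lemma good_for_energy_parity:
  assumes "good_for_energy F w pr" "infpath F u" "\<And>n. esum w u n \<le> c"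
  shows "parity True pr u"
proof -
  have "bdd_below (range (esum (\<lambda>v. - w v) u))"
    using assms(3) by (intro bdd_belowI2[of _ "- c"]) (simp add: esum_uminus)
  then show ?thesis
    using assms(1,2)
    by (auto simp: good_for_energy_def lax_energy_parity_def energy_parity_def parity_False_iff)
qed

subsection \<open>Closed walks\<close>

lemma infpath_iter:
  assumes "i < j" "u i = u j" "\<And>k. i \<le> k \<Longrightarrow> k < j \<Longrightarrow> (u k, u (Suc k)) \<in> F"
  shows "infpath F ((subsequence u i j)\<^sup>\<omega>)"
  unfolding infpath_def
proof
  fix n
  have iter: "(subsequence u i j)\<^sup>\<omega> m = u (i + m mod (j - i))" for m using assms(1) by simp
  define k where "k = i + n mod (j - i)"
  have "n mod (j - i) < j - i" using assms(1) by simp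
  then have k: "i \<le> k" "k < j" by (simp_all add: k_def)
  have "(subsequence u i j)\<^sup>\<omega> (Suc n) = u (Suc k)"
  proof (cases "Suc k = j")
    case True
    then have "Suc (n mod (j - i)) = j - i" using k by (simp add: k_def)
    then show ?thesis using assms(2) True by (simp add: iter mod_Suc)
  next
    case False
    then have "Suc (n mod (j - i)) \<noteq> j - i" using k by (auto simp: k_def)
    then show ?thesis by (simp add: iter mod_Suc k_def)
  qed
  then show "((subsequence u i j)\<^sup>\<omega> n, (subsequence u i j)\<^sup>\<omega> (Suc n)) \<in> F"
    using assms(3)[OF k] by (simp add: iter k_def)
qed

lemma sum_list_subsequence:
  "i \<le> j \<Longrightarrow> sum_list (map w (subsequence u i j)) = esum w u j - esum w u i"
  by (induction rule: dec_induct) simp_all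

lemma esum_iter:
  assumes "xs \<noteq> []"
  shows "esum w (xs\<^sup>\<omega>) (k * length xs + r) = int k * sum_list (map w xs) + esum w (xs\<^sup>\<omega>) r"
proof (induction k)
  case (Suc k)
  have "suffix (length xs) (xs\<^sup>\<omega>) = xs\<^sup>\<omega>" using assms by auto
  moreover have "esum w (xs\<^sup>\<omega>) (length xs) = sum_list (map w xs)"
    using assms by (simp add: esum_def sum_list_sum_nth atLeast0LessThan)
  ultimately have "esum w (xs\<^sup>\<omega>) (length xs + (k * length xs + r)) =
      sum_list (map w xs) + esum w (xs\<^sup>\<omega>) (k * length xs + r)"
    by (simp only: esum_add)
  then show ?case using Suc by (simp add: algebra_simps)
qed simp

lemma esum_iter_at_top:
  assumes xs: "xs \<noteq> []" and pos: "0 < sum_list (map w xs)"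
  shows "filterlim (esum w (xs\<^sup>\<omega>)) at_top sequentially"
proof -
  define c where "c = Min (esum w (xs\<^sup>\<omega>) ` {..<length xs})"
  have bound: "int (n div length xs) + c \<le> esum w (xs\<^sup>\<omega>) n" for n
  proof -
    have "c \<le> esum w (xs\<^sup>\<omega>) (n mod length xs)" using xs by (auto simp: c_def)
    moreover have "int (n div length xs) * 1 \<le> int (n div length xs) * sum_list (map w xs)"
      using pos by (intro mult_left_mono) auto
    ultimately show ?thesis
      using esum_iter[OF xs, of w "n div length xs" "n mod length xs"] by simp
  qed
  show ?thesis
    unfolding filterlim_at_top
  proof (intro allI eventually_sequentiallyI)
    fix m n assume n: "nat (m - c) * length xs \<le> n"
    then have "nat (m - c) \<le> n div length xs" using xs by (simp add: less_eq_div_iff_mult_less_eq)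
    then show "m \<le> esum w (xs\<^sup>\<omega>) n" using bound[of n] by linarith
  qed
qed

lemma good_for_energy_closed_walk:
  assumes good: "good_for_energy F w pr" and "i < j" "u i = u j"
    and path: "\<And>k. i \<le> k \<Longrightarrow> k < j \<Longrightarrow> (u k, u (Suc k)) \<in> F"
  shows "esum w u i \<le> esum w u j"
proof (rule ccontr)
  let ?xs = "subsequence u i j"
  assume "\<not> esum w u i \<le> esum w u j"
  then have "0 < sum_list (map (\<lambda>v. - w v) ?xs)"
    using assms(2) by (simp add: sum_list_subsequence esum_uminus)
  then have "lax_energy_parity False (\<lambda>v. - w v) pr (?xs\<^sup>\<omega>)"
    using assms(2) esum_iter_at_top[of ?xs] by (simp add: lax_energy_parity_def)
  then show False using good infpath_iter[OF assms(2,3) path] by (simp add: good_for_energy_def)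
qed

text \<open>Cutting a walk after the last visit to its first vertex leaves a walk that has lost this
  vertex.\<close>

lemma esum_ge_if_closed_walks_nonneg:
  assumes "finite V" "\<And>v. v \<in> V \<Longrightarrow> - W \<le> w v" "0 \<le> W" "\<And>k. k < n \<Longrightarrow> u k \<in> V"
    and "\<And>i j. i < j \<Longrightarrow> j < n \<Longrightarrow> u i = u j \<Longrightarrow> esum w u i \<le> esum w u j"
  shows "- (int (card V) * W) \<le> esum w u n"
  using assms
proof (induction "card V" arbitrary: V u n)
  case 0
  then have "n = 0" by fastforce
  then show ?case using 0 by simp
next
  case (Suc c)
  show ?case
  proof (cases "n = 0")
    case False
    define i where "i = Max {k. k < n \<and> u k = u 0}"
    have "i \<in> {k. k < n \<and> u k = u 0}" unfolding i_def using False by (intro Max_in) auto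
    then have i: "i < n" "u i = u 0" by simp_all
    have last: "u k \<noteq> u 0" if "i < k" "k < n" for k
    proof
      assume "u k = u 0"
      then have "k \<le> i" unfolding i_def using that by (intro Max_ge) auto
      then show False using that by simp
    qed
    define z m where "z = suffix (Suc i) u" and "m = n - Suc i"
    have n: "n = Suc i + m" using i(1) by (simp add: m_def)
    have esum_z: "esum w z k = esum w u (Suc i + k) - esum w u (Suc i)" for k
      using esum_add[of w u "Suc i" k] by (simp add: z_def)
    have "0 \<le> esum w u i" using Suc.prems(5)[of 0 i] i by (cases "i = 0") auto
    moreover have "- W \<le> w (u i)" using Suc.prems(2,4) i(1) by blast
    moreover have "- (int (card (V - {u 0})) * W) \<le> esum w z m"
    proof (rule Suc.hyps(1))
      have "u 0 \<in> V" using Suc.prems(4) False by blast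
      then show "c = card (V - {u 0})" using Suc.hyps(2) Suc.prems(1) by simp
      show "z k \<in> V - {u 0}" if "k < m" for k
        using that last[of "Suc i + k"] Suc.prems(4)[of "Suc i + k"] by (simp add: z_def n)
      show "esum w z k \<le> esum w z l" if "k < l" "l < m" "z k = z l" for k l
        using that Suc.prems(5)[of "Suc i + k" "Suc i + l"] unfolding esum_z by (simp add: z_def n)
    qed (use Suc.prems in auto)
    moreover have "int (card V) = int (card (V - {u 0})) + 1"
      using Suc.prems(1) Suc.prems(4)[of 0] False Suc.hyps(2) by simp
    ultimately show ?thesis using esum_z[of m] by (simp add: n algebra_simps)
  qed (use Suc.prems in simp)
qed

lemma good_for_energy_esum_ge:
  assumes good: "good_for_energy F w pr" and V: "finite V" "Domain F \<subseteq> V"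
    and w: "\<And>v. v \<in> V \<Longrightarrow> \<bar>w v\<bar> \<le> W" "0 \<le> W"
    and path: "\<And>k. k < n \<Longrightarrow> (u k, u (Suc k)) \<in> F"
  shows "- (int (card V) * W) \<le> esum w u n"
proof (rule esum_ge_if_closed_walks_nonneg[OF V(1) _ w(2)])
  show "- W \<le> w v" if "v \<in> V" for v using w(1)[OF that] by simp
  show "u k \<in> V" if "k < n" for k using path[OF that] V(2) by blast
  show "esum w u i \<le> esum w u j" if "i < j" "j < n" "u i = u j" for i j
    using path that by (intro good_for_energy_closed_walk[OF good]) auto
qed

section \<open>Capped energy\<close>

text \<open>The energy level \<open>- 1\<close> stands for exhausted energy; it is absorbing and gets the odd
  priority 1.\<close>

definition cap_step :: "int \<Rightarrow> ('v \<Rightarrow> int) \<Rightarrow> 'v \<Rightarrow> int \<Rightarrow> int" where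
  "cap_step D w v e = max (- 1) (min D (e + w v))"

definition cap_edges :: "('v \<times> 'v) set \<Rightarrow> int \<Rightarrow> ('v \<Rightarrow> int) \<Rightarrow> (('v \<times> int) \<times> ('v \<times> int)) set" where
  "cap_edges E D w =
     {((v, e), (y, cap_step D w v e)) | v e y. (v, y) \<in> E \<and> 0 \<le> e \<and> e \<le> D} \<union>
     {((v, - 1), (v, - 1)) | v. v \<in> Domain E}"

definition cap_prio :: "('v \<Rightarrow> nat) \<Rightarrow> 'v \<times> int \<Rightarrow> nat" where
  "cap_prio pr c = (if snd c < 0 then 1 else pr (fst c))"

definition cap_player :: "'v set \<Rightarrow> ('v \<times> int) set" where
  "cap_player P = P \<times> UNIV"

definition cap_strategy :: "int \<Rightarrow> ('v \<Rightarrow> int) \<Rightarrow> ('v \<Rightarrow> 'v) \<Rightarrow> 'v \<times> int \<Rightarrow> 'v \<times> int" where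
  "cap_strategy D w s c =
     (if 0 \<le> snd c then (s (fst c), cap_step D w (fst c) (snd c)) else c)"

abbreviation cap_conform ::
  "('v \<times> 'v) set \<Rightarrow> 'v set \<Rightarrow> ('v \<Rightarrow> int) \<Rightarrow> int \<Rightarrow> ('v \<times> int \<Rightarrow> 'v \<times> int) \<Rightarrow>
    (('v \<times> int) \<times> ('v \<times> int)) set" where
  "cap_conform E P w D \<equiv> conform (cap_edges E D w) (cap_player P)"

abbreviation cap_wins ::
  "('v \<times> 'v) set \<Rightarrow> 'v set \<Rightarrow> ('v \<Rightarrow> int) \<Rightarrow> ('v \<Rightarrow> nat) \<Rightarrow> int \<Rightarrow> ('v \<times> int \<Rightarrow> 'v \<times> int) \<Rightarrow>
    'v \<times> int \<Rightarrow> bool" where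
  "cap_wins E P w pr D s \<equiv> avoids (cap_conform E P w D s) (parity False (cap_prio pr))"

definition cap_suffices ::
  "('v \<times> 'v) set \<Rightarrow> 'v set \<Rightarrow> ('v \<Rightarrow> int) \<Rightarrow> ('v \<Rightarrow> nat) \<Rightarrow> int \<Rightarrow> bool" where
  "cap_suffices E P w pr D \<longleftrightarrow> (\<forall>v \<in> Domain E.
     (v, D) \<notin> avoid_region (cap_edges E D w) (- cap_player P) (parity True (cap_prio pr)))"

lemma cap_step_ge_minus_one: "- 1 \<le> cap_step D w v e"
  by (simp add: cap_step_def)

lemma cap_step_le: "0 \<le> D \<Longrightarrow> cap_step D w v e \<le> D"
  by (simp add: cap_step_def)

lemma mem_cap_player [simp]: "(v, e) \<in> cap_player P \<longleftrightarrow> v \<in> P"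
  by (simp add: cap_player_def)

lemma cap_edges_iff:
  "((v, e), (y, f)) \<in> cap_edges E D w \<longleftrightarrow>
     0 \<le> e \<and> e \<le> D \<and> (v, y) \<in> E \<and> f = cap_step D w v e \<or>
     e = - 1 \<and> f = - 1 \<and> y = v \<and> v \<in> Domain E"
  by (auto simp: cap_edges_def)

lemma Domain_cap_edges:
  assumes "0 \<le> D"
  shows "Domain (cap_edges E D w) = Domain E \<times> {- 1..D}"
proof
  show "Domain E \<times> {- 1..D} \<subseteq> Domain (cap_edges E D w)"
  proof
    fix c assume "c \<in> Domain E \<times> {- 1..D}"
    then obtain v e y where c: "c = (v, e)" "(v, y) \<in> E" "- 1 \<le> e" "e \<le> D" by auto
    then have "(c, if e = - 1 then c else (y, cap_step D w v e)) \<in> cap_edges E D w"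
      by (auto simp: cap_edges_iff)
    then show "c \<in> Domain (cap_edges E D w)" by blast
  qed
qed (use assms in \<open>auto simp: cap_edges_def\<close>)

lemma arena_cap_edges:
  assumes "arena E" "0 \<le> D"
  shows "arena (cap_edges E D w)"
proof -
  have range: "Range (cap_edges E D w) \<subseteq> Domain E \<times> {- 1..D}"
    using assms cap_step_ge_minus_one[of D w] cap_step_le[of D w] arena_succ_in_Domain[OF assms(1)]
    by (fastforce simp: cap_edges_def)
  then have "cap_edges E D w \<subseteq> (Domain E \<times> {- 1..D}) \<times> (Domain E \<times> {- 1..D})"
    using Domain_cap_edges[OF assms(2), of E w]
    by (intro subrelI SigmaI) (blast dest: DomainI RangeI)+
  moreover have "finite (Domain E \<times> {- 1..D})" using arena_finite_Domain[OF assms(1)] by simp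
  ultimately have "finite (cap_edges E D w)" by (meson finite_SigmaI finite_subset)
  then show ?thesis using range by (simp add: arena_def Domain_cap_edges[OF assms(2)])
qed

lemma cap_edges_exhausted:
  assumes "infpath (cap_edges E D w) u" "snd (u n) < 0" "n \<le> m"
  shows "snd (u m) < 0"
  using assms(3)
proof (induction m rule: dec_induct)
  case (step m)
  then show ?case
    using infpathD[OF assms(1), of m] by (cases "u m"; cases "u (Suc m)") (auto simp: cap_edges_iff)
qed (rule assms)

lemma positional_cap_strategy:
  assumes "positional E P s"
  shows "positional (cap_edges E D w) (cap_player P) (cap_strategy D w s)"
proof -
  have "(v, s v) \<in> E" if "v \<in> P" "(v, y) \<in> E" for v y
    using assms that by (auto simp: positional_def)
  then show ?thesis
    unfolding positional_def by (auto simp: cap_edges_iff cap_strategy_def)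
qed

lemma not_avoids_exhausted:
  assumes s: "positional (cap_edges E D w) (cap_player P) s" and v: "v \<in> Domain E"
  shows "\<not> cap_wins E P w pr D s (v, - 1)"
proof -
  let ?u = "\<lambda>_ :: nat. (v, - 1 :: int)"
  have edge: "((v, - 1), (v, - 1)) \<in> cap_edges E D w" using v by (simp add: cap_edges_iff)
  have "s (v, - 1) = (v, - 1)" if "v \<in> P"
  proof -
    have "((v, - 1), s (v, - 1)) \<in> cap_edges E D w"
      using s that edge by (auto simp: positional_def)
    then show ?thesis by (cases "s (v, - 1)") (auto simp: cap_edges_iff)
  qed
  then have "infpath (cap_conform E P w D s) ?u"
    using edge by (auto simp: infpath_def conform_def)
  moreover have "parity (even (1 :: nat)) (cap_prio pr) ?u"
    by (rule parity_of_frequent_minimum) (simp_all add: cap_prio_def)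
  ultimately show ?thesis by (auto simp: avoids_def)
qed

lemma cap_suffices_strategy:
  assumes "arena E" "0 \<le> D" "cap_suffices E P w pr D"
  obtains s where "positional (cap_edges E D w) (cap_player P) s"
    "\<And>v. v \<in> Domain E \<Longrightarrow> cap_wins E P w pr D s (v, D)"
proof -
  let ?K = "cap_edges E D w"
  have disj: "\<not> (parity False (cap_prio pr) u \<and> parity True (cap_prio pr) u)"
    for u :: "('a \<times> int) word" by (simp add: parity_def)
  obtain s t where s: "positional ?K (cap_player P) s" and t: "positional ?K (- cap_player P) t"
    and det: "\<And>c. c \<in> Domain ?K \<Longrightarrow> cap_wins E P w pr D s c \<or>
       avoids (conform ?K (- cap_player P) t) (parity True (cap_prio pr)) c"
    using positional_determinacy[OF arena_cap_edges[OF assms(1,2), of w]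
        tail_closed_parity shuffle_closed_parity tail_closed_parity shuffle_closed_parity disj,
        of "cap_player P"] by blast
  have "cap_wins E P w pr D s (v, D)" if v: "v \<in> Domain E" for v
  proof -
    have "(v, D) \<in> Domain ?K" using v assms(2) Domain_cap_edges[OF assms(2), of E w] by simp
    then show ?thesis
      using det avoid_regionI[OF _ t] assms(3) v unfolding cap_suffices_def by blast
  qed
  then show ?thesis using that s by blast
qed

primrec cap_level :: "int \<Rightarrow> ('v \<Rightarrow> int) \<Rightarrow> 'v word \<Rightarrow> nat \<Rightarrow> int" where
  "cap_level D w u 0 = D"
| "cap_level D w u (Suc n) = cap_step D w (u n) (cap_level D w u n)"

lemma cap_level_le: "0 \<le> D \<Longrightarrow> cap_level D w u n \<le> D"
  by (cases n) (simp_all add: cap_step_le)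

lemma winning_cap_play:
  assumes E: "arena E" and D: "0 \<le> D"
    and s: "positional (cap_edges E D w) (cap_player P) s"
    and win: "u 0 \<in> Domain E" "cap_wins E P w pr D s (u 0, D)"
    and step: "\<And>n. u n \<in> Domain E \<Longrightarrow> 0 \<le> cap_level D w u n \<Longrightarrow>
      ((u n, cap_level D w u n), (u (Suc n), cap_level D w u (Suc n)))
        \<in> cap_conform E P w D s"
  shows "parity True pr u" "- D \<le> esum w u n"
proof -
  let ?F = "cap_conform E P w D s" and ?e = "cap_level D w u"
  have inv: "u n \<in> Domain E \<and> avoids ?F (parity False (cap_prio pr)) (u n, ?e n) \<and>
      0 \<le> ?e n \<and> ?e n \<le> D + esum w u n" for n
  proof (induction n)
    case (Suc n)
    then have edge: "((u n, ?e n), (u (Suc n), ?e (Suc n))) \<in> ?F" using step by blast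
    then have "(u n, u (Suc n)) \<in> E" using Suc by (auto simp: conform_def cap_edges_iff)
    then have u_Suc: "u (Suc n) \<in> Domain E" by (rule arena_succ_in_Domain[OF E])
    have win_Suc: "avoids ?F (parity False (cap_prio pr)) (u (Suc n), ?e (Suc n))"
      using Suc avoids_rtrancl[OF tail_closed_parity _ r_into_rtrancl[OF edge]] by blast
    then have "?e (Suc n) \<noteq> - 1" using not_avoids_exhausted[OF s u_Suc] by metis
    then have "0 \<le> ?e (Suc n)" using cap_step_ge_minus_one[of D w "u n" "?e n"] by simp
    moreover from this have "?e (Suc n) \<le> D + esum w u (Suc n)"
      using Suc unfolding cap_level.simps cap_step_def esum_Suc by linarith
    ultimately show ?case using u_Suc win_Suc by blast
  qed (use win D in simp)
  then show "- D \<le> esum w u n" by (smt (verit))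
  have "infpath ?F (\<lambda>n. (u n, ?e n))" unfolding infpath_def using inv step by blast
  with win(2) have "\<not> parity False (cap_prio pr) (\<lambda>n. (u n, ?e n))" by (rule avoidsD) simp
  moreover have "cap_prio pr (u n, ?e n) = pr (u n)" for n
    using inv[of n] by (simp add: cap_prio_def)
  then have "parity False (cap_prio pr) (\<lambda>n. (u n, ?e n)) \<longleftrightarrow> parity False pr u" by (rule parity_cong)
  ultimately show "parity True pr u" by (simp add: parity_False_iff)
qed

lemma cap_play_below_cap:
  assumes D: "0 \<le> D" and u: "infpath (cap_edges E D w) u" and start: "0 \<le> snd (u 0)"
    and below: "\<And>n. snd (u n) \<noteq> D"
    and esum: "\<And>n. (\<And>k. k < n \<Longrightarrow> 0 \<le> snd (u k)) \<Longrightarrow> 0 \<le> snd (u 0) + esum w (fst \<circ> u) n"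
  shows "0 \<le> snd (u n) \<and> snd (u n) = snd (u 0) + esum w (fst \<circ> u) n"
proof (induction n rule: less_induct)
  case (less n)
  show ?case
  proof (cases n)
    case 0
    then show ?thesis using start by simp
  next
    case (Suc m)
    then have "0 \<le> snd (u m)" "snd (u m) = snd (u 0) + esum w (fst \<circ> u) m"
      using less[of m] by blast+
    moreover from this(1) have "snd (u n) = cap_step D w (fst (u m)) (snd (u m))"
      using infpathD[OF u, of m] Suc by (cases "u m"; cases "u n") (auto simp: cap_edges_iff)
    moreover have "0 \<le> snd (u 0) + esum w (fst \<circ> u) n" using esum less by blast
    moreover have "esum w (fst \<circ> u) n = esum w (fst \<circ> u) m + w (fst (u m))" by (simp add: Suc)
    ultimately show ?thesis using below[of n] D unfolding cap_step_def by linarith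
  qed
qed

subsection \<open>Constructing plays\<close>

lemma ex_infpath_or_exit:
  assumes z0: "z0 \<in> I" and succ: "\<And>z. z \<in> I \<Longrightarrow> \<exists>z'. (z, z') \<in> R"
  obtains (stays) u where "infpath R u" "u 0 = z0" "range u \<subseteq> I"
  | (exits) z z' where "(z0, z) \<in> R\<^sup>*" "z \<in> I" "(z, z') \<in> R" "z' \<notin> I"
proof (cases "\<exists>z z'. (z0, z) \<in> R\<^sup>* \<and> z \<in> I \<and> (z, z') \<in> R \<and> z' \<notin> I")
  case False
  define J where "J = {z \<in> I. (z0, z) \<in> R\<^sup>*}"
  have "\<exists>z'. z' \<in> J \<and> (z, z') \<in> R" if z: "z \<in> J" for z
  proof -
    obtain z' where z': "(z, z') \<in> R" using succ z by (auto simp: J_def)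
    moreover have "(z0, z') \<in> R\<^sup>*" using z z' by (auto simp: J_def)
    ultimately show ?thesis using False z by (auto simp: J_def)
  qed
  then obtain g where g: "\<And>z. z \<in> J \<Longrightarrow> g z \<in> J \<and> (z, g z) \<in> R" by metis
  define u where "u n = (g ^^ n) z0" for n
  have J: "u n \<in> J" for n
    by (induction n) (use g z0 in \<open>auto simp: u_def J_def\<close>)
  then have "infpath R u" using g by (auto simp: infpath_def u_def)
  moreover have "u 0 = z0" "range u \<subseteq> I" using J by (auto simp: u_def J_def)
  ultimately show ?thesis by (rule stays)
qed (use exits in blast)

lemma arena_ex_infpath:
  assumes "arena E" "v \<in> Domain E"
  obtains u where "infpath E u" "u 0 = v"
  by (rule ex_infpath_or_exit[OF assms(2), of E])
    (use that arena_succ_in_Domain[OF assms(1)] in blast)+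

lemma arena_conform:
  assumes E: "arena E" and s: "positional E P s"
  shows "Domain (conform E P s) = Domain E" "arena (conform E P s)"
proof -
  show dom: "Domain (conform E P s) = Domain E"
    using s by (force simp: conform_def positional_def)
  show "arena (conform E P s)"
    using E conform_subset[of E P s] unfolding arena_def dom
    by (meson Range_mono finite_subset order_trans)
qed

lemma infpath_of_cycle:
  assumes "(z, z) \<in> F\<^sup>+"
  obtains u where "infpath F u" "u 0 = z" "z \<in> limit u"
proof -
  obtain n where "0 < n" "(z, z) \<in> F ^^ n" using assms by (auto simp: trancl_power)
  then obtain f where f: "f 0 = z" "f n = z" "\<And>i. i < n \<Longrightarrow> (f i, f (Suc i)) \<in> F"
    by (auto simp: relpow_fun_conv)
  show ?thesis
  proof (rule that)
    show "infpath F ((prefix n f)\<^sup>\<omega>)" using \<open>0 < n\<close> f by (intro infpath_iter) auto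
    show "(prefix n f)\<^sup>\<omega> 0 = z" using \<open>0 < n\<close> f(1) by simp
    show "z \<in> limit ((prefix n f)\<^sup>\<omega>)"
      using \<open>0 < n\<close> f(1) by (auto simp: image_iff intro!: bexI[of _ 0])
  qed
qed

lemma finite_trancl_cycle:
  assumes Z: "finite Z" "Z \<noteq> {}" and succ: "\<And>z. z \<in> Z \<Longrightarrow> \<exists>z' \<in> Z. (z, z') \<in> F\<^sup>+"
  obtains z where "z \<in> Z" "(z, z) \<in> F\<^sup>+"
proof -
  let ?R = "Restr (F\<^sup>+) Z"
  have "\<not> acyclic ?R"
  proof
    assume "acyclic ?R"
    then have "wf (?R\<inverse>)" using Z(1) by (intro finite_acyclic_wf_converse) auto
    then obtain z where "z \<in> Z" "\<And>z'. (z', z) \<in> ?R\<inverse> \<Longrightarrow> z' \<notin> Z"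
      using Z(2) by (metis wfE_min equals0I)
    then show False using succ by blast
  qed
  then obtain z where "(z, z) \<in> ?R\<^sup>+" by (auto simp: acyclic_def)
  moreover have "trans ?R" by (intro trans_Restr trans_trancl)
  ultimately show ?thesis using that by (auto simp: trancl_id)
qed

subsection \<open>Refuting a positional strategy of the opponent\<close>

text \<open>The opponent's strategy \<open>t\<close> is fixed, so the plays of the capped game are the paths of one
  graph, and configurations that are lost for the player stay lost along its edges.\<close>

locale capped_game =
  fixes E :: "('v \<times> 'v) set" and P :: "'v set" and w :: "'v \<Rightarrow> int" and pr :: "'v \<Rightarrow> nat"
    and D W :: int and t :: "'v \<times> int \<Rightarrow> 'v \<times> int"
  assumes arena: "arena E" and D_nonneg: "0 \<le> D" and W_pos: "1 \<le> W"
    and abs_weight_le: "\<And>v. v \<in> Domain E \<Longrightarrow> \<bar>w v\<bar> \<le> W"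
    and positional_t: "positional (cap_edges E D w) (- cap_player P) t"
begin

definition t_edges :: "(('v \<times> int) \<times> ('v \<times> int)) set" where
  "t_edges = conform (cap_edges E D w) (- cap_player P) t"

abbreviation lost :: "'v \<times> int \<Rightarrow> bool" where
  "lost \<equiv> avoids t_edges (parity True (cap_prio pr))"

lemma t_edges_subset: "t_edges \<subseteq> cap_edges E D w"
  unfolding t_edges_def by (rule conform_subset)

lemma arena_t_edges: "Domain t_edges = Domain E \<times> {- 1..D}" "arena t_edges"
  unfolding t_edges_def
  using arena_conform[OF arena_cap_edges[OF arena D_nonneg] positional_t]
  by (simp_all add: Domain_cap_edges[OF D_nonneg])

lemma lost_rtrancl: "lost c \<Longrightarrow> (c, d) \<in> t_edges\<^sup>* \<Longrightarrow> lost d"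
  by (rule avoids_rtrancl[OF tail_closed_parity])

lemma rtrancl_t_edges_in_Domain:
  assumes "(c, d) \<in> t_edges\<^sup>*" "c \<in> Domain E \<times> {- 1..D}"
  shows "d \<in> Domain E \<times> {- 1..D}"
  using assms
  by (induction rule: rtrancl_induct)
    (use arena_succ_in_Domain[OF arena_t_edges(2)] arena_t_edges(1) in auto)

lemma t_edgesD:
  assumes "((v, e), (y, f)) \<in> t_edges" "0 \<le> e"
  shows "(v, y) \<in> E" "f = cap_step D w v e"
  using assms t_edges_subset by (auto simp: cap_edges_iff)

lemma own_t_edge:
  "0 \<le> e \<Longrightarrow> e \<le> D \<Longrightarrow> v \<in> P \<Longrightarrow> (v, y) \<in> E \<Longrightarrow> ((v, e), (y, cap_step D w v e)) \<in> t_edges"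
  by (simp add: t_edges_def conform_def cap_edges_iff)

lemma t_edges_ex_succ:
  assumes "v \<in> Domain E" "0 \<le> e" "e \<le> D"
  obtains y where "(v, y) \<in> E" "((v, e), (y, cap_step D w v e)) \<in> t_edges"
proof -
  have "(v, e) \<in> Domain t_edges" using assms arena_t_edges(1) by simp
  then obtain y f where "((v, e), (y, f)) \<in> t_edges" by auto
  then show ?thesis using that t_edgesD[OF _ assms(2)] by blast
qed

lemma cap_step_ge: "v \<in> Domain E \<Longrightarrow> c \<le> D \<Longrightarrow> c \<le> e - W \<Longrightarrow> c \<le> cap_step D w v e"
  using abs_weight_le[of v] by (auto simp: cap_step_def)

lemma attr_run:
  assumes T: "T \<subseteq> Domain E" and c: "0 \<le> c"
  shows "v \<in> attr E P T \<Longrightarrow> int (attr_rank E P T v) * W + c \<le> e \<Longrightarrow> e \<le> D \<Longrightarrow>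
    \<exists>z f. z \<in> T \<and> c \<le> f \<and> f \<le> D \<and> ((v, e), (z, f)) \<in> t_edges\<^sup>*"
proof (induction "attr_rank E P T v" arbitrary: v e rule: less_induct)
  case less
  let ?r = "attr_rank E P T"
  have "0 \<le> int (?r v) * W" using W_pos by simp
  then have e: "c \<le> e" "0 \<le> e" "e \<le> D" using less.prems c by linarith+
  show ?case
  proof (cases "v \<in> T")
    case True
    then show ?thesis using e by blast
  next
    case False
    then have v: "v \<in> attr E P T - T" "v \<in> Domain E"
      using less.prems(1) attr_subset_Domain[OF T] by blast+
    obtain y where y: "y \<in> attr E P T" "?r y < ?r v" "((v, e), (y, cap_step D w v e)) \<in> t_edges"
    proof (cases "v \<in> P")
      case True
      then show ?thesis using that attr_move[OF v(1) True] own_t_edge[OF e(2,3) True] by blast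
    next
      case False
      obtain y where "(v, y) \<in> E" "((v, e), (y, cap_step D w v e)) \<in> t_edges"
        using t_edges_ex_succ[OF v(2) e(2,3)] .
      then show ?thesis using that attr_opponent_move[OF v(1) False] by blast
    qed
    have "(int (?r y) + 1) * W \<le> int (?r v) * W" using y(2) W_pos by (intro mult_right_mono) auto
    then have "int (?r y) * W + c \<le> e - W" using less.prems(2) by (simp add: algebra_simps)
    then have "int (?r y) * W + c \<le> cap_step D w v e"
      using e W_pos by (intro cap_step_ge[OF v(2)]) auto
    from less.hyps[OF y(2,1) this cap_step_le[OF D_nonneg]] obtain z f
      where "z \<in> T" "c \<le> f" "f \<le> D" "((y, cap_step D w v e), (z, f)) \<in> t_edges\<^sup>*" by blast
    then show ?thesis using converse_rtrancl_into_rtrancl[OF y(3)] by blast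
  qed
qed

lemma recharge_run:
  assumes s: "positional E P s" "good_for_energy (conform E P s) w pr"
    and v: "v \<in> Domain E" and e: "int (card (Domain E)) * W \<le> e" "e \<le> D" and lost: "lost (v, e)"
  shows "\<exists>q. ((v, e), (q, D)) \<in> t_edges\<^sup>*"
proof (rule ccontr)
  assume never: "\<not> (\<exists>q. ((v, e), (q, D)) \<in> t_edges\<^sup>*)"
  let ?F = "conform E P s" and ?R = "conform t_edges (cap_player P) (cap_strategy D w s)"
  have e0: "0 \<le> e" using e(1) W_pos by (smt (verit) mult_nonneg_nonneg of_nat_0_le_iff)
  have "positional t_edges (cap_player P) (cap_strategy D w s)"
    using positional_cap_strategy[OF s(1)] by (auto simp: positional_def t_edges_def conform_def)
  then have "arena ?R" "(v, e) \<in> Domain ?R"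
    using arena_conform[OF arena_t_edges(2)] arena_t_edges(1) v e(2) e0 by auto
  from arena_ex_infpath[OF this] obtain u where u: "infpath ?R u" "u 0 = (v, e)" .
  have u_path: "infpath t_edges u" by (rule infpath_mono[OF u(1) conform_subset])
  have not_full: "snd (u n) \<noteq> D" for n
    using infpath_rtrancl[OF u_path, of n] u(2) never by (metis prod.collapse)
  have step: "(fst (u n), fst (u (Suc n))) \<in> ?F" if "0 \<le> snd (u n)" for n
    using infpathD[OF u(1), of n] that t_edges_subset
    by (cases "u n"; cases "u (Suc n)") (auto simp: conform_def cap_strategy_def cap_edges_iff)
  have "0 \<le> snd (u 0) + esum w (fst \<circ> u) n" if "\<And>k. k < n \<Longrightarrow> 0 \<le> snd (u k)" for n
  proof -
    have "- (int (card (Domain E)) * W) \<le> esum w (fst \<circ> u) n"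
      using that step abs_weight_le W_pos conform_subset[of E P s] arena_finite_Domain[OF arena]
      by (intro good_for_energy_esum_ge[OF s(2)]) auto
    then show ?thesis using e(1) u(2) by simp
  qed
  then have energy: "0 \<le> snd (u n) \<and> snd (u n) = snd (u 0) + esum w (fst \<circ> u) n" for n
    using infpath_mono[OF u_path t_edges_subset] not_full u(2) e0
    by (intro cap_play_below_cap[OF D_nonneg]) auto
  moreover have "snd (u n) \<le> D" for n
    using infpath_in_Domain[OF u_path, of n] arena_t_edges(1) by auto
  ultimately have "esum w (fst \<circ> u) n \<le> D" for n using u(2) e0 by (smt (verit) snd_conv)
  moreover have "infpath ?F (fst \<circ> u)" unfolding infpath_def o_def using step energy by blast
  ultimately have "parity True pr (fst \<circ> u)" by (intro good_for_energy_parity[OF s(2)])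
  moreover have "cap_prio pr (u n) = pr ((fst \<circ> u) n)" for n
    using conjunct1[OF energy[of n]] by (simp add: cap_prio_def)
  then have "parity True (cap_prio pr) u \<longleftrightarrow> parity True pr (fst \<circ> u)" by (rule parity_cong)
  ultimately have "parity True (cap_prio pr) u" by blast
  then show False using avoidsD[OF lost u_path u(2)] by blast
qed

end

text \<open>A winning strategy \<open>s\<close> for the smaller cap \<open>D'\<close> on \<open>X\<close> is followed together with its own
  energy level \<open>e'\<close>, which stays below the actual level.\<close>

locale shadowed_game = capped_game E P w pr D W t
  for E :: "('v \<times> 'v) set" and P w pr D W t +
  fixes X :: "'v set" and D' c :: int and s :: "'v \<times> int \<Rightarrow> 'v \<times> int"
  assumes Domain_X: "Domain (Restr E X) = X" and D'_nonneg: "0 \<le> D'"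
    and slack: "0 \<le> c" "c \<le> D - D'"
    and positional_s: "positional (cap_edges (Restr E X) D' w) (cap_player P) s"
begin

definition s_edges :: "(('v \<times> int) \<times> ('v \<times> int)) set" where
  "s_edges = cap_conform (Restr E X) P w D' s"

abbreviation won :: "'v \<times> int \<Rightarrow> bool" where
  "won \<equiv> avoids s_edges (parity False (cap_prio pr))"

definition safe :: "(('v \<times> int) \<times> int) set" where
  "safe = {((v, e), e'). v \<in> X \<and> won (v, e') \<and> 0 \<le> e' \<and> e' \<le> D' \<and> e' + c \<le> e \<and> e \<le> D}"

definition shadow_edges :: "((('v \<times> int) \<times> int) \<times> (('v \<times> int) \<times> int)) set" where
  "shadow_edges = {(((v, e), e'), ((y, f), f')).
     ((v, e), (y, f)) \<in> t_edges \<and> f' = cap_step D' w v e' \<and> (v \<in> P \<longrightarrow> y = fst (s (v, e')))}"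

lemma X_subset: "X \<subseteq> Domain E"
  using Domain_X by blast

lemma s_move:
  assumes "v \<in> P" "v \<in> X" "0 \<le> e'" "e' \<le> D'"
  shows "(v, fst (s (v, e'))) \<in> Restr E X" "snd (s (v, e')) = cap_step D' w v e'"
proof -
  have "(v, e') \<in> Domain (cap_edges (Restr E X) D' w)"
    using assms Domain_cap_edges[OF D'_nonneg, of "Restr E X"] Domain_X by simp
  then have "((v, e'), s (v, e')) \<in> cap_edges (Restr E X) D' w"
    using positional_s assms(1) by (simp add: positional_def)
  then show "(v, fst (s (v, e'))) \<in> Restr E X" "snd (s (v, e')) = cap_step D' w v e'"
    using assms(3) by (cases "s (v, e')"; auto simp: cap_edges_iff)+
qed

lemma shadow_step:
  assumes "((v, e), e') \<in> safe" "(((v, e), e'), ((y, f), f')) \<in> shadow_edges"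
  shows "y \<in> X \<Longrightarrow> ((v, e'), (y, f')) \<in> s_edges" "y \<notin> X \<Longrightarrow> v \<notin> P"
proof -
  have v: "v \<in> X" "0 \<le> e'" "e' \<le> D'" "0 \<le> e" using assms(1) slack(1) by (auto simp: safe_def)
  have y: "((v, e), (y, f)) \<in> t_edges" "f' = cap_step D' w v e'" "v \<in> P \<Longrightarrow> y = fst (s (v, e'))"
    using assms(2) by (auto simp: shadow_edges_def)
  then show "y \<notin> X \<Longrightarrow> v \<notin> P" using s_move(1)[OF _ v(1-3)] by auto
  assume "y \<in> X"
  then have "((v, e'), (y, f')) \<in> cap_edges (Restr E X) D' w"
    using t_edgesD(1)[OF y(1) v(4)] v y(2) by (simp add: cap_edges_iff)
  moreover have "(y, f') = s (v, e')" if "v \<in> P"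
    using s_move(2)[OF that v(1-3)] y(2,3) that by (simp add: prod_eq_iff)
  ultimately show "((v, e'), (y, f')) \<in> s_edges" by (simp add: s_edges_def conform_def)
qed

lemma safe_step:
  assumes z: "((v, e), e') \<in> safe" "(((v, e), e'), ((y, f), f')) \<in> shadow_edges" and y: "y \<in> X"
  shows "((y, f), f') \<in> safe"
proof -
  have v: "won (v, e')" "e' + c \<le> e" "0 \<le> e" using z(1) slack(1) by (auto simp: safe_def)
  have f: "f = cap_step D w v e" "f' = cap_step D' w v e'"
    using z(2) t_edgesD(2)[OF _ v(3)] by (auto simp: shadow_edges_def)
  have won: "won (y, f')"
    using avoids_rtrancl[OF tail_closed_parity v(1)] shadow_step(1)[OF z y] by blast
  then have "f' \<noteq> - 1"
    using not_avoids_exhausted[OF positional_s] y Domain_X by (auto simp: s_edges_def)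
  then have "0 \<le> f'" using cap_step_ge_minus_one[of D' w v e'] f(2) by simp
  moreover from this have "f' + c \<le> f" using slack v(2) f unfolding cap_step_def by linarith
  ultimately show ?thesis
    using won y f cap_step_le[OF D_nonneg, of w v e] cap_step_le[OF D'_nonneg, of w v e']
    by (simp add: safe_def)
qed

lemma safe_ex_succ:
  assumes "z \<in> safe"
  shows "\<exists>z'. (z, z') \<in> shadow_edges"
proof -
  obtain v e e' where z: "z = ((v, e), e')" by (metis surj_pair)
  then have v: "v \<in> Domain E" "0 \<le> e" "e \<le> D" and e': "v \<in> X" "0 \<le> e'" "e' \<le> D'"
    using assms X_subset slack(1) by (auto simp: safe_def)
  obtain y where "((v, e), (y, cap_step D w v e)) \<in> t_edges" "v \<in> P \<Longrightarrow> y = fst (s (v, e'))"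
  proof (cases "v \<in> P")
    case True
    then show ?thesis using that own_t_edge[OF v(2,3) True] s_move(1)[OF True e'] by blast
  next
    case False
    then show ?thesis using that t_edges_ex_succ[OF v] by metis
  qed
  then show ?thesis by (auto simp: shadow_edges_def z)
qed

lemma not_lost_if_safe_path:
  assumes u: "infpath shadow_edges u" "range u \<subseteq> safe"
  shows "\<not> lost (fst (u 0))"
proof
  assume lost: "lost (fst (u 0))"
  have safe: "u n \<in> safe" for n using u(2) by blast
  have path: "infpath t_edges (fst \<circ> u)"
    using u(1) by (auto simp: infpath_def shadow_edges_def split_beta)
  let ?z = "\<lambda>n. (fst (fst (u n)), snd (u n))"
  have "(?z n, ?z (Suc n)) \<in> s_edges" for n
    using shadow_step(1)[of "fst (fst (u n))" "snd (fst (u n))" "snd (u n)"]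
      safe[of n] safe[of "Suc n"] infpathD[OF u(1), of n]
    by (cases "u n"; cases "u (Suc n)") (auto simp: safe_def)
  then have z_path: "infpath s_edges ?z" by (simp add: infpath_def)
  have "won (?z 0)" using safe[of 0] by (auto simp: safe_def)
  from avoidsD[OF this z_path refl] have "parity True (cap_prio pr) ?z"
    by (simp add: parity_False_iff)
  moreover have "cap_prio pr (?z n) = cap_prio pr ((fst \<circ> u) n)" for n
    using safe[of n] slack(1) by (cases "u n") (auto simp: cap_prio_def safe_def)
  then have "parity True (cap_prio pr) ?z \<longleftrightarrow> parity True (cap_prio pr) (fst \<circ> u)"
    by (rule parity_cong)
  ultimately show False using avoidsD[OF lost path] by simp
qed

lemma escape_from_safe:
  assumes z0: "z0 \<in> safe" and lost: "lost (fst z0)"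
  obtains a y f where "a \<in> X - P" "(a, y) \<in> E" "y \<notin> X" "c - W \<le> f" "f \<le> D"
    "(fst z0, (y, f)) \<in> t_edges\<^sup>*"
proof (rule ex_infpath_or_exit[OF z0 safe_ex_succ])
  fix u assume "infpath shadow_edges u" "u 0 = z0" "range u \<subseteq> safe"
  then show thesis using not_lost_if_safe_path lost by metis
next
  fix z z' assume exits: "(z0, z) \<in> shadow_edges\<^sup>*" "z \<in> safe" "(z, z') \<in> shadow_edges" "z' \<notin> safe"
  obtain v e e' y f f' where z: "z = ((v, e), e')" "z' = ((y, f), f')" by (metis surj_pair)
  have y: "y \<notin> X" using safe_step exits z by blast
  have v: "v \<in> X - P" "0 \<le> e" "c \<le> e"
    using shadow_step(2)[OF _ _ y] exits z slack(1) by (auto simp: safe_def)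
  have shadow_t_edges: "(fst z, fst z') \<in> t_edges" if "(z, z') \<in> shadow_edges" for z z'
    using that by (auto simp: shadow_edges_def)
  then have edge: "((v, e), (y, f)) \<in> t_edges" using exits(3) z by fastforce
  have "(fst z0, fst z) \<in> t_edges\<^sup>*"
    using exits(1)
    by (induction rule: rtrancl_induct) (use shadow_t_edges in \<open>blast intro: rtrancl_into_rtrancl\<close>)+
  then have reach: "(fst z0, (y, f)) \<in> t_edges\<^sup>*" using z edge by (auto intro: rtrancl_into_rtrancl)
  have "c - W \<le> f" "f \<le> D"
    using cap_step_ge[of v "c - W" e] v X_subset slack(2) D'_nonneg W_pos t_edgesD(2)[OF edge v(2)]
      cap_step_le[OF D_nonneg] by auto
  then show thesis by (rule that[OF v(1) t_edgesD(1)[OF edge v(2)] y _ _ reach])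
qed

end

context capped_game
begin

lemma escape_run:
  assumes X: "Domain (Restr E X) = X" "arena (Restr E X)"
    and D': "0 \<le> D'" "cap_suffices (Restr E X) P w pr D'"
    and c: "0 \<le> c" "c \<le> D - D'" and v: "v \<in> X" and e: "D' + c \<le> e" "e \<le> D" and lost: "lost (v, e)"
  obtains a y f where "a \<in> X - P" "(a, y) \<in> E" "y \<notin> X" "c - W \<le> f" "f \<le> D"
    "((v, e), (y, f)) \<in> t_edges\<^sup>*"
proof -
  obtain s where s: "positional (cap_edges (Restr E X) D' w) (cap_player P) s"
    and win: "\<And>v. v \<in> Domain (Restr E X) \<Longrightarrow> cap_wins (Restr E X) P w pr D' s (v, D')"
    using cap_suffices_strategy[OF X(2) D'] by blast
  interpret shadowed_game E P w pr D W t X D' c s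
    by unfold_locales (use X(1) D'(1) c s in auto)
  have "((v, e), D') \<in> safe" using v win X(1) D'(1) e by (simp add: safe_def s_edges_def)
  then show ?thesis using escape_from_safe[of "((v, e), D')"] lost that by auto
qed

lemma target_run:
  assumes T: "T \<subseteq> Domain E" and X: "X = Domain E - attr E P T"
    and D': "0 \<le> D'" "cap_suffices (Restr E X) P w pr D'" and c: "0 \<le> c"
    and bound: "D' + W + int (card (attr E P T - T)) * W + c \<le> D"
    and v: "v \<in> Domain E" and lost: "lost (v, D)"
  shows "\<exists>z f. z \<in> T \<and> c \<le> f \<and> f \<le> D \<and> ((v, D), (z, f)) \<in> t_edges\<^sup>*"
proof -
  have fin: "finite (attr E P T)"
    using attr_subset_Domain[OF T] arena_finite_Domain[OF arena] by (rule finite_subset)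
  have attr: "\<exists>z f. z \<in> T \<and> c \<le> f \<and> f \<le> D \<and> ((y, e), (z, f)) \<in> t_edges\<^sup>*"
    if "y \<in> attr E P T" "D - D' - W \<le> e" "e \<le> D" for y e
  proof (intro attr_run[OF T c that(1) _ that(3)])
    have "int (attr_rank E P T y) * W \<le> int (card (attr E P T - T)) * W"
      using attr_rank_le_card[OF fin that(1)] W_pos by (intro mult_right_mono) auto
    then show "int (attr_rank E P T y) * W + c \<le> e" using bound that(2) by linarith
  qed
  show ?thesis
  proof (cases "v \<in> attr E P T")
    case True
    then show ?thesis using D'(1) W_pos by (intro attr) auto
  next
    case False
    have trap: "trap E P X" unfolding X by (rule trap_compl_attr[OF arena T])
    have "0 \<le> int (card (attr E P T - T)) * W" using W_pos by simp
    then have slack: "0 \<le> D - D'" using bound c W_pos by linarith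
    have "v \<in> X" using v False X by blast
    then obtain a y f where "a \<in> X - P" and y: "(a, y) \<in> E" "y \<notin> X" and f: "D - D' - W \<le> f" "f \<le> D"
      and reach: "((v, D), (y, f)) \<in> t_edges\<^sup>*"
      by (rule escape_run[OF Domain_Restr_trap[OF trap] arena_Restr_trap[OF arena trap] D'
            slack order_refl _ _ order_refl lost]) auto
    have "y \<in> attr E P T" using y arena_succ_in_Domain[OF arena] X by blast
    then obtain z f' where "z \<in> T" "c \<le> f'" "f' \<le> D" "((y, f), (z, f')) \<in> t_edges\<^sup>*"
      using attr f by blast
    then show ?thesis using rtrancl_trans[OF reach] by blast
  qed
qed

lemma not_lost_if_recurrent:
  assumes p: "even p" "\<And>v. v \<in> Domain E \<Longrightarrow> p \<le> pr v" and T: "T = {v \<in> Domain E. pr v = p}"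
    and B: "0 \<le> B" and c0: "c0 \<in> T \<times> {B..D}"
    and return: "\<And>c. c \<in> T \<times> {B..D} \<Longrightarrow> lost c \<Longrightarrow> \<exists>d \<in> T \<times> {B..D}. (c, d) \<in> t_edges\<^sup>+"
  shows "\<not> lost c0"
proof
  assume "lost c0"
  define Z where "Z = {c \<in> T \<times> {B..D}. lost c}"
  have "finite Z" using arena_finite_Domain[OF arena] by (simp add: Z_def T)
  moreover have "Z \<noteq> {}" using c0 \<open>lost c0\<close> unfolding Z_def by blast
  moreover have "\<exists>d \<in> Z. (c, d) \<in> t_edges\<^sup>+" if c: "c \<in> Z" for c
  proof -
    obtain d where d: "d \<in> T \<times> {B..D}" "(c, d) \<in> t_edges\<^sup>+"
      using return c unfolding Z_def by blast
    then have "lost d" using c lost_rtrancl trancl_into_rtrancl[OF d(2)] unfolding Z_def by blast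
    then show ?thesis using d unfolding Z_def by blast
  qed
  ultimately obtain z where z: "z \<in> Z" "(z, z) \<in> t_edges\<^sup>+" by (rule finite_trancl_cycle)
  obtain u where u: "infpath t_edges u" "u 0 = z" "z \<in> limit u" using infpath_of_cycle[OF z(2)] .
  have nonneg: "0 \<le> snd (u n)" for n
  proof (rule ccontr)
    assume "\<not> 0 \<le> snd (u n)"
    moreover obtain m where "n \<le> m" "u m = z"
      using u(3) by (auto simp: limit_iff_frequent INFM_nat_le)
    ultimately show False
      using cap_edges_exhausted[OF infpath_mono[OF u(1) t_edges_subset], of n m] z(1) B
      by (auto simp: Z_def)
  qed
  have "fst (u n) \<in> Domain E" for n
    using infpath_in_Domain[OF u(1), of n] arena_t_edges(1) by (simp add: mem_Times_iff)
  then have "p \<le> cap_prio pr (u n)" for n using nonneg[of n] p(2) by (simp add: cap_prio_def)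
  moreover have "\<exists>\<^sub>\<infinity>n. u n = z" using u(3) by (simp add: limit_iff_frequent)
  then have "\<exists>\<^sub>\<infinity>n. cap_prio pr (u n) = p"
    by (rule INFM_mono) (use z(1) B in \<open>auto simp: cap_prio_def Z_def T\<close>)
  ultimately have "parity (even p) (cap_prio pr) u"
    using finite_range_infpath[OF arena_t_edges(2) u(1)] by (intro parity_of_frequent_minimum)
  then show False using avoidsD[of t_edges _ z u] z(1) u p(1) by (auto simp: Z_def)
qed

text \<open>From full energy the player can afford to visit the even least priority, and then regains
  full energy.\<close>

lemma not_lost_if_even_min:
  assumes win: "avoid_region E (- P) (energy_parity True w pr) = {}" and v: "v \<in> Domain E"
    and p: "even p" "\<And>v. v \<in> Domain E \<Longrightarrow> p \<le> pr v" and T: "T = {v \<in> Domain E. pr v = p}"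
    and X: "X = Domain E - attr E P T"
    and D': "0 \<le> D'" "cap_suffices (Restr E X) P w pr D'"
    and bound: "D' + W + int (card (attr E P T - T)) * W + int (Suc (card (Domain E))) * W \<le> D"
  shows "\<not> lost (v, D)"
proof
  define B where "B = int (Suc (card (Domain E))) * W"
  have B: "0 \<le> B" "int (card (Domain E)) * W + W = B"
    using W_pos by (simp_all add: B_def algebra_simps)
  have to_target: "\<exists>d \<in> T \<times> {B..D}. ((q, D), d) \<in> t_edges\<^sup>*" if "q \<in> Domain E" "lost (q, D)" for q
    using target_run[OF _ X D' B(1) bound[folded B_def] that] by (force simp: T)
  obtain s where s: "positional E P s" "good_for_energy (conform E P s) w pr"
    using ex_good_for_energy_strategy[OF arena win] .
  have return: "\<exists>d \<in> T \<times> {B..D}. (c, d) \<in> t_edges\<^sup>+" if c: "c \<in> T \<times> {B..D}" "lost c" for c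
  proof -
    obtain z f where zf: "c = (z, f)" "z \<in> T" "B \<le> f" "f \<le> D" using c(1) by auto
    then have z: "z \<in> Domain E" by (simp add: T)
    obtain y where y: "(z, y) \<in> E" "(c, (y, cap_step D w z f)) \<in> t_edges"
      using t_edges_ex_succ[OF z _ zf(4)] zf(1,3) B(1) by force
    have low: "int (card (Domain E)) * W \<le> cap_step D w z f"
      using zf z B W_pos by (intro cap_step_ge) auto
    have "lost (y, cap_step D w z f)" by (rule lost_rtrancl[OF c(2) r_into_rtrancl[OF y(2)]])
    then obtain q where q: "((y, cap_step D w z f), (q, D)) \<in> t_edges\<^sup>*"
      using recharge_run[OF s arena_succ_in_Domain[OF arena y(1)] low cap_step_le[OF D_nonneg]]
      by blast
    have cq: "(c, (q, D)) \<in> t_edges\<^sup>+" using y(2) q by (rule rtrancl_into_trancl2)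
    then have "lost (q, D)" using lost_rtrancl[OF c(2)] by (meson trancl_into_rtrancl)
    moreover have "q \<in> Domain E"
      using rtrancl_t_edges_in_Domain[OF trancl_into_rtrancl[OF cq]] zf z B(1) by simp
    ultimately show ?thesis using to_target cq by (meson trancl_rtrancl_trancl)
  qed
  assume "lost (v, D)"
  then obtain d where d: "d \<in> T \<times> {B..D}" "((v, D), d) \<in> t_edges\<^sup>*" using to_target v by blast
  have "\<not> lost d" using p T B(1) d(1) return by (rule not_lost_if_recurrent)
  then show False using lost_rtrancl[OF \<open>lost (v, D)\<close> d(2)] by blast
qed

text \<open>The player forces the play into \<open>T\<close>, which the opponent cannot leave and where she wins.\<close>

lemma not_lost_if_trap_suffices:
  assumes v: "v \<in> Domain E" and T: "trap E (- P) T"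
    and X: "X = Domain E - attr E P T"
    and D': "0 \<le> D'" "cap_suffices (Restr E X) P w pr D'"
    and D1: "0 \<le> D1" "cap_suffices (Restr E T) P w pr D1"
    and bound: "D' + W + int (card (attr E P T - T)) * W + D1 \<le> D"
  shows "\<not> lost (v, D)"
proof
  assume "lost (v, D)"
  then obtain z f where z: "z \<in> T" "D1 \<le> f" "f \<le> D" "((v, D), (z, f)) \<in> t_edges\<^sup>*"
    using target_run[OF trap_subset[OF T] X D' D1(1) bound v] by blast
  have slack: "0 \<le> D - D1" using z by linarith
  obtain a y f' where "a \<in> T - P" "(a, y) \<in> E" "y \<notin> T"
    by (rule escape_run[OF Domain_Restr_trap[OF T] arena_Restr_trap[OF arena T] D1 order_refl slack
          z(1) _ z(3) lost_rtrancl[OF \<open>lost (v, D)\<close> z(4)]]) (use z(2) in auto)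
  then show False using trap_closed[OF T] by blast
qed

end

subsection \<open>The bound on the energy cap\<close>

definition cap_bound :: "int \<Rightarrow> ('v \<Rightarrow> nat) \<Rightarrow> 'v set \<Rightarrow> int" where
  "cap_bound W pr V = 3 * int (card (pr ` V) * card V) * W"

lemma cap_bound_nonneg: "0 \<le> W \<Longrightarrow> 0 \<le> cap_bound W pr V"
  by (simp add: cap_bound_def)

lemma cap_bound_mono:
  assumes "finite V" "U \<subseteq> V" "0 \<le> W"
  shows "cap_bound W pr U \<le> cap_bound W pr V"
proof -
  have "card (pr ` U) * card U \<le> card (pr ` V) * card V"
    using assms(1,2) by (intro mult_mono card_mono image_mono) auto
  then have "int (card (pr ` U) * card U) \<le> int (card (pr ` V) * card V)"
    by (simp only: of_nat_le_iff)
  then show ?thesis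
    unfolding cap_bound_def using assms(3) by (intro mult_right_mono mult_left_mono) auto
qed

lemma Suc_card_image_le:
  assumes "finite V" "U \<subseteq> V" "p \<in> pr ` V" "p \<notin> pr ` U"
  shows "Suc (card (pr ` U)) \<le> card (pr ` V)"
proof -
  have "pr ` U \<subset> pr ` V" using assms(2-4) by blast
  with finite_imageI[OF assms(1)] have "card (pr ` U) < card (pr ` V)" by (rule psubset_card_mono)
  then show ?thesis by simp
qed

lemma card_target_attr_compl:
  assumes "finite V" "T \<subseteq> A" "A \<subseteq> V"
  shows "card V = card T + card (A - T) + card (V - A)"
proof -
  have A: "finite A" using assms(3,1) by (rule finite_subset)
  with assms(2) have "finite T" by (rule finite_subset)
  then show ?thesis using A assms by (simp add: card_Diff_subset card_mono)
qed

lemma cap_bound_even: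
  assumes V: "finite V" "T \<subseteq> A" "A \<subseteq> V" "T \<noteq> {}"
    and p: "p \<in> pr ` V" "p \<notin> pr ` (V - A)" and W: "0 \<le> W"
  shows "cap_bound W pr (V - A) + W + int (card (A - T)) * W + int (Suc (card V)) * W
    \<le> cap_bound W pr V"
proof -
  let ?d = "card (pr ` V)" and ?d' = "card (pr ` (V - A))" and ?x = "card (V - A)"
  have d: "Suc ?d' \<le> ?d" using Suc_card_image_le[OF V(1) _ p] by blast
  have "1 \<le> card T" using V finite_subset[of T V] by (simp add: Suc_le_eq card_gt_0_iff)
  moreover have n: "card V = card T + card (A - T) + ?x" by (rule card_target_attr_compl[OF V(1-3)])
  moreover have "?d * card V = ?d * card T + ?d * card (A - T) + ?d * ?x"
    unfolding n by (simp only: distrib_left)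
  moreover have "Suc ?d' * ?x \<le> ?d * ?x" using d by (rule mult_le_mono1)
  moreover have "1 * (card T + card (A - T)) \<le> ?d * (card T + card (A - T))"
    using d by (intro mult_le_mono1) simp
  ultimately have "3 * (?d' * ?x) + (1 + card (A - T) + Suc (card V)) \<le> 3 * (?d * card V)"
    unfolding mult_Suc mult_1 distrib_left by linarith
  then have "int (3 * (?d' * ?x) + (1 + card (A - T) + Suc (card V))) * W
      \<le> int (3 * (?d * card V)) * W"
    using W by (intro mult_right_mono) (simp only: of_nat_le_iff)
  then show ?thesis by (simp add: cap_bound_def algebra_simps)
qed

lemma cap_bound_odd:
  assumes V: "finite V" "T \<subseteq> A" "A \<subseteq> V" "T \<noteq> {}"
    and p: "p \<in> pr ` V" "p \<notin> pr ` T" and W: "0 \<le> W"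
  shows "cap_bound W pr (V - A) + W + int (card (A - T)) * W + cap_bound W pr T \<le> cap_bound W pr V"
proof -
  let ?d = "card (pr ` V)" and ?d' = "card (pr ` T)"
  let ?d'' = "card (pr ` (V - A))" and ?x = "card (V - A)"
  have d: "Suc ?d' \<le> ?d" using Suc_card_image_le[OF V(1) _ p] V by blast
  have "1 \<le> card T" using V finite_subset[of T V] by (simp add: Suc_le_eq card_gt_0_iff)
  moreover have n: "card V = card T + card (A - T) + ?x" by (rule card_target_attr_compl[OF V(1-3)])
  moreover have "?d * card V = ?d * card T + ?d * card (A - T) + ?d * ?x"
    unfolding n by (simp only: distrib_left)
  moreover have "Suc ?d' * card T \<le> ?d * card T" using d by (rule mult_le_mono1)
  moreover have "1 * card (A - T) \<le> ?d * card (A - T)" using d by (intro mult_le_mono1) simp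
  moreover have "?d'' * ?x \<le> ?d * ?x" using V(1) by (intro mult_le_mono1 card_mono) auto
  ultimately have "3 * (?d'' * ?x) + 3 * (?d' * card T) + (1 + card (A - T)) \<le> 3 * (?d * card V)"
    unfolding mult_Suc mult_1 distrib_left by linarith
  then have "int (3 * (?d'' * ?x) + 3 * (?d' * card T) + (1 + card (A - T))) * W
      \<le> int (3 * (?d * card V)) * W"
    using W by (intro mult_right_mono) (simp only: of_nat_le_iff)
  then show ?thesis by (simp add: cap_bound_def algebra_simps)
qed

lemma cap_sufficesI:
  assumes "\<And>v t. v \<in> Domain E \<Longrightarrow> positional (cap_edges E D w) (- cap_player P) t \<Longrightarrow>
    \<not> avoids (conform (cap_edges E D w) (- cap_player P) t) (parity True (cap_prio pr)) (v, D)"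
  shows "cap_suffices E P w pr D"
  using assms unfolding cap_suffices_def by (blast elim: avoid_regionE)

context
  fixes E :: "('v \<times> 'v) set" and P w pr and W :: int
  assumes E: "arena E" "Domain E \<noteq> {}" and W: "1 \<le> W" "\<And>v. v \<in> Domain E \<Longrightarrow> \<bar>w v\<bar> \<le> W"
    and win: "avoid_region E (- P) (energy_parity True w pr) = {}"
    and attr_compl: "\<And>X T. X = Domain E - attr E P T \<Longrightarrow> T \<subseteq> Domain E \<Longrightarrow> T \<noteq> {} \<Longrightarrow>
      cap_suffices (Restr E X) P w pr (cap_bound W pr X)"
begin

lemma Min_prio: "Min (pr ` Domain E) \<in> pr ` Domain E" "v \<in> Domain E \<Longrightarrow> Min (pr ` Domain E) \<le> pr v"
  using E arena_finite_Domain[OF E(1)] by (auto intro: Min_in)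

lemma capped_game_cap_bound:
  "positional (cap_edges E (cap_bound W pr (Domain E)) w) (- cap_player P) t \<Longrightarrow>
    capped_game E P w (cap_bound W pr (Domain E)) W t"
  using E W cap_bound_nonneg[of W pr "Domain E"] by unfold_locales auto

lemma cap_suffices_cap_bound_if_even_min:
  assumes even: "even (Min (pr ` Domain E))"
  shows "cap_suffices E P w pr (cap_bound W pr (Domain E))"
proof (rule cap_sufficesI)
  fix v t
  assume v: "v \<in> Domain E"
    and t: "positional (cap_edges E (cap_bound W pr (Domain E)) w) (- cap_player P) t"
  interpret capped_game E P w pr "cap_bound W pr (Domain E)" W t
    by (rule capped_game_cap_bound[OF t])
  define p where "p = Min (pr ` Domain E)"
  define T where "T = {v \<in> Domain E. pr v = p}"
  define X where "X = Domain E - attr E P T"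
  have T: "T \<subseteq> Domain E" "T \<noteq> {}" "p \<notin> pr ` X"
    using Min_prio(1) target_subset_attr[of T E P] by (auto simp: T_def p_def X_def)
  have "\<not> lost (v, cap_bound W pr (Domain E))"
  proof (rule not_lost_if_even_min[OF win v _ _ T_def X_def _ attr_compl[OF X_def T(1,2)]])
    show "cap_bound W pr X + W + int (card (attr E P T - T)) * W + int (Suc (card (Domain E))) * W
        \<le> cap_bound W pr (Domain E)"
      using cap_bound_even[OF arena_finite_Domain[OF E(1)] target_subset_attr
          attr_subset_Domain[OF T(1)] T(2)] Min_prio(1) T(3) W(1) by (simp add: p_def X_def)
  qed (use even Min_prio(2) W(1) in \<open>auto simp: p_def intro: cap_bound_nonneg\<close>)
  then show "\<not> avoids (conform (cap_edges E (cap_bound W pr (Domain E)) w) (- cap_player P) t)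
      (parity True (cap_prio pr)) (v, cap_bound W pr (Domain E))"
    by (simp add: t_edges_def)
qed

lemma cap_suffices_cap_bound_if_odd_min:
  assumes odd: "odd (Min (pr ` Domain E))"
    and trap: "\<And>T. trap E (- P) T \<Longrightarrow> T \<noteq> Domain E \<Longrightarrow>
      avoid_region (Restr E T) (- P) (energy_parity True w pr) = {} \<Longrightarrow>
      cap_suffices (Restr E T) P w pr (cap_bound W pr T)"
  shows "cap_suffices E P w pr (cap_bound W pr (Domain E))"
proof (rule cap_sufficesI)
  fix v t
  assume v: "v \<in> Domain E"
    and t: "positional (cap_edges E (cap_bound W pr (Domain E)) w) (- cap_player P) t"
  interpret capped_game E P w pr "cap_bound W pr (Domain E)" W t
    by (rule capped_game_cap_bound[OF t])
  obtain T where T: "trap E (- P) T" "T \<noteq> {}" "Min (pr ` Domain E) \<notin> pr ` T"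
    and win_T: "avoid_region (Restr E T) (- P) (energy_parity True w pr) = {}"
    using ex_trap_without_odd_min[OF E(1) tail_closed_energy_parity _ win E(2) refl odd]
    by (auto simp: energy_parity_def)
  define X where "X = Domain E - attr E P T"
  have T_E: "T \<subseteq> Domain E" "T \<noteq> Domain E" using trap_subset[OF T(1)] T(3) Min_prio(1) by auto
  have "\<not> lost (v, cap_bound W pr (Domain E))"
  proof (rule not_lost_if_trap_suffices[OF v T(1) X_def _ attr_compl[OF X_def T_E(1) T(2)]
        _ trap[OF T(1) T_E(2) win_T]])
    show "cap_bound W pr X + W + int (card (attr E P T - T)) * W + cap_bound W pr T
        \<le> cap_bound W pr (Domain E)"
      using cap_bound_odd[OF arena_finite_Domain[OF E(1)] target_subset_attr
          attr_subset_Domain[OF T_E(1)] T(2)] Min_prio(1) T(3) W(1) by (simp add: X_def)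
  qed (use W(1) in \<open>simp_all add: cap_bound_nonneg\<close>)
  then show "\<not> avoids (conform (cap_edges E (cap_bound W pr (Domain E)) w) (- cap_player P) t)
      (parity True (cap_prio pr)) (v, cap_bound W pr (Domain E))"
    by (simp add: t_edges_def)
qed

end

theorem cap_suffices_cap_bound:
  assumes "arena E" "avoid_region E (- P) (energy_parity True w pr) = {}" and W: "1 \<le> W"
    and "\<And>v. v \<in> Domain E \<Longrightarrow> \<bar>w v\<bar> \<le> W"
  shows "cap_suffices E P w pr (cap_bound W pr (Domain E))"
  using assms(1,2,4)
proof (induction "card (Domain E)" arbitrary: E rule: less_induct)
  case less
  note E = less.prems(1) and win = less.prems(2) and weight = less.prems(3)
  let ?L = "energy_parity True w pr"
  have trap: "cap_suffices (Restr E X) P w pr (cap_bound W pr X)"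
    if X: "trap E Q X" "X \<noteq> Domain E" "avoid_region (Restr E X) (- P) ?L = {}" for Q X
  proof -
    have "X \<subset> Domain E" using X(1,2) trap_subset by blast
    with arena_finite_Domain[OF E] have "card X < card (Domain E)" by (rule psubset_card_mono)
    then show ?thesis
      using less.hyps[of "Restr E X"] X(3) arena_Restr_trap[OF E X(1)] weight \<open>X \<subset> Domain E\<close>
      unfolding Domain_Restr_trap[OF X(1)] by blast
  qed
  have attr_compl: "cap_suffices (Restr E X) P w pr (cap_bound W pr X)"
    if X: "X = Domain E - attr E P T" and T: "T \<subseteq> Domain E" "T \<noteq> {}" for X T
  proof (rule trap)
    show trap_X: "trap E P X" unfolding X by (rule trap_compl_attr[OF E T(1)])
    show "X \<noteq> Domain E" using X T target_subset_attr[of T E P] by blast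
    show "avoid_region (Restr E X) (- P) ?L = {}"
      using avoid_region_Restr_trap[OF trap_X] win by blast
  qed
  consider (empty) "Domain E = {}" | (even) "Domain E \<noteq> {}" "even (Min (pr ` Domain E))"
    | (odd) "Domain E \<noteq> {}" "odd (Min (pr ` Domain E))" by blast
  then show ?case
  proof cases
    case empty
    then show ?thesis by (simp add: cap_suffices_def)
  next
    case even
    show ?thesis
      by (rule cap_suffices_cap_bound_if_even_min[OF E even(1) W weight win attr_compl even(2)])
  next
    case odd
    show ?thesis
      by (rule cap_suffices_cap_bound_if_odd_min[OF E odd(1) W weight win attr_compl odd(2) trap])
  qed
qed

section \<open>The game graph of a parity automaton\<close>

text \<open>The weight of an edge of the game graph depends on its target only, so weights are moved to
  the vertices.\<close>

fun vertex_weight :: "'p set \<Rightarrow> 'p set \<Rightarrow> ('p lit \<Rightarrow> rat) \<Rightarrow> ('q, 'p) vertex \<Rightarrow> rat" where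
  "vertex_weight Inp Out w (V1 q i) = set_weight w Inp i"
| "vertex_weight Inp Out w (V2 q x) = set_weight w Out x"

primrec vertex_state :: "('q, 'p) vertex \<Rightarrow> 'q" where
  "vertex_state (V1 q i) = q"
| "vertex_state (V2 q x) = q"

primrec vertex_letter :: "('q, 'p) vertex \<Rightarrow> 'p set" where
  "vertex_letter (V1 q i) = i"
| "vertex_letter (V2 q x) = x"

definition player_O :: "('q, 'p) vertex set" where
  "player_O = {V1 q j | q j. True}"

lemma mem_player_O [simp]: "V1 q j \<in> player_O" "V2 q x \<notin> player_O"
  by (auto simp: player_O_def)

lemma edge_weight_eq: "edge_weight Inp Out w (a, v) = vertex_weight Inp Out w v"
  by (cases v) simp_all

lemma vertex_prio_eq: "vertex_prio A v = prio A (vertex_state v)"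
  by (cases v) simp_all

lemma limit_comp:
  assumes "finite (range u)"
  shows "limit (f \<circ> u) = f ` limit u"
proof
  show "limit (f \<circ> u) \<subseteq> f ` limit u"
  proof
    fix y assume "y \<in> limit (f \<circ> u)"
    then have "\<exists>\<^sub>\<infinity>n. u n \<in> {x \<in> range u. f x = y}" by (simp add: limit_iff_frequent)
    then have "limit u \<inter> {x \<in> range u. f x = y} \<noteq> {}"
      using assms by (subst fin_ex_inf_eq_limit[symmetric]) auto
    then show "y \<in> f ` limit u" by blast
  qed
qed auto

lemma limit_div2: "limit (\<lambda>n. u (n div 2)) = limit u"
proof -
  have "(\<exists>\<^sub>\<infinity>n. u (n div 2) = a) \<longleftrightarrow> (\<exists>\<^sub>\<infinity>n. u n = a)" for a
    unfolding INFM_nat_le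
  proof (intro iffI allI)
    fix m assume "\<forall>m. \<exists>n\<ge>m. u (n div 2) = a"
    then obtain n where "2 * m \<le> n" "u (n div 2) = a" by blast
    then show "\<exists>n\<ge>m. u n = a" by (intro exI[of _ "n div 2"]) auto
  next
    fix m assume "\<forall>m. \<exists>n\<ge>m. u n = a"
    then obtain n where "m \<le> n" "u n = a" by blast
    then show "\<exists>n\<ge>m. u (n div 2) = a" by (intro exI[of _ "2 * n"]) auto
  qed
  then show ?thesis by (auto simp: limit_def)
qed

lemma even_odd_cases:
  fixes n :: nat
  obtains (even) m where "n = 2 * m" | (odd) m where "n = Suc (2 * m)"
  by (metis evenE oddE Suc_eq_plus1)

locale ltl_game =
  fixes Inp Out :: "'p set" and \<phi> :: "'p ltl" and A :: "('q, 'p) automaton" and j\<^sub>0 :: "'p set"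
  assumes finite_letters: "finite Inp" "finite Out" and disjoint: "Inp \<inter> Out = {}"
    and automaton: "parity_automaton (Inp \<union> Out) A"
    and language: "automaton_language (Inp \<union> Out) A = ltl_language (Inp \<union> Out) \<phi>"
    and j0: "j\<^sub>0 \<in> Pow Inp"
begin

abbreviation S :: "('q, 'p) vertex set" where "S \<equiv> game_states Inp Out A j\<^sub>0"
abbreviation G :: "(('q, 'p) vertex \<times> ('q, 'p) vertex) set" where "G \<equiv> game_edges Inp Out A j\<^sub>0"
abbreviation v\<^sub>0 :: "('q, 'p) vertex" where "v\<^sub>0 \<equiv> V1 (init A) j\<^sub>0"

lemma delta_in_states: "q \<in> states A \<Longrightarrow> \<sigma> \<subseteq> Inp \<union> Out \<Longrightarrow> delta A q \<sigma> \<in> states A"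
  using automaton by (auto simp: parity_automaton_def)

lemma v0_in_S: "v\<^sub>0 \<in> S"
  by (simp add: game_states_def)

lemma edge_in_G: "a \<in> S \<Longrightarrow> (a, b) \<in> all_edges Inp Out A \<Longrightarrow> (a, b) \<in> G"
  by (auto simp: game_states_def game_edges_def intro: rtrancl_into_rtrancl)

lemma G_in_S: "(a, b) \<in> G \<Longrightarrow> a \<in> S \<and> b \<in> S"
  by (simp add: game_edges_def)

lemma S_subset:
  "S \<subseteq> case_prod V1 ` (states A \<times> Pow Inp) \<union> case_prod V2 ` (states A \<times> Pow Out)"
proof
  fix v assume "v \<in> S"
  then have "(v\<^sub>0, v) \<in> (all_edges Inp Out A)\<^sup>*" by (simp add: game_states_def)
  then show "v \<in> case_prod V1 ` (states A \<times> Pow Inp) \<union> case_prod V2 ` (states A \<times> Pow Out)"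
  proof (cases rule: rtranclE)
    case base
    then show ?thesis using automaton j0 by (auto simp: parity_automaton_def)
  next
    case (step y)
    then show ?thesis by (auto simp: all_edges_def image_iff intro!: delta_in_states)
  qed
qed

lemma finite_S: "finite S"
  by (rule finite_subset[OF S_subset])
    (use finite_letters automaton in \<open>simp add: parity_automaton_def\<close>)

lemma G_V1 [simp]: "(V1 q j, V2 q' x) \<in> G \<longleftrightarrow> V1 q j \<in> S \<and> q' = q \<and> x \<in> Pow Out"
proof
  assume V: "V1 q j \<in> S \<and> q' = q \<and> x \<in> Pow Out"
  then have "q \<in> states A \<and> j \<in> Pow Inp" using S_subset by auto
  then show "(V1 q j, V2 q' x) \<in> G" using V edge_in_G by (auto simp: all_edges_def)
qed (auto simp: game_edges_def all_edges_def)

lemma G_V2 [simp]: "(V2 q x, V1 q' i) \<in> G \<longleftrightarrow> V2 q x \<in> S \<and> i \<in> Pow Inp \<and> q' = delta A q (x \<union> i)"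
proof
  assume V: "V2 q x \<in> S \<and> i \<in> Pow Inp \<and> q' = delta A q (x \<union> i)"
  then have "q \<in> states A \<and> x \<in> Pow Out" using S_subset by auto
  then show "(V2 q x, V1 q' i) \<in> G" using V edge_in_G by (auto simp: all_edges_def)
qed (auto simp: game_edges_def all_edges_def)

lemma G_alternates [simp]: "(V1 q j, V1 q' i) \<notin> G" "(V2 q x, V2 q' y) \<notin> G"
  by (auto simp: game_edges_def all_edges_def)

lemma Domain_G: "Domain G = S"
proof
  show "S \<subseteq> Domain G"
  proof
    fix v assume v: "v \<in> S"
    show "v \<in> Domain G"
    proof (cases v)
      case (V1 q j)
      then have "(v, V2 q {}) \<in> G" using v by simp
      then show ?thesis by blast
    next
      case (V2 q x)
      then have "(v, V1 (delta A q (x \<union> {})) {}) \<in> G" using v by (simp del: Un_empty_right)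
      then show ?thesis by blast
    qed
  qed
qed (use G_in_S in blast)

lemma arena_G: "arena G"
proof -
  have "G \<subseteq> S \<times> S" using G_in_S by auto
  then have "finite G" using finite_S by (meson finite_SigmaI finite_subset)
  then show ?thesis using G_in_S by (auto simp: arena_def Domain_G)
qed

lemma ex_edge_of_vertex_weight:
  assumes "v \<in> S"
  obtains e where "e \<in> G" "edge_weight Inp Out w e = vertex_weight Inp Out w v"
proof -
  have "(v\<^sub>0, v) \<in> (all_edges Inp Out A)\<^sup>*" using assms by (simp add: game_states_def)
  then show ?thesis
  proof (cases rule: rtranclE)
    case base
    have "V2 (init A) {} \<in> S" using v0_in_S G_in_S[of v\<^sub>0 "V2 (init A) {}"] by simp
    then have "(V2 (init A) {}, V1 (delta A (init A) ({} \<union> j\<^sub>0)) j\<^sub>0) \<in> G"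
      using j0 by (simp del: Un_empty_left)
    then show ?thesis by (rule that) (simp flip: base)
  next
    case (step y)
    then have "(y, v) \<in> G" using edge_in_G by (simp add: game_states_def)
    then show ?thesis by (rule that) (rule edge_weight_eq)
  qed
qed

subsection \<open>Plays\<close>

definition hist_vertex :: "'p round list \<Rightarrow> ('q, 'p) vertex" where
  "hist_vertex h = foldl (\<lambda>v (x, i). V1 (delta A (vertex_state v) (x \<union> i)) i) v\<^sub>0 h"

definition play_path ::
  "('p round list \<Rightarrow> 'p set) \<Rightarrow> ('p round list \<Rightarrow> 'p set \<Rightarrow> 'p set) \<Rightarrow> ('q, 'p) vertex word" where
  "play_path sO sI n = (let h = play_prefix sO sI (n div 2) in
     if even n then hist_vertex h else V2 (vertex_state (hist_vertex h)) (sO h))"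

lemma hist_vertex_Nil [simp]: "hist_vertex [] = v\<^sub>0"
  by (simp add: hist_vertex_def)

lemma hist_vertex_snoc [simp]:
  "hist_vertex (h @ [(x, i)]) = V1 (delta A (vertex_state (hist_vertex h)) (x \<union> i)) i"
  by (simp add: hist_vertex_def)

lemma hist_vertex_eq_V1:
  "hist_vertex h = V1 (vertex_state (hist_vertex h)) (vertex_letter (hist_vertex h))"
  by (induction h rule: rev_induct) auto

lemma play_path_0 [simp]: "play_path sO sI 0 = v\<^sub>0"
  by (simp add: play_path_def)

lemma play_path_even: "play_path sO sI (2 * n) = hist_vertex (play_prefix sO sI n)"
  by (simp add: play_path_def Let_def)

lemma play_path_odd: "play_path sO sI (Suc (2 * n)) =
    V2 (vertex_state (hist_vertex (play_prefix sO sI n))) (sO (play_prefix sO sI n))"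
  by (simp add: play_path_def Let_def)

lemma round_in_G:
  assumes "hist_vertex h \<in> S" "x \<in> Pow Out" "i \<in> Pow Inp"
  shows "(hist_vertex h, V2 (vertex_state (hist_vertex h)) x) \<in> G"
    "(V2 (vertex_state (hist_vertex h)) x, hist_vertex (h @ [(x, i)])) \<in> G"
proof -
  show "(hist_vertex h, V2 (vertex_state (hist_vertex h)) x) \<in> G"
    using assms(1,2) hist_vertex_eq_V1[of h] G_V1 by metis
  then show "(V2 (vertex_state (hist_vertex h)) x, hist_vertex (h @ [(x, i)])) \<in> G"
    using G_in_S assms(3) by simp
qed

lemma hist_vertex_in_S: "h \<in> histories Inp Out \<Longrightarrow> hist_vertex h \<in> S"
proof (induction h rule: rev_induct)
  case (snoc r h)
  then obtain x i where "hist_vertex h \<in> S" "x \<in> Pow Out" "i \<in> Pow Inp" and r: "r = (x, i)"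
    by (auto simp: histories_def)
  then have "(V2 (vertex_state (hist_vertex h)) x, hist_vertex (h @ [r])) \<in> G"
    unfolding r by (intro round_in_G(2))
  then show ?case using G_in_S by blast
qed (simp add: v0_in_S)

context
  fixes sO sI
  assumes sO: "sO \<in> strategies_O Inp Out" and sI: "sI \<in> strategies_I Inp Out"
begin

lemma play_prefix_in_histories: "play_prefix sO sI n \<in> histories Inp Out"
proof (induction n)
  case (Suc n)
  then show ?case
    using sO sI by (auto simp: histories_def strategies_O_def strategies_I_def Let_def Pi_iff)
qed (simp add: histories_def)

lemma move_O_in_Pow: "sO (play_prefix sO sI n) \<in> Pow Out"
  using sO play_prefix_in_histories unfolding strategies_O_def by (rule funcset_mem)

lemma move_I_in_Pow: "sI (play_prefix sO sI n) (sO (play_prefix sO sI n)) \<in> Pow Inp"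
  using sI play_prefix_in_histories move_O_in_Pow unfolding strategies_I_def by (simp add: Pi_iff)

lemma outcome_in_words: "outcome sO sI \<in> words (Inp \<union> Out)"
  using move_O_in_Pow move_I_in_Pow by (auto simp: words_def outcome_def Let_def)

lemma vertex_state_play_prefix:
  "vertex_state (hist_vertex (play_prefix sO sI n)) = run A (outcome sO sI) n"
  by (induction n) (simp_all add: outcome_def Let_def)

lemma infpath_play_path: "infpath G (play_path sO sI)"
  unfolding infpath_def
proof
  fix n
  show "(play_path sO sI n, play_path sO sI (Suc n)) \<in> G"
  proof (cases n rule: even_odd_cases)
    case (even m)
    then show ?thesis
      using round_in_G(1)[OF hist_vertex_in_S[OF play_prefix_in_histories]
          move_O_in_Pow[of m] move_I_in_Pow[of m]]
      by (simp only: play_path_even play_path_odd)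
  next
    case (odd m)
    have "play_path sO sI (Suc n) = play_path sO sI (2 * Suc m)" by (simp add: odd)
    then show ?thesis
      using round_in_G(2)[OF hist_vertex_in_S[OF play_prefix_in_histories]
          move_O_in_Pow[of m] move_I_in_Pow[of m]]
      by (simp only: odd play_path_even play_path_odd play_prefix.simps Let_def)
  qed
qed

lemma play_path_in_S: "play_path sO sI n \<in> S"
  using G_in_S infpathD[OF infpath_play_path] by blast

lemma finite_range_run: "finite (range (run A (outcome sO sI)))"
proof (rule finite_subset)
  have "run A (outcome sO sI) n \<in> states A" for n
  proof (induction n)
    case (Suc n)
    then show ?case using outcome_in_words by (auto simp: words_def intro!: delta_in_states)
  qed (use automaton in \<open>simp add: parity_automaton_def\<close>)
  then show "range (run A (outcome sO sI)) \<subseteq> states A" by blast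
qed (use automaton in \<open>simp add: parity_automaton_def\<close>)

lemma sat_iff_parity_play_path: "outcome sO sI \<Turnstile> \<phi> \<longleftrightarrow> parity True (vertex_prio A) (play_path sO sI)"
proof -
  let ?u = "outcome sO sI"
  have "?u \<Turnstile> \<phi> \<longleftrightarrow> accepts A ?u"
    using language outcome_in_words unfolding automaton_language_def ltl_language_def by blast
  also have "\<dots> \<longleftrightarrow> even (Min (limit (prio A \<circ> run A ?u)))"
    unfolding limit_comp[OF finite_range_run] by (simp add: accepts_def limit_def)
  also have "\<dots> \<longleftrightarrow> even (Min (limit (\<lambda>n. (prio A \<circ> run A ?u) (n div 2))))" by (simp only: limit_div2)
  also have "(\<lambda>n. (prio A \<circ> run A ?u) (n div 2)) = vertex_prio A \<circ> play_path sO sI"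
    by (auto simp: vertex_prio_eq play_path_def Let_def vertex_state_play_prefix)
  finally show ?thesis by (simp only: parity_def simp_thms)
qed

lemma letter_weight_outcome:
  "letter_weight Inp Out w (outcome sO sI n) =
     vertex_weight Inp Out w (play_path sO sI (Suc (2 * n))) +
     vertex_weight Inp Out w (play_path sO sI (2 * Suc n))"
proof -
  define x i where "x = sO (play_prefix sO sI n)" and "i = sI (play_prefix sO sI n) x"
  have "x \<subseteq> Out" "i \<subseteq> Inp" using move_O_in_Pow[of n] move_I_in_Pow[of n] by (auto simp: x_def i_def)
  then have "(x \<union> i) \<inter> Out = x" "(x \<union> i) \<inter> Inp = i" using disjoint by auto
  then show ?thesis
    unfolding play_path_even play_path_odd
    by (simp add: outcome_def Let_def letter_weight_def x_def i_def)
qed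

end

end

section \<open>Mean payoffs of eventually periodic words\<close>

definition eventually_periodic :: "'v word \<Rightarrow> bool" where
  "eventually_periodic u \<longleftrightarrow> (\<exists>m c. 0 < c \<and> (\<forall>n \<ge> m. u (n + c) = u n))"

lemma eventually_periodic_if_deterministic:
  assumes "finite (range z)" and step: "\<And>m n. z m = z n \<Longrightarrow> z (Suc m) = z (Suc n)"
  shows "eventually_periodic z"
proof -
  have "\<not> inj z" using assms(1) finite_imageD infinite_UNIV_nat by blast
  then obtain m m' where m: "m < m'" "z m = z m'" by (metis injI linorder_neqE_nat)
  have "z (n + (m' - m)) = z n" if "m \<le> n" for n
    using that
  proof (induction n rule: dec_induct)
    case base
    then show ?case using m by simp
  next
    case (step n)
    then show ?case using assms(2)[of "n + (m' - m)" n] by simp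
  qed
  then show ?thesis using m(1) unfolding eventually_periodic_def by (metis zero_less_diff)
qed

lemma eventually_periodic_mono:
  "eventually_periodic z \<Longrightarrow> (\<And>m n. z m = z n \<Longrightarrow> u m = u n) \<Longrightarrow> eventually_periodic u"
  unfolding eventually_periodic_def by metis

lemma liminf_average_nonneg:
  fixes s :: "nat \<Rightarrow> real"
  assumes "\<And>n. c \<le> s n"
  shows "0 \<le> liminf (\<lambda>n. ereal (s n / real n))"
proof -
  have "(\<lambda>n. ereal (c / real n)) \<longlonglongrightarrow> ereal 0" by (intro tendsto_ereal lim_const_over_n)
  then have "ereal 0 = liminf (\<lambda>n. ereal (c / real n))" by (intro lim_imp_Liminf[symmetric]) auto
  also have "\<dots> \<le> liminf (\<lambda>n. ereal (s n / real n))"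
    using assms by (intro Liminf_mono always_eventually) (auto intro: divide_right_mono)
  finally show ?thesis by (simp add: zero_ereal_def)
qed

lemma liminf_average_if_periodic_increments:
  fixes s :: "nat \<Rightarrow> real"
  assumes c: "0 < c" and s: "\<And>n. m \<le> n \<Longrightarrow> s (n + c) = s n + g"
  shows "liminf (\<lambda>n. ereal (s n / real n)) \<le> ereal (g / real c)"
proof -
  define r where "r k = m + k * c" for k
  have s_r: "s (r k) = s m + real k * g" for k
    by (induction k) (use s[of "r _"] in \<open>simp_all add: r_def algebra_simps\<close>)
  have "(\<lambda>k. (s m / real k + g) / (real m / real k + real c)) \<longlonglongrightarrow> (0 + g) / (0 + real c)"
    using c by (intro tendsto_intros lim_const_over_n) simp
  moreover have "\<forall>\<^sub>F k in sequentially.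
      (s m / real k + g) / (real m / real k + real c) = s (r k) / real (r k)"
  proof (intro eventually_sequentiallyI[of 1])
    fix k :: nat assume "1 \<le> k"
    then have "(s m / real k + g) / (real m / real k + real c) =
        (real k * (s m / real k + g)) / (real k * (real m / real k + real c))" by simp
    also have "\<dots> = s (r k) / real (r k)"
      using \<open>1 \<le> k\<close> unfolding s_r by (simp add: r_def distrib_left)
    finally show "(s m / real k + g) / (real m / real k + real c) = s (r k) / real (r k)" .
  qed
  ultimately have "(\<lambda>k. s (r k) / real (r k)) \<longlonglongrightarrow> (0 + g) / (0 + real c)"
    by (rule Lim_transform_eventually)
  then have "liminf (\<lambda>k. ereal (s (r k) / real (r k))) = ereal (g / real c)"
    by (intro lim_imp_Liminf) simp_all
  moreover have "strict_mono r" using c by (simp add: r_def strict_mono_def)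
  ultimately show ?thesis
    using liminf_subseq_mono[of r "\<lambda>n. ereal (s n / real n)"] by (simp add: o_def)
qed

lemma bdd_below_sum_if_liminf_average_nonneg:
  fixes a :: "real word"
  assumes "eventually_periodic a" and avg: "0 \<le> liminf (\<lambda>n. ereal ((\<Sum>k<n. a k) / real n))"
  shows "\<exists>c. \<forall>n. c \<le> (\<Sum>k<n. a k)"
proof -
  define s where "s n = (\<Sum>k<n. a k)" for n
  obtain m c where c: "0 < c" and a: "\<And>n. m \<le> n \<Longrightarrow> a (n + c) = a n"
    using assms(1) by (auto simp: eventually_periodic_def)
  define g where "g = s (m + c) - s m"
  have s: "s (n + c) = s n + g" if "m \<le> n" for n
    using that by (induction n rule: dec_induct) (simp_all add: a s_def g_def)
  have "0 \<le> liminf (\<lambda>n. ereal (s n / real n))" using avg by (simp add: s_def)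
  also have "\<dots> \<le> ereal (g / real c)" using c s by (rule liminf_average_if_periodic_increments)
  finally have g: "0 \<le> g" using c by (simp add: zero_le_divide_iff zero_ereal_def)
  have "Min (s ` {..m + c}) \<le> s n" for n
  proof (induction n rule: less_induct)
    case (less n)
    show ?case
    proof (cases "n \<le> m + c")
      case False
      then have "s n = s (n - c) + g" using s[of "n - c"] by simp
      then show ?thesis using less[of "n - c"] g c False by simp
    qed simp
  qed
  then show ?thesis unfolding s_def by blast
qed

section \<open>Realizability and the game graph\<close>

subsection \<open>Positional strategies of Player I\<close>

context ltl_game
begin

definition strat_I :: "(('q, 'p) vertex \<Rightarrow> ('q, 'p) vertex) \<Rightarrow> 'p round list \<Rightarrow> 'p set \<Rightarrow> 'p set" where
  "strat_I t h x = vertex_letter (t (V2 (vertex_state (hist_vertex h)) x)) \<inter> Inp"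

lemma strat_I_in_strategies_I: "strat_I t \<in> strategies_I Inp Out"
  by (auto simp: strategies_I_def strat_I_def)

lemma conform_strat_I:
  assumes sO: "sO \<in> strategies_O Inp Out" and t: "positional G (- player_O) t"
  shows "infpath (conform G (- player_O) t) (play_path sO (strat_I t))"
  unfolding infpath_def
proof
  fix n
  let ?u = "play_path sO (strat_I t)"
  have edge: "(?u n, ?u (Suc n)) \<in> G"
    using infpathD[OF infpath_play_path[OF sO strat_I_in_strategies_I]] .
  show "(?u n, ?u (Suc n)) \<in> conform G (- player_O) t"
  proof (cases n rule: even_odd_cases)
    case (even m)
    have "?u n \<in> player_O" unfolding even play_path_even by (subst hist_vertex_eq_V1) simp
    then show ?thesis using edge by (simp add: conform_def)
  next
    case (odd m)
    define h where "h = play_prefix sO (strat_I t) m"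
    define q x where "q = vertex_state (hist_vertex h)" and "x = sO h"
    have u_n: "?u (Suc (2 * m)) = V2 q x" unfolding play_path_odd by (simp add: q_def x_def h_def)
    then have "(V2 q x, t (V2 q x)) \<in> G" using t edge by (auto simp: positional_def odd)
    then obtain i where t: "t (V2 q x) = V1 (delta A q (x \<union> i)) i" "i \<subseteq> Inp"
      by (cases "t (V2 q x)") auto
    then have "strat_I t h x = i" by (auto simp: strat_I_def q_def[symmetric])
    then have "?u (2 * Suc m) = t (V2 q x)"
      unfolding play_path_even by (simp add: Let_def flip: h_def x_def) (simp add: t flip: q_def)
    then show ?thesis using edge by (simp add: conform_def u_n odd)
  qed
qed

lemma eventually_periodic_outcome:
  assumes sO: "sO \<in> strategies_O Inp Out" and mem: "memory_size Inp Out sO k"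
  shows "eventually_periodic (outcome sO (strat_I t))"
proof -
  let ?H = "histories Inp Out" and ?sI = "strat_I t"
  obtain R where R: "right_congruence Inp Out R" "finite (?H // R)"
    and const: "\<forall>(h, h') \<in> R. sO h = sO h'"
    using mem unfolding memory_size_def by blast
  have equiv: "equiv ?H R"
    and cong: "\<And>h h' r. (h, h') \<in> R \<Longrightarrow> r \<in> Pow Out \<times> Pow Inp \<Longrightarrow> (h @ [r], h' @ [r]) \<in> R"
    using R(1) unfolding right_congruence_def by blast+
  define h where "h n = play_prefix sO ?sI n" for n
  define r where "r n = (sO (h n), ?sI (h n) (sO (h n)))" for n
  have h: "h n \<in> ?H" "r n \<in> Pow Out \<times> Pow Inp" "h (Suc n) = h n @ [r n]" for n
    using play_prefix_in_histories[OF sO strat_I_in_strategies_I]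
      move_O_in_Pow[OF sO strat_I_in_strategies_I] move_I_in_Pow[OF sO strat_I_in_strategies_I]
    by (simp_all add: h_def r_def Let_def)
  define z where "z n = (R `` {h n}, hist_vertex (h n))" for n
  have det: "(h m, h n) \<in> R" "r m = r n" if "z m = z n" for m n
  proof -
    show "(h m, h n) \<in> R" using that eq_equiv_class[OF _ equiv h(1)] by (simp add: z_def)
    then have "sO (h m) = sO (h n)" using const by blast
    then show "r m = r n" using that by (simp add: r_def z_def strat_I_def)
  qed
  have "eventually_periodic z"
  proof (rule eventually_periodic_if_deterministic)
    have "z n \<in> (?H // R) \<times> S" for n
      using h(1) hist_vertex_in_S by (auto simp: z_def intro: quotientI)
    then have "range z \<subseteq> (?H // R) \<times> S" by blast
    then show "finite (range z)" using R(2) finite_S by (meson finite_SigmaI finite_subset)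
    fix m n assume mn: "z m = z n"
    have "(h (Suc m), h (Suc n)) \<in> R"
      using cong[OF det(1)[OF mn] h(2)[of n]] det(2)[OF mn] by (simp add: h(3))
    moreover have "hist_vertex (h (Suc m)) = hist_vertex (h (Suc n))"
      using mn det(2)[OF mn] by (cases "r n") (simp add: h(3) z_def)
    ultimately show "z (Suc m) = z (Suc n)" using equiv_class_eq[OF equiv] by (simp add: z_def)
  qed
  then show ?thesis
  proof (rule eventually_periodic_mono)
    have "outcome sO ?sI n = fst (r n) \<union> snd (r n)" for n
      by (simp add: outcome_def Let_def r_def h_def)
    then show "outcome sO ?sI m = outcome sO ?sI n" if "z m = z n" for m n
      using det(2)[OF that] by simp
  qed
qed

end

subsection \<open>Energy levels and payoffs\<close>

locale weighted_game = ltl_game Inp Out \<phi> A j\<^sub>0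
  for Inp Out :: "'p set" and \<phi> and A :: "('q, 'p) automaton" and j\<^sub>0 +
  fixes w\<^sub>P :: "'p lit \<Rightarrow> int" and \<nu> :: rat and w :: "'p lit \<Rightarrow> rat" and b :: nat
  assumes letter_weight_shift: "\<And>\<sigma>. \<sigma> \<subseteq> Inp \<union> Out \<Longrightarrow>
      letter_weight Inp Out w \<sigma> = letter_weight Inp Out (\<lambda>l. rat_of_int (w\<^sub>P l)) \<sigma> - \<nu>"
    and b_pos: "0 < b" and integral: "\<And>e. e \<in> G \<Longrightarrow> of_nat b * edge_weight Inp Out w e \<in> \<int>"
begin

abbreviation W\<^sub>P :: "'p lit \<Rightarrow> rat" where "W\<^sub>P \<equiv> \<lambda>l. rat_of_int (w\<^sub>P l)"

definition int_weight :: "('q, 'p) vertex \<Rightarrow> int" where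
  "int_weight v = \<lfloor>of_nat b * vertex_weight Inp Out w v\<rfloor>"

abbreviation objective :: "('q, 'p) vertex word \<Rightarrow> bool" where
  "objective \<equiv> energy_parity True int_weight (vertex_prio A)"

abbreviation unbeaten :: bool where
  "unbeaten \<equiv> v\<^sub>0 \<notin> avoid_region G (- player_O) objective"

lemma of_int_int_weight:
  assumes "v \<in> S"
  shows "of_int (int_weight v) = of_nat b * vertex_weight Inp Out w v"
proof -
  obtain e where "e \<in> G" "edge_weight Inp Out w e = vertex_weight Inp Out w v"
    using assms by (rule ex_edge_of_vertex_weight)
  then have "of_nat b * vertex_weight Inp Out w v \<in> \<int>" using integral by metis
  then show ?thesis unfolding int_weight_def by (auto elim: Ints_cases)
qed

context
  fixes sO sI
  assumes sO: "sO \<in> strategies_O Inp Out" and sI: "sI \<in> strategies_I Inp Out"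
begin

lemma esum_play_path:
  "of_int (esum int_weight (play_path sO sI) (Suc (2 * n))) =
     of_nat b * (vertex_weight Inp Out w v\<^sub>0 + EL Inp Out w (outcome sO sI) n)"
proof (induction n)
  case 0
  then show ?case using of_int_int_weight[OF v0_in_S] by (simp add: EL_def)
next
  case (Suc n)
  have "of_int (esum int_weight (play_path sO sI) (Suc (2 * Suc n))) =
      of_int (esum int_weight (play_path sO sI) (Suc (2 * n))) +
      (of_int (int_weight (play_path sO sI (Suc (2 * n)))) +
        of_int (int_weight (play_path sO sI (2 * Suc n))) :: rat)"
    by simp
  also have "\<dots> = of_nat b * (vertex_weight Inp Out w v\<^sub>0 + EL Inp Out w (outcome sO sI) n) +
      of_nat b * letter_weight Inp Out w (outcome sO sI n)"
    unfolding Suc letter_weight_outcome[OF sO sI] of_int_int_weight[OF play_path_in_S[OF sO sI]]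
    by (simp add: distrib_left)
  finally show ?case by (simp add: EL_def distrib_left)
qed

lemma bdd_below_esum_play_path:
  assumes "\<And>n. c \<le> EL Inp Out w (outcome sO sI) n"
  shows "bdd_below (range (esum int_weight (play_path sO sI)))"
proof -
  let ?u = "play_path sO sI"
  define d where "d = \<lfloor>of_nat b * (vertex_weight Inp Out w v\<^sub>0 + c)\<rfloor>"
  define M where "M = Max (int_weight ` S)"
  have odd: "d \<le> esum int_weight ?u (Suc (2 * n))" for n
  proof -
    have "of_nat b * (vertex_weight Inp Out w v\<^sub>0 + c) \<le> of_int (esum int_weight ?u (Suc (2 * n)))"
      unfolding esum_play_path using assms by (intro mult_left_mono) auto
    then show ?thesis unfolding d_def by linarith
  qed
  have "int_weight (?u n) \<le> M" for n
    unfolding M_def using play_path_in_S[OF sO sI] finite_S by (intro Max_ge) auto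
  then have even: "d - M \<le> esum int_weight ?u (2 * n)" for n
    using odd[of n] by (smt (verit) esum_Suc)
  have "min d (d - M) \<le> esum int_weight ?u n" for n
    by (cases n rule: even_odd_cases) (use odd even in \<open>auto simp: min_le_iff_disj\<close>)
  then show ?thesis by (rule bdd_belowI2)
qed

lemma EL_ge:
  assumes "\<And>n. - D \<le> esum int_weight (play_path sO sI) n"
  shows "- (of_int D / of_nat b + vertex_weight Inp Out w v\<^sub>0) \<le> EL Inp Out w (outcome sO sI) n"
proof -
  have "of_int (- D) \<le> (of_int (esum int_weight (play_path sO sI) (Suc (2 * n))) :: rat)"
    using assms by (simp only: of_int_le_iff)
  also have "\<dots> = of_nat b * (vertex_weight Inp Out w v\<^sub>0 + EL Inp Out w (outcome sO sI) n)"
    by (rule esum_play_path)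
  finally show ?thesis using b_pos by (simp add: field_simps)
qed

lemma MP_shift:
  "MP Inp Out W\<^sub>P (outcome sO sI) = MP Inp Out w (outcome sO sI) + ereal (real_of_rat \<nu>)"
proof -
  let ?u = "outcome sO sI"
  have "?u k \<subseteq> Inp \<union> Out" for k using outcome_in_words[OF sO sI] by (auto simp: words_def)
  then have "EL Inp Out W\<^sub>P ?u n = EL Inp Out w ?u n + of_nat n * \<nu>" for n
    by (simp add: EL_def letter_weight_shift sum_subtractf)
  then have "ereal (real_of_rat (EL Inp Out W\<^sub>P ?u n) / real n) =
      ereal (real_of_rat (EL Inp Out w ?u n) / real n) + ereal (real_of_rat \<nu>)" if "1 \<le> n" for n
    using that by (simp add: of_rat_add of_rat_mult add_divide_distrib)
  then have "MP Inp Out W\<^sub>P ?u =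
      liminf (\<lambda>n. ereal (real_of_rat (EL Inp Out w ?u n) / real n) + ereal (real_of_rat \<nu>))"
    unfolding MP_def by (intro Liminf_eq eventually_sequentiallyI)
  also have "\<dots> = MP Inp Out w ?u + ereal (real_of_rat \<nu>)"
    unfolding MP_def by (rule Liminf_add_ereal_right) simp_all
  finally show ?thesis .
qed

lemma MP_ge_iff:
  "ereal (real_of_rat \<nu>) \<le> MP Inp Out W\<^sub>P (outcome sO sI) \<longleftrightarrow> 0 \<le> MP Inp Out w (outcome sO sI)"
  unfolding MP_shift by (cases "MP Inp Out w (outcome sO sI)") (auto simp: zero_ereal_def)

end

lemma unbeaten_if_ex_play:
  assumes "\<And>t. positional G (- player_O) t \<Longrightarrow>
    \<exists>sO \<in> strategies_O Inp Out. outcome sO (strat_I t) \<Turnstile> \<phi> \<and>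
      (\<exists>c. \<forall>n. c \<le> EL Inp Out w (outcome sO (strat_I t)) n)"
  shows unbeaten
proof
  assume "v\<^sub>0 \<in> avoid_region G (- player_O) objective"
  then obtain t where t: "positional G (- player_O) t"
      "avoids (conform G (- player_O) t) objective v\<^sub>0"
    by (rule avoid_regionE)
  obtain sO c where sO: "sO \<in> strategies_O Inp Out" and sat: "outcome sO (strat_I t) \<Turnstile> \<phi>"
    and c: "\<And>n. c \<le> EL Inp Out w (outcome sO (strat_I t)) n"
    using assms[OF t(1)] by blast
  have "objective (play_path sO (strat_I t))"
    using bdd_below_esum_play_path[OF sO strat_I_in_strategies_I c] sat
      sat_iff_parity_play_path[OF sO strat_I_in_strategies_I] by (simp add: energy_parity_def)
  then show False using avoidsD[OF t(2) conform_strat_I[OF sO t(1)]] by simp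
qed

lemma unbeaten_if_E_realizable:
  assumes "E_realizable Inp Out \<phi> w"
  shows unbeaten
proof (rule unbeaten_if_ex_play)
  fix t
  obtain sO and c\<^sub>0 :: nat where "sO \<in> strategies_O Inp Out" "outcome sO (strat_I t) \<Turnstile> \<phi>"
    and c: "\<And>n. 0 \<le> of_nat c\<^sub>0 + EL Inp Out w (outcome sO (strat_I t)) n"
    using assms strat_I_in_strategies_I unfolding E_realizable_def by blast
  moreover have "- of_nat c\<^sub>0 \<le> EL Inp Out w (outcome sO (strat_I t)) n" for n
    using c[of n] by linarith
  ultimately show "\<exists>sO \<in> strategies_O Inp Out. outcome sO (strat_I t) \<Turnstile> \<phi> \<and>
      (\<exists>c. \<forall>n. c \<le> EL Inp Out w (outcome sO (strat_I t)) n)" by blast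
qed

lemma unbeaten_if_MP_realizable_fm:
  assumes "MP_realizable_fm Inp Out \<phi> W\<^sub>P \<nu>"
  shows unbeaten
proof (rule unbeaten_if_ex_play)
  fix t
  let ?u = "\<lambda>sO. outcome sO (strat_I t)"
  obtain sO k where sO: "sO \<in> strategies_O Inp Out" and mem: "memory_size Inp Out sO k"
    and "ereal (real_of_rat \<nu>) \<le> Val Inp Out \<phi> W\<^sub>P (?u sO)"
    using assms strat_I_in_strategies_I unfolding MP_realizable_fm_def MP_winning_def by blast
  then have sat: "?u sO \<Turnstile> \<phi>" and "ereal (real_of_rat \<nu>) \<le> MP Inp Out W\<^sub>P (?u sO)"
    by (auto simp: Val_def split: if_splits)
  then have avg: "0 \<le> liminf (\<lambda>n. ereal (real_of_rat (EL Inp Out w (?u sO) n) / real n))"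
    using MP_ge_iff[OF sO strat_I_in_strategies_I] by (simp add: MP_def)
  define a where "a k = real_of_rat (letter_weight Inp Out w (?u sO k))" for k
  have sum: "(\<Sum>k<n. a k) = real_of_rat (EL Inp Out w (?u sO) n)" for n
    by (simp add: a_def EL_def of_rat_sum)
  have "eventually_periodic a"
    using eventually_periodic_outcome[OF sO mem, of t]
    by (rule eventually_periodic_mono) (simp add: a_def)
  then obtain c where c: "\<And>n. c \<le> real_of_rat (EL Inp Out w (?u sO) n)"
    using bdd_below_sum_if_liminf_average_nonneg[of a] avg by (auto simp: sum)
  have "of_int \<lfloor>c\<rfloor> \<le> EL Inp Out w (?u sO) n" for n
  proof -
    have "real_of_rat (of_int \<lfloor>c\<rfloor>) \<le> real_of_rat (EL Inp Out w (?u sO) n)"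
      using order_trans[OF of_int_floor_le c] by simp
    then show ?thesis by (simp only: of_rat_less_eq)
  qed
  then show "\<exists>sO \<in> strategies_O Inp Out. ?u sO \<Turnstile> \<phi> \<and> (\<exists>c. \<forall>n. c \<le> EL Inp Out w (?u sO) n)"
    using sO sat by blast
qed

end

subsection \<open>Finite-memory strategies of Player O\<close>

lemma memory_size_kernel:
  assumes fin: "finite (f ` histories Inp Out)"
    and cong: "\<And>h h' r. f h = f h' \<Longrightarrow> f (h @ [r]) = f (h' @ [r])"
    and const: "\<And>h h'. f h = f h' \<Longrightarrow> sO h = sO h'"
  obtains k where "memory_size Inp Out sO k" "k \<le> card (f ` histories Inp Out)"
proof -
  let ?H = "histories Inp Out"
  define R where "R = {(h, h'). h \<in> ?H \<and> h' \<in> ?H \<and> f h = f h'}"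
  have snoc: "h @ [r] \<in> ?H" if "h \<in> ?H" "r \<in> Pow Out \<times> Pow Inp" for h r
    using that by (auto simp: histories_def)
  have "equiv ?H R"
    by (rule equivI) (auto simp: R_def refl_on_def sym_def trans_def)
  moreover have "(h @ [r], h' @ [r]) \<in> R" if "(h, h') \<in> R" "r \<in> Pow Out \<times> Pow Inp" for h h' r
    using that snoc[OF _ that(2)] cong[of h h' r] unfolding R_def by blast
  ultimately have "right_congruence Inp Out R"
    unfolding right_congruence_def by blast
  moreover have quot: "?H // R = (\<lambda>m. {h \<in> ?H. f h = m}) ` (f ` ?H)"
  proof -
    have "R `` {h} = {h' \<in> ?H. f h' = f h}" if "h \<in> ?H" for h using that by (auto simp: R_def)
    then show ?thesis by (auto simp: quotient_def image_iff)
  qed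
  then have "finite (?H // R)" using finite_imageI[OF fin] by simp
  moreover have "\<forall>(h, h') \<in> R. sO h = sO h'" unfolding R_def using const by blast
  ultimately have "memory_size Inp Out sO (card (?H // R))" unfolding memory_size_def by blast
  moreover have "card (?H // R) \<le> card (f ` ?H)" unfolding quot using fin by (rule card_image_le)
  ultimately show ?thesis by (rule that)
qed

context weighted_game
begin

definition config :: "int \<Rightarrow> 'p round list \<Rightarrow> ('q, 'p) vertex \<times> int" where
  "config D h = foldl (\<lambda>(v, e) (x, i). (V1 (delta A (vertex_state v) (x \<union> i)) i,
     cap_step D int_weight (V2 (vertex_state v) x) (cap_step D int_weight v e))) (v\<^sub>0, D) h"

definition config_strategy ::
  "(('q, 'p) vertex \<times> int \<Rightarrow> ('q, 'p) vertex \<times> int) \<Rightarrow> int \<Rightarrow> 'p round list \<Rightarrow> 'p set" where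
  "config_strategy s D h = vertex_letter (fst (s (config D h))) \<inter> Out"

lemma config_snoc: "config D (h @ [(x, i)]) =
    (V1 (delta A (vertex_state (fst (config D h))) (x \<union> i)) i,
     cap_step D int_weight (V2 (vertex_state (fst (config D h))) x)
       (cap_step D int_weight (fst (config D h)) (snd (config D h))))"
  by (simp add: config_def split_beta)

lemma fst_config: "fst (config D h) = hist_vertex h"
proof (induction h rule: rev_induct)
  case (snoc r h)
  then show ?case by (cases r) (simp add: config_snoc)
qed (simp add: config_def)

lemma config_bounds:
  assumes "0 \<le> D" "h \<in> histories Inp Out"
  shows "config D h \<in> S \<times> {- 1..D}"
proof -
  have "snd (config D h) \<in> {- 1..D}"
  proof (cases h rule: rev_cases)
    case (snoc g r)
    then show ?thesis
      by (cases r) (simp add: config_snoc cap_step_ge_minus_one cap_step_le[OF assms(1)])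
  qed (use assms(1) in \<open>simp add: config_def\<close>)
  then show ?thesis using hist_vertex_in_S[OF assms(2)] by (simp add: mem_Times_iff fst_config)
qed

lemma config_play_prefix:
  "config D (play_prefix sO sI n) =
     (play_path sO sI (2 * n), cap_level D int_weight (play_path sO sI) (2 * n))"
proof (induction n)
  case (Suc n)
  then have "snd (config D (play_prefix sO sI n)) =
      cap_level D int_weight (play_path sO sI) (2 * n)"
    by simp
  then have "snd (config D (play_prefix sO sI (Suc n))) =
      cap_level D int_weight (play_path sO sI) (2 * Suc n)"
    by (simp add: Let_def config_snoc fst_config play_path_even play_path_odd)
  then show ?case by (simp only: prod_eq_iff fst_config play_path_even fst_conv snd_conv)
qed (simp add: config_def)

lemma config_strategy_in_strategies_O: "config_strategy s D \<in> strategies_O Inp Out"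
  by (auto simp: strategies_O_def config_strategy_def)

lemma memory_size_config_strategy:
  assumes "0 \<le> D"
  obtains k where "memory_size Inp Out (config_strategy s D) k" "int k \<le> int (card S) * (D + 2)"
proof -
  let ?C = "config D ` histories Inp Out"
  have sub: "?C \<subseteq> S \<times> {- 1..D}" using config_bounds[OF assms] by blast
  have fin: "finite (S \<times> {- 1..D})" using finite_S by simp
  obtain k where k: "memory_size Inp Out (config_strategy s D) k" "k \<le> card ?C"
  proof (rule memory_size_kernel[where sO = "config_strategy s D", OF finite_subset[OF sub fin]])
    show "config D (h @ [r]) = config D (h' @ [r])" if "config D h = config D h'" for h h' r
      using that by (cases r) (simp add: config_snoc)
  qed (simp add: config_strategy_def)
  have "k \<le> card (S \<times> {- 1..D})" using k(2) card_mono[OF fin sub] by (rule order_trans)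
  also have "\<dots> = card S * nat (D + 2)" using assms by (simp add: card_cartesian_product add.commute)
  finally have "int k \<le> int (card S * nat (D + 2))" by (simp only: of_nat_le_iff)
  also have "\<dots> = int (card S) * (D + 2)" using assms by simp
  finally show ?thesis by (rule that[OF k(1)])
qed

context
  fixes X D s sI
  assumes X: "trap G (- player_O) X" and D: "0 \<le> D"
    and s: "positional (cap_edges (Restr G X) D int_weight) (cap_player player_O) s"
    and sI: "sI \<in> strategies_I Inp Out"
begin

abbreviation config_path :: "('q, 'p) vertex word" where
  "config_path \<equiv> play_path (config_strategy s D) sI"

lemma config_strategy_step:
  fixes n
  defines "e \<equiv> cap_level D int_weight config_path"
  assumes n: "config_path n \<in> Domain (Restr G X)" "0 \<le> e n"
  shows "((config_path n, e n), (config_path (Suc n), e (Suc n)))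
    \<in> cap_conform (Restr G X) player_O int_weight D s"
proof (cases n rule: even_odd_cases)
  case (even m)
  define h where "h = play_prefix (config_strategy s D) sI m"
  have path_n: "config_path n = V1 (vertex_state (hist_vertex h)) (vertex_letter (hist_vertex h))"
    unfolding even play_path_even h_def by (rule hist_vertex_eq_V1)
  have config: "config D h = (config_path n, e n)"
    unfolding h_def e_def even by (rule config_play_prefix)
  have "(config_path n, e n) \<in> Domain (cap_edges (Restr G X) D int_weight)"
    unfolding Domain_cap_edges[OF D] using n cap_level_le[OF D, of int_weight config_path n]
    by (simp add: e_def)
  then have edge: "((config_path n, e n), s (config_path n, e n))
      \<in> cap_edges (Restr G X) D int_weight"
    using s path_n by (simp add: positional_def)
  then obtain y where y: "s (config_path n, e n) = (y, e (Suc n))" "(config_path n, y) \<in> Restr G X"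
    using n(2) by (cases "s (config_path n, e n)") (auto simp: cap_edges_iff e_def)
  then obtain x where x: "y = V2 (vertex_state (hist_vertex h)) x" "x \<subseteq> Out"
    unfolding path_n by (cases y) auto
  have "config_strategy s D h = x" using x y(1) config by (auto simp: config_strategy_def)
  then have "config_path (Suc n) = y" unfolding even play_path_odd x(1) by (simp add: h_def)
  then show ?thesis using edge y(1) by (simp add: conform_def)
next
  case (odd m)
  have path_n: "config_path n \<notin> player_O" unfolding odd play_path_odd by simp
  have "(config_path n, config_path (Suc n)) \<in> G"
    by (rule infpathD[OF infpath_play_path[OF config_strategy_in_strategies_O sI]])
  then have "(config_path n, config_path (Suc n)) \<in> Restr G X"
    using trap_closed[OF X] n(1) path_n by blast
  then have "((config_path n, e n), (config_path (Suc n), e (Suc n)))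
      \<in> cap_edges (Restr G X) D int_weight"
    using n(2) cap_level_le[OF D] by (simp add: cap_edges_iff e_def)
  then show ?thesis using path_n by (simp add: conform_def)
qed

lemma config_strategy_wins:
  assumes v0: "v\<^sub>0 \<in> X"
    and win: "cap_wins (Restr G X) player_O int_weight (vertex_prio A) D s (v\<^sub>0, D)"
  shows "outcome (config_strategy s D) sI \<Turnstile> \<phi>" "- D \<le> esum int_weight config_path n"
proof -
  have path0: "config_path 0 \<in> Domain (Restr G X)" using v0 Domain_Restr_trap[OF X] by simp
  have "cap_wins (Restr G X) player_O int_weight (vertex_prio A) D s (config_path 0, D)"
    using win by simp
  note play = winning_cap_play[OF arena_Restr_trap[OF arena_G X] D s path0 this
      config_strategy_step]
  show "outcome (config_strategy s D) sI \<Turnstile> \<phi>"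
    using play(1) sat_iff_parity_play_path[OF config_strategy_in_strategies_O sI] by blast
  show "- D \<le> esum int_weight config_path n" by (rule play(2))
qed

end

lemma ex_finite_memory_strategy:
  fixes W :: int
  defines "D \<equiv> cap_bound W (vertex_prio A) S"
  assumes W: "1 \<le> W" "\<And>v. v \<in> S \<Longrightarrow> \<bar>int_weight v\<bar> \<le> W"
    and unbeaten: unbeaten
  obtains sO k where "sO \<in> strategies_O Inp Out" "memory_size Inp Out sO k"
    "int k \<le> int (card S) * (D + 2)"
    "\<And>sI. sI \<in> strategies_I Inp Out \<Longrightarrow> outcome sO sI \<Turnstile> \<phi>"
    "\<And>sI n. sI \<in> strategies_I Inp Out \<Longrightarrow> - D \<le> esum int_weight (play_path sO sI) n"
proof -
  define X where "X = S - avoid_region G (- player_O) objective"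
  define M where "M = cap_bound W (vertex_prio A) X"
  have X: "trap G (- player_O) X"
    using trap_compl_avoid_region[OF arena_G tail_closed_energy_parity]
    by (simp add: X_def Domain_G)
  have unbeaten_X: "avoid_region (Restr G X) (- player_O) objective = {}"
    using avoid_region_Restr_compl[OF arena_G tail_closed_energy_parity]
    by (simp add: X_def Domain_G)
  have M: "0 \<le> M" "M \<le> D"
    using W(1) finite_S by (auto simp: M_def D_def X_def intro: cap_bound_nonneg cap_bound_mono)
  have "cap_suffices (Restr G X) player_O int_weight (vertex_prio A) M"
    using cap_suffices_cap_bound[OF arena_Restr_trap[OF arena_G X] unbeaten_X W(1)] W(2)
    unfolding M_def Domain_Restr_trap[OF X] by (simp add: X_def)
  then obtain s where s: "positional (cap_edges (Restr G X) M int_weight) (cap_player player_O) s"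
    and win: "\<And>v. v \<in> Domain (Restr G X) \<Longrightarrow>
      cap_wins (Restr G X) player_O int_weight (vertex_prio A) M s (v, M)"
    using cap_suffices_strategy[OF arena_Restr_trap[OF arena_G X] M(1)] by blast
  have v0: "v\<^sub>0 \<in> X" using v0_in_S unbeaten by (simp add: X_def)
  then have "v\<^sub>0 \<in> Domain (Restr G X)" by (simp only: Domain_Restr_trap[OF X])
  note wins = config_strategy_wins[OF X M(1) s _ v0 win[OF this]]
  obtain k where k: "memory_size Inp Out (config_strategy s M) k" "int k \<le> int (card S) * (M + 2)"
    using M(1) by (rule memory_size_config_strategy)
  show ?thesis
  proof (rule that[OF config_strategy_in_strategies_O k(1)])
    have "int (card S) * (M + 2) \<le> int (card S) * (D + 2)" using M(2) by (intro mult_left_mono) auto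
    then show "int k \<le> int (card S) * (D + 2)" using k(2) by linarith
    show "- D \<le> esum int_weight (play_path (config_strategy s M) sI) n"
      if "sI \<in> strategies_I Inp Out" for sI n
      using wins(2)[OF that, of n] M(2) by linarith
  qed (rule wins(1))
qed

end

subsection \<open>Realizability and the memory bound\<close>

lemma ex_common_denominator:
  fixes F :: "rat set"
  assumes "finite F"
  shows "\<exists>b :: nat. 0 < b \<and> (\<forall>x \<in> F. of_nat b * x \<in> \<int>)"
  using assms
proof (induction F)
  case (insert x F)
  then obtain b :: nat where b: "0 < b" "\<forall>y \<in> F. of_nat b * y \<in> \<int>" by blast
  obtain m n where n: "0 < n" "x = of_int m / of_int n"
    using quotient_of_denom_pos' quotient_of_div by (metis prod.collapse)
  have "of_nat (b * nat n) * y \<in> \<int>" if "y \<in> insert x F" for y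
  proof (cases "y = x")
    case True
    then have "of_nat (b * nat n) * y = of_int (int b * m)" using n by simp
    then show ?thesis by (metis Ints_of_int)
  next
    case False
    then have "of_nat b * y \<in> \<int>" using b(2) that by auto
    then have "of_int n * (of_nat b * y) \<in> \<int>" by (rule Ints_mult[OF Ints_of_int])
    then show ?thesis using n(1) by (simp add: mult_ac)
  qed
  then show ?case using b(1) n(1) by (intro exI[of _ "b * nat n"]) simp
qed (auto intro: exI[of _ 1])

context weighted_game
begin

lemma card_S_ge_2: "2 \<le> card S"
proof -
  have "{v\<^sub>0, V2 (init A) {}} \<subseteq> S" using v0_in_S G_in_S[of v\<^sub>0 "V2 (init A) {}"] by simp
  then have "card {v\<^sub>0, V2 (init A) {}} \<le> card S" by (rule card_mono[OF finite_S])
  then show ?thesis by simp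
qed

lemma num_priorities_ge_1: "1 \<le> num_priorities Inp Out A j\<^sub>0"
proof -
  have "vertex_prio A ` S \<noteq> {}" using v0_in_S by blast
  then show ?thesis using finite_S by (simp add: num_priorities_def Suc_le_eq card_gt_0_iff)
qed

definition weight_bound :: rat where
  "weight_bound = max 1 (of_nat b * max_abs_weight Inp Out A j\<^sub>0 w)"

lemma abs_int_weight_le:
  assumes "v \<in> S"
  shows "\<bar>int_weight v\<bar> \<le> \<lfloor>weight_bound\<rfloor>"
proof -
  obtain e where e: "e \<in> G" "edge_weight Inp Out w e = vertex_weight Inp Out w v"
    using assms by (rule ex_edge_of_vertex_weight)
  have "finite G" using arena_G by (simp add: arena_def)
  then have "\<bar>edge_weight Inp Out w e\<bar> \<le> max_abs_weight Inp Out A j\<^sub>0 w"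
    unfolding max_abs_weight_def using e(1) by (intro Max_ge) auto
  then have "\<bar>of_nat b * edge_weight Inp Out w e\<bar> \<le> weight_bound"
    by (simp add: abs_mult mult_left_mono weight_bound_def le_max_iff_disj)
  then have "of_int \<bar>int_weight v\<bar> \<le> weight_bound"
    unfolding e(2) by (simp add: of_int_int_weight[OF assms])
  then show ?thesis by (simp only: le_floor_iff)
qed

lemma memory_bound:
  assumes "int k \<le> int (card S) * (cap_bound \<lfloor>weight_bound\<rfloor> (vertex_prio A) S + 2)"
  shows "of_nat k \<le> 4 * of_nat (card S) ^ 2 * of_nat (num_priorities Inp Out A j\<^sub>0) * weight_bound"
proof -
  let ?n = "card S" and ?d = "num_priorities Inp Out A j\<^sub>0" and ?W = "\<lfloor>weight_bound\<rfloor>"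
  have "1 \<le> ?W" by (simp add: le_floor_iff weight_bound_def)
  moreover have "int (2 * 1) \<le> int (?n * ?d)"
    using mult_le_mono[OF card_S_ge_2 num_priorities_ge_1] by (simp only: of_nat_le_iff)
  ultimately have "2 \<le> int (?n * ?d) * ?W" using mult_mono[of 2 "int (?n * ?d)" 1 ?W] by simp
  then have "int ?n * (cap_bound ?W (vertex_prio A) S + 2) \<le> int ?n * (4 * int (?n * ?d) * ?W)"
    by (intro mult_left_mono) (simp_all add: cap_bound_def num_priorities_def mult_ac)
  then have "int k \<le> 4 * int ?n ^ 2 * int ?d * ?W"
    using assms by (simp add: power2_eq_square mult_ac)
  then have "(of_int (int k) :: rat) \<le> of_int (4 * int ?n ^ 2 * int ?d * ?W)"
    by (simp only: of_int_le_iff)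
  also have "\<dots> = 4 * of_nat ?n ^ 2 * of_nat ?d * of_int ?W" by simp
  also have "\<dots> \<le> 4 * of_nat ?n ^ 2 * of_nat ?d * weight_bound" by (intro mult_left_mono) simp_all
  finally show ?thesis by simp
qed

lemma ex_strategy_if_unbeaten:
  assumes unbeaten
  obtains sO k C where "sO \<in> strategies_O Inp Out" "memory_size Inp Out sO k"
    "of_nat k \<le> 4 * of_nat (card S) ^ 2 * of_nat (num_priorities Inp Out A j\<^sub>0) * weight_bound"
    "\<And>sI. sI \<in> strategies_I Inp Out \<Longrightarrow> outcome sO sI \<Turnstile> \<phi>"
    "\<And>sI n. sI \<in> strategies_I Inp Out \<Longrightarrow> - C \<le> EL Inp Out w (outcome sO sI) n"
proof -
  have W: "1 \<le> \<lfloor>weight_bound\<rfloor>" by (simp add: le_floor_iff weight_bound_def)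
  obtain sO k where sO: "sO \<in> strategies_O Inp Out" and k: "memory_size Inp Out sO k"
      "int k \<le> int (card S) * (cap_bound \<lfloor>weight_bound\<rfloor> (vertex_prio A) S + 2)"
    and sat: "\<And>sI. sI \<in> strategies_I Inp Out \<Longrightarrow> outcome sO sI \<Turnstile> \<phi>"
    and esum: "\<And>sI n. sI \<in> strategies_I Inp Out \<Longrightarrow>
      - cap_bound \<lfloor>weight_bound\<rfloor> (vertex_prio A) S \<le> esum int_weight (play_path sO sI) n"
    by (rule ex_finite_memory_strategy[OF W abs_int_weight_le assms]) blast+
  show ?thesis by (rule that[OF sO k(1) memory_bound[OF k(2)] sat EL_ge[OF sO _ esum]])
qed

lemma E_realizable_iff_unbeaten:
  "E_realizable Inp Out \<phi> w \<longleftrightarrow> unbeaten"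
proof
  assume unbeaten
  then obtain sO k C where sO: "sO \<in> strategies_O Inp Out"
    and sat: "\<And>sI. sI \<in> strategies_I Inp Out \<Longrightarrow> outcome sO sI \<Turnstile> \<phi>"
    and EL: "\<And>sI n. sI \<in> strategies_I Inp Out \<Longrightarrow> - C \<le> EL Inp Out w (outcome sO sI) n"
    by (rule ex_strategy_if_unbeaten) blast
  obtain c\<^sub>0 where "C \<le> of_nat c\<^sub>0" using real_arch_simple by blast
  then have "0 \<le> of_nat c\<^sub>0 + EL Inp Out w (outcome sO sI) n" if "sI \<in> strategies_I Inp Out" for sI n
    using EL[OF that, of n] by linarith
  then show "E_realizable Inp Out \<phi> w" unfolding E_realizable_def using sO sat by blast
qed (rule unbeaten_if_E_realizable)

lemma MP_winning_strategy_if_unbeaten: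
  assumes unbeaten
  obtains sO k where "MP_winning Inp Out \<phi> W\<^sub>P \<nu> sO" "memory_size Inp Out sO k"
    "of_nat k \<le> 4 * of_nat (card S) ^ 2 * of_nat (num_priorities Inp Out A j\<^sub>0) * weight_bound"
proof -
  obtain sO k C where sO: "sO \<in> strategies_O Inp Out" and k: "memory_size Inp Out sO k"
      "of_nat k \<le> 4 * of_nat (card S) ^ 2 * of_nat (num_priorities Inp Out A j\<^sub>0) * weight_bound"
    and sat: "\<And>sI. sI \<in> strategies_I Inp Out \<Longrightarrow> outcome sO sI \<Turnstile> \<phi>"
    and EL: "\<And>sI n. sI \<in> strategies_I Inp Out \<Longrightarrow> - C \<le> EL Inp Out w (outcome sO sI) n"
    using assms by (rule ex_strategy_if_unbeaten) blast
  have "ereal (real_of_rat \<nu>) \<le> MP Inp Out W\<^sub>P (outcome sO sI)"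
    if sI: "sI \<in> strategies_I Inp Out" for sI
  proof -
    have "real_of_rat (- C) \<le> real_of_rat (EL Inp Out w (outcome sO sI) n)" for n
      using EL[OF sI] by (simp only: of_rat_less_eq)
    then show ?thesis unfolding MP_ge_iff[OF sO sI] unfolding MP_def by (rule liminf_average_nonneg)
  qed
  then have "MP_winning Inp Out \<phi> W\<^sub>P \<nu> sO" unfolding MP_winning_def Val_def using sO sat by simp
  then show ?thesis using k by (rule that)
qed

lemma MP_realizable_fm_iff_unbeaten:
  "MP_realizable_fm Inp Out \<phi> W\<^sub>P \<nu> \<longleftrightarrow> unbeaten"
proof
  assume unbeaten
  then obtain sO k where "MP_winning Inp Out \<phi> W\<^sub>P \<nu> sO" "memory_size Inp Out sO k"
    by (rule MP_winning_strategy_if_unbeaten)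
  then show "MP_realizable_fm Inp Out \<phi> W\<^sub>P \<nu>" unfolding MP_realizable_fm_def by blast
qed (rule unbeaten_if_MP_realizable_fm)

end

theorem theorem8:
  fixes Inp Out :: "'p set"
    and \<phi> :: "'p ltl"
    and w\<^sub>P :: "'p lit \<Rightarrow> int"
    and \<nu> :: rat
    and w\<^sub>\<nu> :: "'p lit \<Rightarrow> rat"
    and A :: "('q, 'p) automaton"
    and j\<^sub>0 :: "'p set"
  assumes "finite Inp" and "finite Out" and "Inp \<inter> Out = {}"
    and "atoms \<phi> \<subseteq> Inp \<union> Out"
    and "\<forall>\<sigma> \<in> Pow (Inp \<union> Out).
           letter_weight Inp Out w\<^sub>\<nu> \<sigma> = letter_weight Inp Out (\<lambda>l. rat_of_int (w\<^sub>P l)) \<sigma> - \<nu>"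
    and "parity_automaton (Inp \<union> Out) A"
    and "automaton_language (Inp \<union> Out) A = ltl_language (Inp \<union> Out) \<phi>"
    and "j\<^sub>0 \<in> Pow Inp"
  shows "(MP_realizable_fm Inp Out \<phi> (\<lambda>l. rat_of_int (w\<^sub>P l)) \<nu> \<longleftrightarrow> E_realizable Inp Out \<phi> w\<^sub>\<nu>) \<and>
         (MP_realizable_fm Inp Out \<phi> (\<lambda>l. rat_of_int (w\<^sub>P l)) \<nu> \<longrightarrow>
           (\<forall>b :: nat. b > 0 \<and>
              (\<forall>e \<in> game_edges Inp Out A j\<^sub>0. of_nat b * edge_weight Inp Out w\<^sub>\<nu> e \<in> \<int>) \<longrightarrow>
              (\<exists>sO k. MP_winning Inp Out \<phi> (\<lambda>l. rat_of_int (w\<^sub>P l)) \<nu> sO \<and>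
                 memory_size Inp Out sO k \<and>
                 of_nat k \<le> 4 * of_nat (card (game_states Inp Out A j\<^sub>0)) ^ 2
                            * of_nat (num_priorities Inp Out A j\<^sub>0)
                            * max 1 (of_nat b * max_abs_weight Inp Out A j\<^sub>0 w\<^sub>\<nu>))))"
proof -
  interpret ltl_game Inp Out \<phi> A j\<^sub>0 by unfold_locales (use assms in auto)
  have weighted: "weighted_game Inp Out \<phi> A j\<^sub>0 w\<^sub>P \<nu> w\<^sub>\<nu> b"
    if "0 < b" "\<forall>e \<in> G. of_nat b * edge_weight Inp Out w\<^sub>\<nu> e \<in> \<int>" for b
    by unfold_locales (use assms(5) that in auto)
  have "finite (edge_weight Inp Out w\<^sub>\<nu> ` G)" using arena_G by (simp add: arena_def)
  from ex_common_denominator[OF this] obtain b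
    where "0 < b" "\<forall>e \<in> G. of_nat b * edge_weight Inp Out w\<^sub>\<nu> e \<in> \<int>" by auto
  then interpret weighted_game Inp Out \<phi> A j\<^sub>0 w\<^sub>P \<nu> w\<^sub>\<nu> b by (rule weighted)
  have "MP_realizable_fm Inp Out \<phi> W\<^sub>P \<nu> \<longleftrightarrow> E_realizable Inp Out \<phi> w\<^sub>\<nu>"
    by (simp only: MP_realizable_fm_iff_unbeaten E_realizable_iff_unbeaten)
  moreover have "\<exists>sO k. MP_winning Inp Out \<phi> W\<^sub>P \<nu> sO \<and> memory_size Inp Out sO k \<and>
      of_nat k \<le> 4 * of_nat (card S) ^ 2 * of_nat (num_priorities Inp Out A j\<^sub>0) *
        max 1 (of_nat b * max_abs_weight Inp Out A j\<^sub>0 w\<^sub>\<nu>)"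
    if MP: "MP_realizable_fm Inp Out \<phi> W\<^sub>P \<nu>"
      and b: "0 < b" "\<forall>e \<in> G. of_nat b * edge_weight Inp Out w\<^sub>\<nu> e \<in> \<int>" for b
  proof -
    interpret scaled: weighted_game Inp Out \<phi> A j\<^sub>0 w\<^sub>P \<nu> w\<^sub>\<nu> b by (rule weighted[OF b])
    show ?thesis
      using MP unfolding scaled.MP_realizable_fm_iff_unbeaten
      by (rule scaled.MP_winning_strategy_if_unbeaten) (auto simp: scaled.weight_bound_def)
  qed
  ultimately show ?thesis by blast
qed

end
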